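(* Let $(P,[\cdot_\lambda\cdot],\cdot_\lambda\cdot)$ be a Poisson conformal algebra and $(V,\rho_P,l_P)$ a representation of it. Assume that $P$ and $V$ are free as $\mathbf k[\partial]$-modules. Let $T\in\mathrm{Chom}(V,P)$ and let $r_T\in P\otimes V^{\ast c}\subset(P\ltimes_{\rho_P^\ast,-l_P^\ast}V^{\ast c})\otimes(P\ltimes_{\rho_P^\ast,-l_P^\ast}V^{\ast c})$ be the element corresponding to $T$. Then $r=r_T-\tau r_T$ is a skew-symmetric solution of the Poisson conformal Yang-Baxter equation (PCYBE) in $P\ltimes_{\rho_P^\ast,-l_P^\ast}V^{\ast c}$ if and only if $T_0=T_\lambda|_{\lambda=0}$ is an $\mathcal O$-operator on $(P,[\cdot_\lambda\cdot],\cdot_\lambda\cdot)$ associated with $(V,\rho_P,l_P)$.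
   Context: Let $\mathbf k$ be a field of characteristic $0$. All $\mathbf k[\partial]$-modules are assumed finitely generated; $\otimes$ is over $\mathbf k$, $I$ is the identity, $\tau(u\otimes v)=v\otimes u$. An associative conformal algebra is a $\mathbf k[\partial]$-module $P$ with a $\mathbf k$-bilinear map $P\times P\to P[\lambda]$, $(a,b)\mapsto a_\lambda b$, with $(\partial a)_\lambda b=-\lambda a_\lambda b$, $a_\lambda(\partial b)=(\partial+\lambda)a_\lambda b$, $(a_\lambda b)_{\lambda+\mu}c=a_\lambda(b_\mu c)$; it is commutative if $a_\lambda b=b_{-\lambda-\partial}a$. (If $b_\nu a=\sum_k\nu^kc_k$, then $b_{-\lambda-\partial}a=\sum_k(-\lambda-\partial)^kc_k$; similarly for other substitutions.) A Lie conformal algebra is a $\mathbf k[\partial]$-module $P$ with a $\mathbf k$-bilinear map $[\cdot_\lambda\cdot]:P\times P\to P[\lambda]$ with $[(\partial a)_\lambda b]=-\lambda[a_\lambda b]$, $[a_\lambda(\partial b)]=(\partial+\lambda)[a_\lambda b]$, $[a_\lambda b]=-[b_{-\lambda-\partial}a]$, $[a_\lambda[b_\mu c]]=[[a_\lambda b]_{\lambda+\mu}c]+[b_\mu[a_\lambda c]]$. A Poisson conformal algebra $(P,[\cdot_\lambda\cdot],\cdot_\lambda\cdot)$ is both a Lie conformal algebra and a commutative associative conformal algebra such that $[a_\lambda(b_\mu c)]=[a_\lambda b]_{\lambda+\mu}c+b_\mu[a_\lambda c]$. A conformal linear map $f:U\to V$ of $\mathbf k[\partial]$-modules is a $\mathbf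 k$-linear map $f_\lambda:U\to V[\lambda]$ with $f_\lambda(\partial u)=(\partial+\lambda)f_\lambda u$; they form a $\mathbf k[\partial]$-module $\mathrm{Chom}(U,V)$ with $(\partial f)_\lambda=-\lambda f_\lambda$; $\mathrm{gc}(V)=\mathrm{Chom}(V,V)$; $U^{\ast c}=\mathrm{Chom}(U,\mathbf k)$ with $\mathbf k$ the trivial module. A representation of a Poisson conformal algebra $P$ is a triple $(V,\rho_P,l_P)$, with $V$ a $\mathbf k[\partial]$-module and $\rho_P,l_P:P\to\mathrm{gc}(V)$ $\mathbf k[\partial]$-module homomorphisms, such that $\rho_P([a_\lambda b])_{\lambda+\mu}v=\rho_P(a)_\lambda(\rho_P(b)_\mu v)-\rho_P(b)_\mu(\rho_P(a)_\lambda v)$, $l_P(a_\lambda b)_{\lambda+\mu}v=l_P(a)_\lambda(l_P(b)_\mu v)$, $\rho_P(a_\mu b)_{-\lambda-\partial}v=l_P(b)_{-\lambda-\mu-\partial}(\rho_P(a)_{-\lambda-\partial}v)+l_P(a)_\mu(\rho_P(b)_{-\lambda-\partial}v)$ and $\rho_P(a)_\lambda(l_P(b)_\mu v)=l_P([a_\lambda b])_{\lambda+\mu}v+l_P(b)_\mu(\rho_P(a)_\lambda v)$. The semi-direct product $P\ltimes_{\rho_P,l_P}V$ is the Poisson conformal algebra $P\oplus V$ with $(a+u)_\lambda(b+v)=a_\lambda b+l_P(a)_\lambda v+l_P(b)_{-\lambda-\partial}u$ and $[(a+u)_\lambda(b+v)]=[a_\lambda b]+\rho_P(a)_\lambda v-\rho_P(b)_{-\lambda-\partial}u$.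 For $\varphi:P\to\mathrm{gc}(V)$, $\varphi^\ast:P\to\mathrm{gc}(V^{\ast c})$ is $(\varphi^\ast(a)_\lambda f)_\mu u=-f_{\mu-\lambda}(\varphi(a)_\lambda u)$. For $P,V$ free, $(V^{\ast c},\rho_P^\ast,-l_P^\ast)$ is again a representation of $P$. Correspondence $T\leftrightarrow r_T$: for $P,V$ free, $P\otimes V^{\ast c}\to\mathrm{Chom}(V,P)$, $a\otimes f\mapsto\big(v\mapsto f_{\lambda+\partial^P}(v)\,a\big)$ is an isomorphism of $\mathbf k[\partial]$-modules ($f_\nu(v)\in\mathbf k[\nu]$ is evaluated at $\nu=\lambda+\partial^P$, $\partial^P$ being the action of $\partial$ on $P$, and applied to $a$). $r_T$ is the preimage of $T$, i.e. $r_T=\sum_ka_k\otimes f_k$ with $T_\lambda(v)=\sum_k(f_k)_{\lambda+\partial^P}(v)\,a_k$. An $\mathcal O$-operator on $P$ associated with $(V,\rho_P,l_P)$ is a $\mathbf k[\partial]$-module homomorphism $T:V\to P$ with $T(u)_\lambda T(v)=T(l_P(T(u))_\lambda v)+T(l_P(T(v))_{-\lambda-\partial}u)$ and $[T(u)_\lambda T(v)]=T(\rho_P(T(u))_\lambda v)-T(\rho_P(T(v))_{-\lambda-\partial}u)$ for all $u,v\in V$. For a Poisson conformal algebra $Q$, put $\partial^{\otimes^2}=\partial\otimes I+I\otimes\partial$, $\partial^{\otimes^3}=\partial\otimes I\otimes I+I\otimes\partial\otimes I+I\otimes I\otimes\partial$, and for $r=\sum_ir_i\otimes l_i\in Q\otimes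 Q$: $[[r,r]]=\sum_{i,j}\big([{r_i}_\mu r_j]\otimes l_i\otimes l_j|_{\mu=I\otimes\partial\otimes I}-r_i\otimes[{r_j}_\mu l_i]\otimes l_j|_{\mu=I\otimes I\otimes\partial}-r_i\otimes r_j\otimes[{l_j}_\mu l_i]|_{\mu=I\otimes\partial\otimes I}\big)$, $r\bullet r=\sum_{i,j}\big(r_i\otimes r_j\otimes{l_i}_\mu l_j|_{\mu=\partial\otimes I\otimes I}-r_i\otimes{r_j}_\mu l_i\otimes l_j|_{\mu=-\partial^{\otimes^2}\otimes I}+{r_i}_\mu r_j\otimes l_i\otimes l_j|_{\mu=I\otimes\partial\otimes I}\big)$, where a substitution means that the polynomial in $\mu$ acts on the tensor coefficients through the given operator. $r$ is a solution of the PCYBE in $Q$ if both $[[r,r]]$ and $r\bullet r$ lie in $\partial^{\otimes^3}(Q\otimes Q\otimes Q)$. *)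

theory Defs
  imports
    "HOL-Computational_Algebra.Polynomial"
    "HOL-Library.Function_Algebras"
    "HOL-Library.Product_Plus"
    "HOL-Library.Poly_Mapping"
begin

text \<open>
  Conventions. A \<open>k[\<partial>]\<close>-module is a \<^locale>\<open>module\<close> over the ring
  \<^typ>\<open>'k poly\<close> with \<open>\<partial> = [:0, 1:]\<close>; the scalar \<open>c \<in> k\<close> is \<open>[:c:]\<close>.
  \<open>M[\<lambda>]\<close> is \<open>'m poly\<close> and \<open>M[\<lambda>, \<mu>]\<close> is \<open>'m poly poly\<close>, where \<open>\<lambda>\<close> is the outer and
  \<open>\<mu>\<close> the inner indeterminate.
\<close>

section \<open>Polynomials with coefficients in a module, and substitution\<close>

definition der :: "('k::comm_ring_1 poly \<Rightarrow> 'm \<Rightarrow> 'm) \<Rightarrow> 'm \<Rightarrow> 'm" where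
  "der s x = s [:0, 1:] x"

definition lam :: "'m::zero poly \<Rightarrow> 'm poly" where
  "lam = pCons 0"

definition mu :: "'m::zero poly poly \<Rightarrow> 'm poly poly" where
  "mu = map_poly (pCons 0)"

definition der1 :: "('k::comm_ring_1 poly \<Rightarrow> 'm::zero \<Rightarrow> 'm) \<Rightarrow> 'm poly \<Rightarrow> 'm poly" where
  "der1 s = map_poly (der s)"

definition der2 :: "('k::comm_ring_1 poly \<Rightarrow> 'm::zero \<Rightarrow> 'm) \<Rightarrow> 'm poly poly \<Rightarrow> 'm poly poly" where
  "der2 s = map_poly (map_poly (der s))"

abbreviation const1 :: "'m::zero \<Rightarrow> 'm poly" where
  "const1 x \<equiv> [:x:]"

abbreviation const2 :: "'m::zero \<Rightarrow> 'm poly poly" where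
  "const2 x \<equiv> [:[:x:]:]"

text \<open>
  All substitutions are instances of \<open>\<Sum>\<^sub>k \<nu>\<^sup>k c\<^sub>k \<mapsto> \<Sum>\<^sub>k \<theta>\<^sup>k (h c\<^sub>k)\<close> for an operator \<open>\<theta>\<close>.
  Operators are added pointwise, so that for instance \<open>- lam - der1 s\<close> is the operator
  \<open>-\<lambda> - \<partial>\<close>. With \<open>h c = f\<^sub>\<mu> c\<close> and \<open>\<theta> = \<lambda>\<close>, this also extends a map \<open>f\<^sub>\<mu>\<close> on \<open>M\<close> to \<open>M[\<lambda>]\<close>.
\<close>

definition psubst :: "('n::comm_monoid_add \<Rightarrow> 'n) \<Rightarrow> ('m::zero \<Rightarrow> 'n) \<Rightarrow> 'm poly \<Rightarrow> 'n" where
  "psubst \<theta> h p = (\<Sum>k\<le>degree p. (\<theta> ^^ k) (h (coeff p k)))"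

section \<open>Poisson conformal algebras\<close>

text \<open>
  The underlying module is a submodule \<open>A\<close> of a module on a whole type, because the conformal dual
  is only a submodule of a function space.
\<close>

locale fg_module = module s
  for s :: "'k::field_char_0 poly \<Rightarrow> 'a::ab_group_add \<Rightarrow> 'a" +
  fixes A :: "'a set"
  assumes subspace_carrier: "module.subspace s A"
    and finitely_generated: "\<exists>S. finite S \<and> module.span s S = A"

definition free_module :: "('k::field_char_0 poly \<Rightarrow> 'a::ab_group_add \<Rightarrow> 'a) \<Rightarrow> bool" where
  "free_module s \<longleftrightarrow> (\<exists>B. \<not> module.dependent s B \<and> module.span s B = UNIV)"

locale conformal_product = fg_module s A
  for s :: "'k::field_char_0 poly \<Rightarrow> 'a::ab_group_add \<Rightarrow> 'a" and A +
  fixes prd :: "'a \<Rightarrow> 'a \<Rightarrow> 'a poly"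
  assumes closed: "\<lbrakk>a \<in> A; b \<in> A\<rbrakk> \<Longrightarrow> coeff (prd a b) n \<in> A"
    and add_left: "\<lbrakk>a \<in> A; a' \<in> A; b \<in> A\<rbrakk> \<Longrightarrow> prd (a + a') b = prd a b + prd a' b"
    and add_right: "\<lbrakk>a \<in> A; b \<in> A; b' \<in> A\<rbrakk> \<Longrightarrow> prd a (b + b') = prd a b + prd a b'"
    and scalar_left: "\<lbrakk>a \<in> A; b \<in> A\<rbrakk> \<Longrightarrow> prd (s [:c:] a) b = map_poly (s [:c:]) (prd a b)"
    and scalar_right: "\<lbrakk>a \<in> A; b \<in> A\<rbrakk> \<Longrightarrow> prd a (s [:c:] b) = map_poly (s [:c:]) (prd a b)"
    and der_left: "\<lbrakk>a \<in> A; b \<in> A\<rbrakk> \<Longrightarrow> prd (der s a) b = - lam (prd a b)"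
    and der_right: "\<lbrakk>a \<in> A; b \<in> A\<rbrakk> \<Longrightarrow> prd a (der s b) = (der1 s + lam) (prd a b)"

locale associative_conformal_algebra = conformal_product s A mul
  for s :: "'k::field_char_0 poly \<Rightarrow> 'a::ab_group_add \<Rightarrow> 'a" and A mul +
  assumes assoc: "\<lbrakk>a \<in> A; b \<in> A; c \<in> A\<rbrakk> \<Longrightarrow>
    psubst lam (\<lambda>x. psubst (lam + mu) const2 (mul x c)) (mul a b) =
    psubst mu (\<lambda>x. psubst lam const2 (mul a x)) (mul b c)"

locale comm_associative_conformal_algebra = associative_conformal_algebra s A mul
  for s :: "'k::field_char_0 poly \<Rightarrow> 'a::ab_group_add \<Rightarrow> 'a" and A mul +
  assumes comm: "\<lbrakk>a \<in> A; b \<in> A\<rbrakk> \<Longrightarrow> mul a b = psubst (- lam - der1 s) const1 (mul b a)"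

locale lie_conformal_algebra = conformal_product s A br
  for s :: "'k::field_char_0 poly \<Rightarrow> 'a::ab_group_add \<Rightarrow> 'a" and A br +
  assumes skew: "\<lbrakk>a \<in> A; b \<in> A\<rbrakk> \<Longrightarrow> br a b = - psubst (- lam - der1 s) const1 (br b a)"
    and jacobi: "\<lbrakk>a \<in> A; b \<in> A; c \<in> A\<rbrakk> \<Longrightarrow>
      psubst mu (\<lambda>x. psubst lam const2 (br a x)) (br b c) =
      psubst lam (\<lambda>x. psubst (lam + mu) const2 (br x c)) (br a b) +
      psubst lam (\<lambda>x. psubst mu const2 (br b x)) (br a c)"

locale poisson_conformal_algebra =
  lie: lie_conformal_algebra s A br + assoc: comm_associative_conformal_algebra s A mul
  for s :: "'k::field_char_0 poly \<Rightarrow> 'a::ab_group_add \<Rightarrow> 'a" and A br mul +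
  assumes leibniz: "\<lbrakk>a \<in> A; b \<in> A; c \<in> A\<rbrakk> \<Longrightarrow>
    psubst mu (\<lambda>x. psubst lam const2 (br a x)) (mul b c) =
    psubst lam (\<lambda>x. psubst (lam + mu) const2 (mul x c)) (br a b) +
    psubst lam (\<lambda>x. psubst mu const2 (mul b x)) (br a c)"

section \<open>Conformal linear maps and representations\<close>

definition chom :: "('k::field_char_0 poly \<Rightarrow> 'u::ab_group_add \<Rightarrow> 'u) \<Rightarrow>
    ('k poly \<Rightarrow> 'w::ab_group_add \<Rightarrow> 'w) \<Rightarrow> ('u \<Rightarrow> 'w poly) set" where
  "chom sU sW = {f. (\<forall>u u'. f (u + u') = f u + f u') \<and>
     (\<forall>c u. f (sU [:c:] u) = map_poly (sW [:c:]) (f u)) \<and>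
     (\<forall>u. f (der sU u) = (der1 sW + lam) (f u))}"

text \<open>
  The \<open>k[\<partial>]\<close>-action on \<open>Chom(U, W)\<close> determined by \<open>(\<partial> f)\<^sub>\<lambda> = -\<lambda> f\<^sub>\<lambda>\<close>, that is
  \<open>(p f)\<^sub>\<lambda> = p(-\<lambda>) f\<^sub>\<lambda>\<close>.
\<close>

definition chom_scale :: "('k::field_char_0 poly \<Rightarrow> 'w::ab_group_add \<Rightarrow> 'w) \<Rightarrow>
    'k poly \<Rightarrow> ('u \<Rightarrow> 'w poly) \<Rightarrow> 'u \<Rightarrow> 'w poly" where
  "chom_scale sW p f = (\<lambda>u. psubst (- lam) (\<lambda>c. map_poly (sW [:c:]) (f u)) p)"

definition trivial_scale :: "'k::field_char_0 poly \<Rightarrow> 'k \<Rightarrow> 'k" where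
  "trivial_scale p x = coeff p 0 * x"

definition cdual :: "('k::field_char_0 poly \<Rightarrow> 'v::ab_group_add \<Rightarrow> 'v) \<Rightarrow> ('v \<Rightarrow> 'k poly) set" where
  "cdual sV = chom sV trivial_scale"

definition cdual_scale :: "'k::field_char_0 poly \<Rightarrow> ('v \<Rightarrow> 'k poly) \<Rightarrow> 'v \<Rightarrow> 'k poly" where
  "cdual_scale = chom_scale trivial_scale"

locale poisson_conformal_representation =
  P: poisson_conformal_algebra sP UNIV br mul + V: fg_module sV UNIV
  for sP :: "'k::field_char_0 poly \<Rightarrow> 'p::ab_group_add \<Rightarrow> 'p" and br mul
    and sV :: "'k poly \<Rightarrow> 'v::ab_group_add \<Rightarrow> 'v" +
  fixes rho l :: "'p \<Rightarrow> 'v \<Rightarrow> 'v poly"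
  assumes rho_gc: "rho a \<in> chom sV sV"
    and l_gc: "l a \<in> chom sV sV"
    and rho_hom: "module_hom sP (chom_scale sV) rho"
    and l_hom: "module_hom sP (chom_scale sV) l"
    and rho_bracket:
      "psubst lam (\<lambda>x. psubst (lam + mu) const2 (rho x v)) (br a b) =
       psubst mu (\<lambda>w. psubst lam const2 (rho a w)) (rho b v) -
       psubst lam (\<lambda>w. psubst mu const2 (rho b w)) (rho a v)"
    and l_product:
      "psubst lam (\<lambda>x. psubst (lam + mu) const2 (l x v)) (mul a b) =
       psubst mu (\<lambda>w. psubst lam const2 (l a w)) (l b v)"
    and rho_product:
      "psubst mu (\<lambda>x. psubst (- lam - der2 sV) const2 (rho x v)) (mul a b) =
       psubst lam (\<lambda>w. psubst (- lam - mu - der2 sV) const2 (l b w))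
         (psubst (- lam - der1 sV) const1 (rho a v)) +
       psubst lam (\<lambda>w. psubst mu const2 (l a w))
         (psubst (- lam - der1 sV) const1 (rho b v))"
    and rho_l:
      "psubst mu (\<lambda>w. psubst lam const2 (rho a w)) (l b v) =
       psubst lam (\<lambda>x. psubst (lam + mu) const2 (l x v)) (br a b) +
       psubst lam (\<lambda>w. psubst mu const2 (l b w)) (rho a v)"

text \<open>
  \<open>(\<phi>\<^sup>*(a)\<^sub>\<lambda> f)\<^sub>\<mu> u = - f\<^sub>\<mu>\<^sub>-\<^sub>\<lambda> (\<phi>(a)\<^sub>\<lambda> u)\<close>. The element \<open>\<phi>\<^sup>*(a)\<^sub>\<lambda> f\<close> of \<open>V\<^sup>*\<^sup>c[\<lambda>]\<close> is the polynomial
  whose \<open>n\<close>-th coefficient maps \<open>u\<close> to the \<open>\<lambda>\<^sup>n\<close>-coefficient, in \<open>k[\<mu>]\<close>, of the right-hand side. The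
  right-hand side for \<open>\<partial> u\<close> is \<open>\<mu>\<close> times that for \<open>u\<close>, so its degree in \<open>\<lambda>\<close> is bounded in \<open>u\<close> when
  the module is finitely generated, and only finitely many of these coefficients are nonzero.
\<close>

definition dual_action :: "('p \<Rightarrow> 'v \<Rightarrow> 'v poly) \<Rightarrow>
    'p \<Rightarrow> ('v::ab_group_add \<Rightarrow> 'k::field_char_0 poly) \<Rightarrow> ('v \<Rightarrow> 'k poly) poly" where
  "dual_action phi a f =
     Abs_poly (\<lambda>n u. coeff (- psubst lam (\<lambda>w. psubst (mu - lam) const2 (f w)) (phi a u)) n)"

section \<open>Semi-direct products\<close>

definition prod_scale :: "('k poly \<Rightarrow> 'p \<Rightarrow> 'p) \<Rightarrow> ('k poly \<Rightarrow> 'w \<Rightarrow> 'w) \<Rightarrow>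
    'k::field_char_0 poly \<Rightarrow> 'p \<times> 'w \<Rightarrow> 'p \<times> 'w" where
  "prod_scale sP sW p = (\<lambda>(a, u). (sP p a, sW p u))"

definition inl_poly :: "'p::zero poly \<Rightarrow> ('p \<times> 'w::zero) poly" where
  "inl_poly = map_poly (\<lambda>a. (a, 0))"

definition inr_poly :: "'w::zero poly \<Rightarrow> ('p::zero \<times> 'w) poly" where
  "inr_poly = map_poly (\<lambda>u. (0, u))"

definition semidirect_mul :: "('k::field_char_0 poly \<Rightarrow> 'w \<Rightarrow> 'w) \<Rightarrow>
    ('p \<Rightarrow> 'p \<Rightarrow> 'p poly) \<Rightarrow> ('p \<Rightarrow> 'w \<Rightarrow> 'w poly) \<Rightarrow>
    'p::ab_group_add \<times> 'w::ab_group_add \<Rightarrow> 'p \<times> 'w \<Rightarrow> ('p \<times> 'w) poly" where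
  "semidirect_mul sW mul l = (\<lambda>(a, u) (b, v).
     inl_poly (mul a b) + inr_poly (l a v + psubst (- lam - der1 sW) const1 (l b u)))"

definition semidirect_br :: "('k::field_char_0 poly \<Rightarrow> 'w \<Rightarrow> 'w) \<Rightarrow>
    ('p \<Rightarrow> 'p \<Rightarrow> 'p poly) \<Rightarrow> ('p \<Rightarrow> 'w \<Rightarrow> 'w poly) \<Rightarrow>
    'p::ab_group_add \<times> 'w::ab_group_add \<Rightarrow> 'p \<times> 'w \<Rightarrow> ('p \<times> 'w) poly" where
  "semidirect_br sW br rho = (\<lambda>(a, u) (b, v).
     inl_poly (br a b) + inr_poly (rho a v - psubst (- lam - der1 sW) const1 (rho b u)))"

section \<open>Tensor products over the ground field\<close>

text \<open>
  A tensor is represented by a formal sum in the free vector space \<open>'x \<Rightarrow>\<^sub>0 'k\<close> on tuples \<open>'x\<close>;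
  two formal sums represent the same element of \<open>A \<otimes> A\<close> (of \<open>A \<otimes> A \<otimes> A\<close>) iff their difference
  lies in the span \<open>tensor2_null\<close> (\<open>tensor3_null\<close>) of the multilinearity relations.
\<close>

definition fscale :: "'k::field \<Rightarrow> ('x \<Rightarrow>\<^sub>0 'k) \<Rightarrow> 'x \<Rightarrow>\<^sub>0 'k" where
  "fscale c = Poly_Mapping.map ((*) c)"

definition pure :: "'x \<Rightarrow> 'x \<Rightarrow>\<^sub>0 'k::field" where
  "pure x = Poly_Mapping.single x 1"

definition formal_sums :: "'x set \<Rightarrow> ('x \<Rightarrow>\<^sub>0 'k::field) set" where
  "formal_sums X = {t. Poly_Mapping.keys t \<subseteq> X}"

definition lin_ext :: "('k \<Rightarrow> 'm \<Rightarrow> 'm) \<Rightarrow> ('x \<Rightarrow> 'm) \<Rightarrow> ('x \<Rightarrow>\<^sub>0 'k::field) \<Rightarrow> 'm::comm_monoid_add" where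
  "lin_ext sc g t = (\<Sum>x\<in>Poly_Mapping.keys t. sc (Poly_Mapping.lookup t x) (g x))"

text \<open>The relations expressing \<open>k\<close>-linearity of \<open>x \<mapsto> pure (slot x)\<close>.\<close>

definition slot_relations :: "('k::field_char_0 poly \<Rightarrow> 'a::ab_group_add \<Rightarrow> 'a) \<Rightarrow> 'a set \<Rightarrow>
    ('a \<Rightarrow> 'x) \<Rightarrow> ('x \<Rightarrow>\<^sub>0 'k) set" where
  "slot_relations s A slot =
     {pure (slot (x + y)) - pure (slot x) - pure (slot y) | x y. x \<in> A \<and> y \<in> A} \<union>
     {pure (slot (s [:c:] x)) - fscale c (pure (slot x)) | c x. x \<in> A}"

definition tensor2_null :: "('k::field_char_0 poly \<Rightarrow> 'a::ab_group_add \<Rightarrow> 'a) \<Rightarrow> 'a set \<Rightarrow>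
    ('a \<times> 'a \<Rightarrow>\<^sub>0 'k) set" where
  "tensor2_null s A = module.span fscale (\<Union>b\<in>A.
     slot_relations s A (\<lambda>x. (x, b)) \<union> slot_relations s A (\<lambda>x. (b, x)))"

definition tensor3_null :: "('k::field_char_0 poly \<Rightarrow> 'a::ab_group_add \<Rightarrow> 'a) \<Rightarrow> 'a set \<Rightarrow>
    ('a \<times> 'a \<times> 'a \<Rightarrow>\<^sub>0 'k) set" where
  "tensor3_null s A = module.span fscale (\<Union>b\<in>A. \<Union>c\<in>A.
     slot_relations s A (\<lambda>x. (x, b, c)) \<union> slot_relations s A (\<lambda>x. (b, x, c)) \<union>
     slot_relations s A (\<lambda>x. (b, c, x)))"

definition flip :: "('a \<times> 'b \<Rightarrow>\<^sub>0 'k::field) \<Rightarrow> 'b \<times> 'a \<Rightarrow>\<^sub>0 'k" where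
  "flip = lin_ext fscale (\<lambda>(a, b). pure (b, a))"

text \<open>\<open>\<partial> \<otimes> I \<otimes> I\<close>, \<open>I \<otimes> \<partial> \<otimes> I\<close>, \<open>I \<otimes> I \<otimes> \<partial>\<close>.\<close>

definition der_1 :: "('k::field_char_0 poly \<Rightarrow> 'a \<Rightarrow> 'a) \<Rightarrow> ('a \<times> 'a \<times> 'a \<Rightarrow>\<^sub>0 'k) \<Rightarrow> 'a \<times> 'a \<times> 'a \<Rightarrow>\<^sub>0 'k" where
  "der_1 s = lin_ext fscale (\<lambda>(a, b, c). pure (der s a, b, c))"

definition der_2 :: "('k::field_char_0 poly \<Rightarrow> 'a \<Rightarrow> 'a) \<Rightarrow> ('a \<times> 'a \<times> 'a \<Rightarrow>\<^sub>0 'k) \<Rightarrow> 'a \<times> 'a \<times> 'a \<Rightarrow>\<^sub>0 'k" where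
  "der_2 s = lin_ext fscale (\<lambda>(a, b, c). pure (a, der s b, c))"

definition der_3 :: "('k::field_char_0 poly \<Rightarrow> 'a \<Rightarrow> 'a) \<Rightarrow> ('a \<times> 'a \<times> 'a \<Rightarrow>\<^sub>0 'k) \<Rightarrow> 'a \<times> 'a \<times> 'a \<Rightarrow>\<^sub>0 'k" where
  "der_3 s = lin_ext fscale (\<lambda>(a, b, c). pure (a, b, der s c))"

section \<open>The Poisson conformal Yang-Baxter equation\<close>

text \<open>
  For \<open>r = \<Sum>\<^sub>i r\<^sub>i \<otimes> l\<^sub>i\<close>, the pairs \<open>(x, x')\<close> and \<open>(y, y')\<close> below are \<open>(r\<^sub>i, l\<^sub>i)\<close> and \<open>(r\<^sub>j, l\<^sub>j)\<close>, and the double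
  sum over \<open>i\<close>, \<open>j\<close> is the bilinear extension.
\<close>

definition cyb :: "('k::field_char_0 poly \<Rightarrow> 'a::ab_group_add \<Rightarrow> 'a) \<Rightarrow> ('a \<Rightarrow> 'a \<Rightarrow> 'a poly) \<Rightarrow>
    ('a \<times> 'a \<Rightarrow>\<^sub>0 'k) \<Rightarrow> 'a \<times> 'a \<times> 'a \<Rightarrow>\<^sub>0 'k" where
  "cyb s br r = lin_ext fscale (\<lambda>(x, x'). lin_ext fscale (\<lambda>(y, y').
       psubst (der_2 s) (\<lambda>z. pure (z, x', y')) (br x y)
     - psubst (der_3 s) (\<lambda>z. pure (x, z, y')) (br y x')
     - psubst (der_2 s) (\<lambda>z. pure (x, y, z)) (br y' x')) r) r"

definition ayb :: "('k::field_char_0 poly \<Rightarrow> 'a::ab_group_add \<Rightarrow> 'a) \<Rightarrow> ('a \<Rightarrow> 'a \<Rightarrow> 'a poly) \<Rightarrow>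
    ('a \<times> 'a \<Rightarrow>\<^sub>0 'k) \<Rightarrow> 'a \<times> 'a \<times> 'a \<Rightarrow>\<^sub>0 'k" where
  "ayb s mul r = lin_ext fscale (\<lambda>(x, x'). lin_ext fscale (\<lambda>(y, y').
       psubst (der_1 s) (\<lambda>z. pure (x, y, z)) (mul x' y')
     - psubst (- (der_1 s + der_2 s)) (\<lambda>z. pure (x, z, y')) (mul y x')
     + psubst (der_2 s) (\<lambda>z. pure (z, x', y')) (mul x y)) r) r"

definition in_der_image :: "('k::field_char_0 poly \<Rightarrow> 'a::ab_group_add \<Rightarrow> 'a) \<Rightarrow> 'a set \<Rightarrow>
    ('a \<times> 'a \<times> 'a \<Rightarrow>\<^sub>0 'k) \<Rightarrow> bool" where
  "in_der_image s A t \<longleftrightarrow>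
     (\<exists>w \<in> formal_sums (A \<times> A \<times> A). t - (der_1 s + der_2 s + der_3 s) w \<in> tensor3_null s A)"

definition pcybe_solution :: "('k::field_char_0 poly \<Rightarrow> 'a::ab_group_add \<Rightarrow> 'a) \<Rightarrow> 'a set \<Rightarrow>
    ('a \<Rightarrow> 'a \<Rightarrow> 'a poly) \<Rightarrow> ('a \<Rightarrow> 'a \<Rightarrow> 'a poly) \<Rightarrow> ('a \<times> 'a \<Rightarrow>\<^sub>0 'k) \<Rightarrow> bool" where
  "pcybe_solution s A br mul r \<longleftrightarrow> r \<in> formal_sums (A \<times> A) \<and>
     in_der_image s A (cyb s br r) \<and> in_der_image s A (ayb s mul r)"

definition skew_symmetric :: "('k::field_char_0 poly \<Rightarrow> 'a::ab_group_add \<Rightarrow> 'a) \<Rightarrow> 'a set \<Rightarrow>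
    ('a \<times> 'a \<Rightarrow>\<^sub>0 'k) \<Rightarrow> bool" where
  "skew_symmetric s A r \<longleftrightarrow> r - (- flip r) \<in> tensor2_null s A"

section \<open>The tensor corresponding to a conformal linear map\<close>

text \<open>The map \<open>P \<otimes> V\<^sup>*\<^sup>c \<rightarrow> Chom(V, P)\<close>, \<open>a \<otimes> f \<mapsto> (v \<mapsto> f\<^sub>\<lambda>\<^sub>+\<^sub>\<partial>(v) a)\<close>, on representing formal sums.\<close>

definition chom_of_tensor :: "('k::field_char_0 poly \<Rightarrow> 'p::ab_group_add \<Rightarrow> 'p) \<Rightarrow>
    ('p \<times> ('v::ab_group_add \<Rightarrow> 'k poly) \<Rightarrow>\<^sub>0 'k) \<Rightarrow> 'v \<Rightarrow> 'p poly" where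
  "chom_of_tensor sP t = (\<lambda>v. lin_ext (\<lambda>c. map_poly (sP [:c:]))
     (\<lambda>(a, f). psubst (lam + der1 sP) (\<lambda>c. const1 (sP [:c:] a)) (f v)) t)"

definition tensor_of_chom :: "('k::field_char_0 poly \<Rightarrow> 'p::ab_group_add \<Rightarrow> 'p) \<Rightarrow>
    ('k poly \<Rightarrow> 'v::ab_group_add \<Rightarrow> 'v) \<Rightarrow> ('v \<Rightarrow> 'p poly) \<Rightarrow> 'p \<times> ('v \<Rightarrow> 'k poly) \<Rightarrow>\<^sub>0 'k" where
  "tensor_of_chom sP sV T = inv_into (formal_sums (UNIV \<times> cdual sV)) (chom_of_tensor sP) T"

definition incl_tensor :: "('p::zero \<times> 'w::zero \<Rightarrow>\<^sub>0 'k::field) \<Rightarrow> ('p \<times> 'w) \<times> ('p \<times> 'w) \<Rightarrow>\<^sub>0 'k" where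
  "incl_tensor = lin_ext fscale (\<lambda>(a, f). pure ((a, 0), (0, f)))"

section \<open>O-operators\<close>

definition O_operator :: "('k::field_char_0 poly \<Rightarrow> 'p::ab_group_add \<Rightarrow> 'p) \<Rightarrow>
    ('p \<Rightarrow> 'p \<Rightarrow> 'p poly) \<Rightarrow> ('p \<Rightarrow> 'p \<Rightarrow> 'p poly) \<Rightarrow>
    ('k poly \<Rightarrow> 'v::ab_group_add \<Rightarrow> 'v) \<Rightarrow> ('p \<Rightarrow> 'v \<Rightarrow> 'v poly) \<Rightarrow> ('p \<Rightarrow> 'v \<Rightarrow> 'v poly) \<Rightarrow>
    ('v \<Rightarrow> 'p) \<Rightarrow> bool" where
  "O_operator sP br mul sV rho l T \<longleftrightarrow> module_hom sV sP T \<and>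
     (\<forall>u v. mul (T u) (T v) =
        map_poly T (l (T u) v) + map_poly T (psubst (- lam - der1 sV) const1 (l (T v) u))) \<and>
     (\<forall>u v. br (T u) (T v) =
        map_poly T (rho (T u) v) - map_poly T (psubst (- lam - der1 sV) const1 (rho (T v) u)))"

end

theory Submission
  imports Defs
begin

text \<open>
  Write \<open>W\<close> for the conformal dual \<open>V\<^sup>*\<^sup>c\<close> and \<open>Q = P \<oplus> W\<close> for the semi-direct product, and let
  \<open>r = \<Sum>\<^sub>i (a\<^sub>i \<otimes> f\<^sub>i - f\<^sub>i \<otimes> a\<^sub>i)\<close>. As products of two elements of \<open>W\<close> vanish and mixed products lie in \<open>W\<close>, both
  Yang-Baxter expressions of \<open>r\<close> live in \<open>P \<otimes> W \<otimes> W\<close>, \<open>W \<otimes> P \<otimes> W\<close> and \<open>W \<otimes> W \<otimes> P\<close>. Because the products are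
  (skew-)commutative, the three components agree up to a sign and a permutation of the factors, modulo the
  image of \<open>\<partial>\<close>. So it suffices to understand the first one.

  Modulo the image of \<open>\<partial>\<close>, an element of \<open>P \<otimes> W \<otimes> W\<close> is determined by its evaluations
  \<open>a \<otimes> f \<otimes> g \<mapsto> f\<^sub>-\<^sub>\<lambda>(u) g\<^sub>\<lambda>\<^sub>+\<^sub>\<partial>(v) a\<close> in \<open>P[\<lambda>]\<close> at vectors \<open>u\<close>, \<open>v\<close>. They do vanish on that image, as \<open>\<partial>\<close> acts on the three
  factors as \<open>\<partial>\<close>, \<open>\<lambda>\<close> and \<open>-\<lambda> - \<partial>\<close>; and for free \<open>V\<close> of finite rank the evaluations at basis vectors are the
  coefficients of the element in terms of the dual basis. Since \<open>T\<^sub>0(v) = \<Sum>\<^sub>i f\<^sub>i\<^sub>,\<^sub>\<partial>(v) a\<^sub>i\<close>, the evaluation of \<open>r \<bullet> r\<close> is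
  \<open>T\<^sub>0(u)\<^sub>\<lambda> T\<^sub>0(v) - T\<^sub>0(l(T\<^sub>0(u))\<^sub>\<lambda> v) - T\<^sub>0(l(T\<^sub>0(v))\<^sub>-\<^sub>\<lambda>\<^sub>-\<^sub>\<partial> u)\<close>, and that of \<open>[[r, r]]\<close> is the corresponding expression for
  the bracket. Hence the Yang-Baxter equation holds iff \<open>T\<^sub>0\<close> is an O-operator.

  Tensors are formal sums modulo relations, so the computation is made under invariant trilinear forms,
  that is, linear maps that vanish on the relations and on the image of \<open>\<partial>\<close>. Such forms detect this image by
  \<open>in_der_image_if_forms_vanish\<close>. The decomposition into components is \<open>lin_ext_yb_pair\<close>, the evaluation is
  \<open>sum_yb_form_eval_form\<close>, and \<open>form_via_eval_forms\<close> says that the evaluations determine all forms. The product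
  and the bracket satisfy the same identities up to a sign and are treated together in the locale
  \<open>commutative_product_with_action\<close>.
\<close>

section \<open>Substituting operators into polynomials\<close>

lemma additive_funpow:
  fixes \<theta> :: "'a::ab_group_add \<Rightarrow> 'a"
  shows "additive \<theta> \<Longrightarrow> additive (\<theta> ^^ k)"
  by (induction k) (simp_all add: additive_def)

lemma psubst_conv_sum:
  assumes "additive \<theta>" "h 0 = 0" "degree p \<le> N"
  shows "psubst \<theta> h p = (\<Sum>k\<le>N. (\<theta> ^^ k) (h (coeff p k)))"
  unfolding psubst_def
proof (rule sum.mono_neutral_left)
  show "\<forall>k\<in>{..N} - {..degree p}. (\<theta> ^^ k) (h (coeff p k)) = 0"
    using assms additive.zero[OF additive_funpow[OF assms(1)]] by (simp add: coeff_eq_0)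
qed (use assms in auto)

lemma psubst_0: "h 0 = 0 \<Longrightarrow> psubst \<theta> h 0 = 0"
  by (simp add: psubst_def)

text \<open>
  Horner's rule. It reduces each identity about substitutions to an induction on the polynomial.
\<close>

lemma psubst_pCons:
  assumes "additive \<theta>" "h 0 = 0"
  shows "psubst \<theta> h (pCons a p) = h a + \<theta> (psubst \<theta> h p)"
proof -
  have "psubst \<theta> h (pCons a p) = (\<Sum>k\<le>Suc (degree p). (\<theta> ^^ k) (h (coeff (pCons a p) k)))"
    by (rule psubst_conv_sum) (use assms degree_pCons_le in auto)
  also have "\<dots> = h a + (\<Sum>k\<le>degree p. \<theta> ((\<theta> ^^ k) (h (coeff p k))))"
    by (subst sum.atMost_Suc_shift) simp
  also have "\<dots> = h a + \<theta> (psubst \<theta> h p)"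
    by (simp add: psubst_def additive.sum[OF assms(1)])
  finally show ?thesis .
qed

lemma psubst_const:
  assumes "additive \<theta>" "h 0 = 0"
  shows "psubst \<theta> h [:a:] = h a"
  using psubst_pCons[where \<theta> = \<theta> and h = h and a = a and p = 0, OF assms] additive.zero[OF assms(1)] assms by (simp add: psubst_0)

lemma additive_psubst:
  assumes "additive \<theta>" "additive h"
  shows "additive (psubst \<theta> h)"
proof
  fix p q
  note z = additive.zero[OF assms(2)]
  show "psubst \<theta> h (p + q) = psubst \<theta> h p + psubst \<theta> h q"
    by (induction p q rule: poly_induct2)
      (simp_all add: psubst_0 psubst_pCons assms(1) z
        additive.add[OF assms(1)] additive.add[OF assms(2)])
qed

text \<open>
  A map that intertwines \<open>\<theta>\<close> with \<open>\<theta>'\<close> turns the substitution of \<open>\<theta>\<close> into that of \<open>\<theta>'\<close>. Almost all changes of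
  variables below are instances of this.
\<close>

lemma psubst_commute:
  assumes "additive \<theta>" "h 0 = 0" "additive \<theta>'" "additive H"
    and "\<And>x. H (\<theta> x) = \<theta>' (H x)"
  shows "H (psubst \<theta> h p) = psubst \<theta>' (\<lambda>x. H (h x)) p"
proof (induction p)
  case 0
  show ?case using assms additive.zero[OF assms(4)] by (simp add: psubst_0)
next
  case (pCons a p)
  have "H (h 0) = 0" using assms additive.zero[OF assms(4)] by simp
  then show ?case
    using pCons.IH by (simp add: psubst_pCons assms additive.add[OF assms(4)])
qed

lemma psubst_map_poly:
  assumes "additive \<theta>" "h 0 = 0" "f 0 = 0"
  shows "psubst \<theta> h (map_poly f p) = psubst \<theta> (\<lambda>x. h (f x)) p"
  by (induction p) (simp_all add: psubst_0 psubst_pCons map_poly_pCons assms)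

lemma additive_lam: "additive lam"
  by standard (simp add: lam_def)

lemma lam_0 [simp]: "lam 0 = 0"
  by (simp add: lam_def)

lemma lam_add: "lam (p + q) = lam p + lam q"
  by (simp add: lam_def)

lemma lam_minus: "lam (- p) = - lam p"
  by (simp add: lam_def)

lemma lam_diff: "lam (p - q) = lam p - lam q"
  by (simp add: lam_def)

lemma coeff_lam_0 [simp]: "coeff (lam p) 0 = 0"
  by (simp add: lam_def)

lemma pCons_conv_lam: "pCons a p = [:a:] + lam p"
  by (simp add: lam_def)

lemma psubst_lam:
  assumes "additive \<theta>" "h 0 = 0"
  shows "psubst \<theta> h (lam p) = \<theta> (psubst \<theta> h p)"
  by (simp add: lam_def psubst_pCons assms)

lemma psubst_lam_const1 [simp]:
  fixes p :: "'a::ab_group_add poly"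
  shows "psubst lam const1 p = p"
  by (induction p) (simp_all add: psubst_0 psubst_pCons additive_lam pCons_conv_lam[symmetric])

lemma additive_minus_op: "additive \<theta> \<Longrightarrow> additive (- \<theta>)"
  by (simp add: additive_def)

lemma additive_plus_op: "additive \<theta> \<Longrightarrow> additive \<eta> \<Longrightarrow> additive (\<theta> + \<eta>)"
  by (simp add: additive_def)

lemma additive_diff_op: "additive \<theta> \<Longrightarrow> additive \<eta> \<Longrightarrow> additive (\<theta> - \<eta>)"
  by (simp add: additive_def)

lemma additive_map_poly: "additive f \<Longrightarrow> additive (map_poly f)"
  by (auto simp: additive_def additive.zero[of f, unfolded additive_def] poly_eq_iff coeff_map_poly)

lemmas additive_ops = additive_lam additive_minus_op additive_plus_op additive_diff_op
  additive_map_poly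

subsection \<open>Polynomials acting through a linear operator\<close>

text \<open>For a \<open>k\<close>-linear operator \<open>\<theta>\<close>, this is the action of \<open>p(\<theta>)\<close>.\<close>

definition opoly :: "('k::comm_ring_1 \<Rightarrow> 'm::ab_group_add \<Rightarrow> 'm) \<Rightarrow> ('m \<Rightarrow> 'm) \<Rightarrow> 'k poly \<Rightarrow> 'm \<Rightarrow> 'm" where
  "opoly sc \<theta> p x = psubst \<theta> (\<lambda>c. sc c x) p"

lemma additive_hom: "module_hom s1 s2 f \<Longrightarrow> additive f"
  by (simp add: additive_def module_hom_def module_hom_axioms_def)

lemma module_hom_domain: "module_hom s1 s2 f \<Longrightarrow> module s1"
  by (simp add: module_hom_def)

lemma module_hom_codomain: "module_hom s1 s2 f \<Longrightarrow> module s2"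
  by (simp add: module_hom_def)

lemma opoly_0 [simp]: "module sc \<Longrightarrow> opoly sc \<theta> 0 x = 0"
  by (simp add: opoly_def psubst_0 module.scale_zero_left[of sc])

lemma opoly_pCons:
  assumes "module_hom sc sc \<theta>"
  shows "opoly sc \<theta> (pCons c p) x = sc c x + \<theta> (opoly sc \<theta> p x)"
proof -
  interpret module_hom sc sc \<theta> by fact
  show ?thesis
    unfolding opoly_def by (rule psubst_pCons) (simp_all add: additive_hom[OF assms])
qed

text \<open>
  Horner's rule determines the action, so every compatible family of values is given by it. This is how
  sesquilinearity, stated for \<open>\<partial>\<close> only, is extended to all polynomials in \<open>\<partial>\<close>.
\<close>

lemma opoly_unique:
  assumes "module_hom sc sc \<theta>" "F 0 = 0" "\<And>c p. F (pCons c p) = sc c x + \<theta> (F p)"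
  shows "F p = opoly sc \<theta> p x"
  by (induction p) (simp_all add: assms opoly_pCons module_hom_domain[OF assms(1)])

lemma opoly_hom:
  assumes "module_hom sc sc \<theta>" "module_hom sc' sc' \<theta>'" "module_hom sc sc' H"
    and "\<And>x. H (\<theta> x) = \<theta>' (H x)"
  shows "H (opoly sc \<theta> p x) = opoly sc' \<theta>' p (H x)"
proof -
  interpret H: module_hom sc sc' H by fact
  show ?thesis
    by (induction p)
      (simp_all add: opoly_pCons assms H.m1.module_axioms H.m2.module_axioms H.add H.scale)
qed

lemma opoly_linear:
  assumes "module_hom sc sc \<theta>"
  shows "module_hom sc sc (opoly sc \<theta> p)"
proof -
  interpret module_hom sc sc \<theta> by fact
  show ?thesis
  proof
    show "opoly sc \<theta> p (x + y) = opoly sc \<theta> p x + opoly sc \<theta> p y" for x y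
      by (induction p)
        (simp_all add: opoly_pCons assms add m1.scale_right_distrib m1.module_axioms algebra_simps)
    show "opoly sc \<theta> p (sc c x) = sc c (opoly sc \<theta> p x)" for c x
      by (induction p)
        (simp_all add: opoly_pCons assms scale m1.scale_right_distrib m1.module_axioms mult.commute)
  qed
qed

lemma opoly_add_left:
  assumes "module_hom sc sc \<theta>"
  shows "opoly sc \<theta> (p + q) x = opoly sc \<theta> p x + opoly sc \<theta> q x"
proof -
  interpret module_hom sc sc \<theta> by fact
  show ?thesis
    by (induction p q rule: poly_induct2)
      (simp_all add: opoly_pCons assms add m1.scale_left_distrib m1.module_axioms)
qed

lemma opoly_smult:
  assumes "module_hom sc sc \<theta>"
  shows "opoly sc \<theta> (smult c p) x = sc c (opoly sc \<theta> p x)"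
proof -
  interpret module_hom sc sc \<theta> by fact
  show ?thesis
    by (induction p) (simp_all add: opoly_pCons assms scale m1.scale_right_distrib m1.module_axioms)
qed

lemma opoly_minus_left:
  assumes "module_hom sc sc \<theta>"
  shows "opoly sc \<theta> (- p) x = - opoly sc \<theta> p x"
proof -
  interpret additive "\<lambda>p. opoly sc \<theta> p x"
    by standard (rule opoly_add_left[OF assms])
  show ?thesis by (rule minus)
qed

lemma opoly_commute:
  assumes "module_hom sc sc \<theta>" "module_hom sc sc \<eta>" "\<And>x. \<theta> (\<eta> x) = \<eta> (\<theta> x)"
  shows "opoly sc \<theta> p (opoly sc \<eta> q x) = opoly sc \<eta> q (opoly sc \<theta> p x)"
proof -
  have 1: "\<eta> (opoly sc \<theta> p x) = opoly sc \<theta> p (\<eta> x)" for x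
    by (rule opoly_hom) (use assms in auto)
  show ?thesis
    by (rule opoly_hom[where H = "opoly sc \<theta> p"]) (use assms opoly_linear 1 in auto)
qed

lemma opoly_lam:
  assumes "module_hom sc sc \<theta>"
  shows "opoly sc \<theta> (lam p) x = \<theta> (opoly sc \<theta> p x)"
  using module.scale_zero_left[OF module_hom_domain[OF assms]]
  by (simp add: lam_def opoly_pCons[OF assms])

lemma opoly_monom_mult:
  assumes "module_hom sc sc \<theta>"
  shows "opoly sc \<theta> ([:0, 1:] ^ k * p) x = opoly sc \<theta> p ((\<theta> ^^ k) x)"
proof (induction k arbitrary: x)
  case (Suc k)
  have "opoly sc \<theta> ([:0, 1:] ^ Suc k * p) x = \<theta> (opoly sc \<theta> ([:0, 1:] ^ k * p) x)"
    using opoly_lam[OF assms, of "[:0, 1:] ^ k * p"] by (simp add: lam_def)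
  also have "\<dots> = opoly sc \<theta> ([:0, 1:] ^ k * p) (\<theta> x)"
    by (rule opoly_hom[OF assms assms assms]) simp
  also have "\<dots> = opoly sc \<theta> p ((\<theta> ^^ Suc k) x)"
    by (simp only: Suc funpow_Suc_right comp_apply)
  finally show ?case .
qed simp

section \<open>Polynomials over a module\<close>

text \<open>The \<open>k\<close>-vector space structure of \<open>M[\<lambda>]\<close>.\<close>

definition poly_scale :: "('k::comm_ring_1 poly \<Rightarrow> 'm::ab_group_add \<Rightarrow> 'm) \<Rightarrow> 'k \<Rightarrow> 'm poly \<Rightarrow> 'm poly" where
  "poly_scale s c = map_poly (s [:c:])"

lemma scalar_module:
  fixes s :: "'k::comm_ring_1 poly \<Rightarrow> 'm::ab_group_add \<Rightarrow> 'm"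
  assumes "module s"
  shows "module (\<lambda>c. s [:c:])"
proof -
  interpret module s by fact
  show ?thesis
  proof
    fix a b x y
    show "s [:a:] (x + y) = s [:a:] x + s [:a:] y" by (rule scale_right_distrib)
    show "s [:a + b:] x = s [:a:] x + s [:b:] x" using scale_left_distrib[of "[:a:]" "[:b:]"] by simp
    show "s [:a:] (s [:b:] x) = s [:a * b:] x" using scale_scale[of "[:a:]" "[:b:]"] by (simp add: mult.commute)
    show "s [:1:] x = x" using scale_one by (simp add: one_pCons[symmetric])
  qed
qed

lemma module_scale_polynomial:
  fixes s :: "'k::comm_ring_1 poly \<Rightarrow> 'm::ab_group_add \<Rightarrow> 'm"
  assumes "module s"
  shows "module_hom (\<lambda>c. s [:c:]) (\<lambda>c. s [:c:]) (s p)"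
proof -
  interpret module s by fact
  show ?thesis
    by (simp add: module_hom_iff scalar_module assms scale_right_distrib mult.commute)
qed

lemma scale_zero [simp]:
  fixes s :: "'k::comm_ring_1 poly \<Rightarrow> 'm::ab_group_add \<Rightarrow> 'm"
  shows "module s \<Longrightarrow> s p 0 = 0"
  by (rule module.scale_zero_right)

lemma der_0 [simp]: "module s \<Longrightarrow> der s 0 = 0"
  by (simp add: der_def)

lemma module_poly_scale:
  fixes s :: "'k::comm_ring_1 poly \<Rightarrow> 'm::ab_group_add \<Rightarrow> 'm"
  assumes "module s"
  shows "module (poly_scale s)"
proof -
  interpret module "\<lambda>c. s [:c:]" by (rule scalar_module) fact
  show ?thesis
    by standard (simp_all add: poly_scale_def poly_eq_iff coeff_map_poly scale_right_distrib
        scale_left_distrib mult.commute)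
qed

lemma poly_scale_const [simp]: "module s \<Longrightarrow> poly_scale s c [:a:] = [:s [:c:] a:]"
  by (simp add: poly_scale_def map_poly_pCons)

lemma lam_linear: "module s \<Longrightarrow> module_hom (poly_scale s) (poly_scale s) lam"
  by (simp add: module_hom_iff module_poly_scale lam_add)
    (simp add: lam_def poly_scale_def map_poly_pCons)

lemma map_poly_linear:
  assumes "module_hom (\<lambda>c. s [:c:]) (\<lambda>c. t [:c:]) f" "module s" "module t"
  shows "module_hom (poly_scale s) (poly_scale t) (map_poly f)"
proof -
  interpret module_hom "\<lambda>c. s [:c:]" "\<lambda>c. t [:c:]" f by fact
  show ?thesis
    by (simp add: module_hom_iff module_poly_scale assms)
      (simp add: poly_scale_def poly_eq_iff coeff_map_poly add scale)
qed

lemma der1_linear: "module s \<Longrightarrow> module_hom (poly_scale s) (poly_scale s) (der1 s)"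
  unfolding der1_def der_def by (intro map_poly_linear module_scale_polynomial)

lemma const1_linear: "module s \<Longrightarrow> module_hom (\<lambda>c. s [:c:]) (poly_scale s) const1"
  by (simp add: module_hom_iff module_poly_scale scalar_module)

lemma linear_minus_op: "module_hom s1 s2 f \<Longrightarrow> module_hom s1 s2 (- f)"
  using module_pair.module_hom_neg[of s1 s2 f]
  by (simp add: fun_Compl_def module_pair_def module_hom_def)

lemma linear_plus_op: "module_hom s1 s2 f \<Longrightarrow> module_hom s1 s2 g \<Longrightarrow> module_hom s1 s2 (f + g)"
  using module_pair.module_hom_add[of s1 s2 f g]
  by (simp add: plus_fun_def module_pair_def module_hom_def)

lemma linear_diff_op: "module_hom s1 s2 f \<Longrightarrow> module_hom s1 s2 g \<Longrightarrow> module_hom s1 s2 (f - g)"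
  using module_pair.module_hom_sub[of s1 s2 f g]
  by (simp add: fun_diff_def module_pair_def module_hom_def)

lemmas linear_ops = linear_minus_op linear_plus_op linear_diff_op lam_linear der1_linear

lemma der1_lam [simp]: "module s \<Longrightarrow> der1 s (lam p) = lam (der1 s p)"
  by (simp add: der1_def lam_def map_poly_pCons  der_def)

lemma der1_add: "module s \<Longrightarrow> der1 s (p + q) = der1 s p + der1 s q"
  by (simp add: module_hom.add[OF der1_linear])

lemma der1_minus: "module s \<Longrightarrow> der1 s (- p) = - der1 s p"
  by (simp add: module_hom.neg[OF der1_linear])

lemma der1_diff: "module s \<Longrightarrow> der1 s (p - q) = der1 s p - der1 s q"
  by (simp add: module_hom.diff[OF der1_linear])

lemma der1_const [simp]: "module s \<Longrightarrow> der1 s [:a:] = [:der s a:]"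
  by (simp add: der1_def map_poly_pCons  der_def)

lemma additive_der1: "module s \<Longrightarrow> additive (der1 s)"
  by (rule additive_hom[OF der1_linear])

lemma der_linear: "module s \<Longrightarrow> module_hom (\<lambda>c. s [:c:]) (\<lambda>c. s [:c:]) (der s)"
  unfolding der_def by (rule module_scale_polynomial)

lemma module_pCons:
  assumes "module s"
  shows "s (pCons c p) x = s [:c:] x + der s (s p x)"
  using module.scale_left_distrib[OF assms, of "[:c:]" "[:0,1:] * p"] module.scale_scale[OF assms]
  by (simp add: der_def)

lemma opoly_der:
  assumes "module s"
  shows "opoly (\<lambda>c. s [:c:]) (der s) p x = s p x"
  by (induction p) (simp_all add: opoly_pCons der_linear scalar_module assms
      module_pCons[OF assms, of _ _ x, symmetric] module.scale_zero_left[of s])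

lemma opoly_der1_const:
  assumes "module s"
  shows "opoly (poly_scale s) (der1 s) p [:x:] = [:s p x:]"
proof -
  have "const1 (opoly (\<lambda>c. s [:c:]) (der s) p x) = opoly (poly_scale s) (der1 s) p [:x:]"
    by (rule opoly_hom[where H = const1]) (simp_all add: assms der_linear der1_linear const1_linear)
  then show ?thesis by (simp add: opoly_der assms)
qed

lemma psubst_der1:
  assumes "module s" "additive \<theta>" "additive h" "additive D"
    and "\<And>x. h (der s x) = D (h x)" "\<And>x. D (\<theta> x) = \<theta> (D x)"
  shows "psubst \<theta> h (der1 s p) = D (psubst \<theta> h p)"
proof -
  have "h 0 = 0" by (rule additive.zero) fact
  moreover have "der s 0 = 0" by (simp add: der_def assms(1))
  ultimately have "psubst \<theta> h (der1 s p) = psubst \<theta> (\<lambda>x. D (h x)) p"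
    by (simp add: der1_def psubst_map_poly assms)
  also have "\<dots> = D (psubst \<theta> h p)"
    by (rule psubst_commute[symmetric]) (use assms \<open>h 0 = 0\<close> in auto)
  finally show ?thesis .
qed

text \<open>The substitution \<open>\<lambda> \<mapsto> -\<lambda> - \<partial>\<close>, which expresses (skew-)commutativity.\<close>

abbreviation twist :: "('k::comm_ring_1 poly \<Rightarrow> 'm::ab_group_add \<Rightarrow> 'm) \<Rightarrow> 'm poly \<Rightarrow> 'm poly" where
  "twist s \<equiv> psubst (- lam - der1 s) const1"

lemma additive_const1: "additive (const1 :: 'm::ab_group_add \<Rightarrow> 'm poly)"
  by standard simp

lemma additive_twist_op: "module s \<Longrightarrow> additive (- lam - der1 s)"
  by (intro additive_ops additive_der1)

lemma additive_twist: "module s \<Longrightarrow> additive (twist s)"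
  by (intro additive_psubst additive_ops additive_der1 additive_const1)

lemma twist_pCons: "module s \<Longrightarrow> twist s (pCons a p) = [:a:] + (- lam - der1 s) (twist s p)"
  by (rule psubst_pCons[OF additive_twist_op]) simp_all

lemma twist_lam: "module s \<Longrightarrow> twist s (lam p) = - lam (twist s p) - der1 s (twist s p)"
  using psubst_lam[OF additive_twist_op, where h = const1] by simp

lemma twist_der1: "module s \<Longrightarrow> twist s (der1 s p) = der1 s (twist s p)"
  by (rule psubst_der1[OF _ additive_twist_op])
    (simp_all add: additive_der1 additive_const1 der1_minus der1_diff)

lemma twist_twist [simp]:
  assumes "module s"
  shows "twist s (twist s p) = p"
proof -
  have "twist s (twist s p) = psubst lam (\<lambda>x. twist s (const1 x)) p"
  proof (rule psubst_commute)
    fix x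
    show "twist s ((- lam - der1 s) x) = lam (twist s x)"
      by (simp add: additive.diff[OF additive_twist] additive.minus[OF additive_twist]
          twist_lam twist_der1 assms)
  qed ((rule additive_twist_op[OF assms] additive_twist[OF assms] additive_lam | simp)+)
  also have "(\<lambda>x. twist s (const1 x)) = const1"
    by (rule ext, rule psubst_const[OF additive_twist_op[OF assms]]) simp
  finally show ?thesis by (simp only: psubst_lam_const1)
qed

text \<open>
  Maps of \<open>k[\<partial>]\<close>-modules commute with \<open>\<lambda> \<mapsto> -\<lambda> - \<partial>\<close>, since they commute with both \<open>\<lambda>\<close> and \<open>\<partial>\<close>.
\<close>

lemma twist_map_poly:
  assumes "module s" "module t" "additive f" "\<And>x. f (der s x) = der t (f x)"
  shows "map_poly f (twist s p) = twist t (map_poly f p)"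
proof -
  have f0: "f 0 = 0" by (rule additive.zero) fact
  interpret F: additive "map_poly f" by (rule additive_map_poly) fact
  have "map_poly f (twist s p) = psubst (- lam - der1 t) (\<lambda>x. map_poly f (const1 x)) p"
  proof (rule psubst_commute[OF additive_twist_op[OF assms(1)] _ additive_twist_op[OF assms(2)] F.additive_axioms])
    show "map_poly f ((- lam - der1 s) x) = (- lam - der1 t) (map_poly f x)" for x
      using f0 by (simp add: F.diff F.minus lam_def map_poly_pCons der1_def map_poly_map_poly
          comp_def assms)
  qed simp
  also have "\<dots> = twist t (map_poly f p)"
    using f0 by (subst psubst_map_poly[OF additive_twist_op[OF assms(2)]]) (simp_all add: map_poly_pCons)
  finally show ?thesis .
qed

lemma twist_coeff_in_subspace:
  assumes s: "module s" and U: "module.subspace s U" and p: "\<And>n. coeff p n \<in> U"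
  shows "coeff (twist s p) n \<in> U"
  using p
proof (induction p arbitrary: n)
  case 0
  then show ?case using module.subspace_0[OF s U] by (simp add: psubst_0)
next
  case (pCons a p)
  have a: "a \<in> U" using pCons.prems[of 0] by simp
  have "coeff p n \<in> U" for n using pCons.prems[of "Suc n"] by simp
  then have p: "coeff (twist s p) n \<in> U" for n by (rule pCons.IH)
  have "coeff (lam (twist s p)) n \<in> U"
    using p module.subspace_0[OF s U] by (cases n) (simp_all add: lam_def)
  moreover have "coeff (der1 s (twist s p)) n \<in> U"
    using module.subspace_scale[OF s U p] by (simp add: der1_def coeff_map_poly s der_def)
  moreover have "coeff [:a:] n \<in> U"
    using a module.subspace_0[OF s U] by (cases n) simp_all
  ultimately show ?case
    unfolding twist_pCons[OF s] using module.subspace_add[OF s U] module.subspace_diff[OF s U]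
      module.subspace_neg[OF s U] by simp
qed

subsection \<open>Operators acting on another tensor slot\<close>

text \<open>
  In the Yang-Baxter expressions the variable \<open>\<mu>\<close> of a product is replaced by \<open>\<partial>\<close> acting on another
  tensor factor. For a biadditive \<open>\<kappa>\<close> this is the value of \<open>\<kappa>\<close> on such a term: the product is the
  polynomial \<open>p\<close>, the other factor is \<open>y\<close>, and \<open>d\<close> is the operator acting on it.
\<close>

definition slot_subst :: "('b \<Rightarrow> 'b) \<Rightarrow> ('a::zero \<Rightarrow> 'b \<Rightarrow> 'm::comm_monoid_add) \<Rightarrow> 'a poly \<Rightarrow> 'b \<Rightarrow> 'm" where
  "slot_subst d \<kappa> p y = (\<Sum>k\<le>degree p. \<kappa> (coeff p k) ((d ^^ k) y))"

lemma slot_subst_conv_sum: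
  assumes "\<And>y. \<kappa> 0 y = 0" "degree p \<le> N"
  shows "slot_subst d \<kappa> p y = (\<Sum>k\<le>N. \<kappa> (coeff p k) ((d ^^ k) y))"
  unfolding slot_subst_def
  by (rule sum.mono_neutral_left) (use assms in \<open>auto simp: coeff_eq_0\<close>)

lemma slot_subst_0 [simp]: "(\<And>y. \<kappa> 0 y = 0) \<Longrightarrow> slot_subst d \<kappa> 0 y = 0"
  by (simp add: slot_subst_def)

lemma slot_subst_pCons:
  assumes "\<And>y. \<kappa> 0 y = 0"
  shows "slot_subst d \<kappa> (pCons a p) y = \<kappa> a y + slot_subst d \<kappa> p (d y)"
proof -
  have "slot_subst d \<kappa> (pCons a p) y = (\<Sum>k\<le>Suc (degree p). \<kappa> (coeff (pCons a p) k) ((d ^^ k) y))"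
    by (rule slot_subst_conv_sum) (use assms degree_pCons_le in auto)
  also have "\<dots> = \<kappa> a y + (\<Sum>k\<le>degree p. \<kappa> (coeff p k) ((d ^^ k) (d y)))"
    by (subst sum.atMost_Suc_shift) (simp add: funpow_swap1)
  finally show ?thesis by (simp add: slot_subst_def)
qed

lemma slot_subst_lam:
  assumes "\<And>y. \<kappa> 0 y = 0"
  shows "slot_subst d \<kappa> (lam p) y = slot_subst d \<kappa> p (d y)"
  by (simp add: lam_def slot_subst_pCons assms)

lemma additive_slot_subst:
  assumes "\<And>y. additive (\<lambda>a. \<kappa> a y)"
  shows "additive (\<lambda>p. slot_subst d \<kappa> p y)"
proof
  fix p q
  have z: "\<And>y. \<kappa> 0 y = 0" using additive.zero[OF assms] .
  show "slot_subst d \<kappa> (p + q) y = slot_subst d \<kappa> p y + slot_subst d \<kappa> q y"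
    by (induction p q arbitrary: y rule: poly_induct2)
      (simp_all add: slot_subst_pCons z additive.add[OF assms])
qed

lemma slot_subst_map_poly:
  assumes "\<And>y. \<kappa> 0 y = 0" "f 0 = 0"
  shows "slot_subst d \<kappa> (map_poly f p) y = slot_subst d (\<lambda>a. \<kappa> (f a)) p y"
  by (induction p arbitrary: y)
    (simp_all add: slot_subst_pCons map_poly_pCons assms)

lemma slot_subst_transport:
  assumes "\<And>y. d' (\<iota> y) = \<iota> (d y)"
  shows "slot_subst d' \<kappa> p (\<iota> y) = slot_subst d (\<lambda>a y. \<kappa> a (\<iota> y)) p y"
proof -
  have "(d' ^^ k) (\<iota> y) = \<iota> ((d ^^ k) y)" for k
    by (induction k) (simp_all add: assms)
  then show ?thesis by (simp add: slot_subst_def)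
qed

lemma slot_subst_hom:
  assumes "additive H"
  shows "H (slot_subst d \<kappa> p y) = slot_subst d (\<lambda>a y. H (\<kappa> a y)) p y"
  by (simp add: slot_subst_def additive.sum[OF assms])

lemma slot_subst_sum:
  "slot_subst d (\<lambda>a y. \<Sum>i\<in>I. \<kappa> i a y) p y = (\<Sum>i\<in>I. slot_subst d (\<kappa> i) p y)"
  unfolding slot_subst_def by (rule sum.swap)

lemma slot_subst_der1:
  fixes \<kappa> :: "'a::ab_group_add \<Rightarrow> 'b \<Rightarrow> 'c \<Rightarrow> 'm::ab_group_add"
  assumes "module s" "\<And>x y. \<kappa> 0 x y = 0"
    and inv: "\<And>a x y. \<kappa> (der s a) x y + \<kappa> a (d x) y + \<kappa> a x (d' y) = 0"
  shows "slot_subst d (\<lambda>a x. \<kappa> a x y) (der1 s p) x =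
    - slot_subst d (\<lambda>a x. \<kappa> a x y) p (d x) - slot_subst d (\<lambda>a x. \<kappa> a x (d' y)) p x"
proof -
  have "slot_subst d (\<lambda>a x. \<kappa> a x y) (der1 s p) x = slot_subst d (\<lambda>a x. \<kappa> (der s a) x y) p x"
    unfolding der1_def using assms(1,2) by (intro slot_subst_map_poly) simp_all
  also have "(\<lambda>a x. \<kappa> (der s a) x y) = (\<lambda>a x. - \<kappa> a (d x) y - \<kappa> a x (d' y))"
    using inv by (auto simp: fun_eq_iff add_eq_0_iff2 algebra_simps)
  also have "slot_subst d \<dots> p x =
      - slot_subst d (\<lambda>a x. \<kappa> a x y) p (d x) - slot_subst d (\<lambda>a x. \<kappa> a x (d' y)) p x"
    unfolding slot_subst_def by (simp add: sum_subtractf sum_negf funpow_swap1)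
  finally show ?thesis .
qed

text \<open>
  If \<open>\<partial>\<close>, \<open>d\<close> and \<open>d'\<close> on the three slots sum to zero under \<open>\<kappa>\<close>, then \<open>-\<mu> - \<partial>\<close> becomes \<open>d'\<close> when \<open>\<mu>\<close> becomes \<open>d\<close>.
  This is how (skew-)commutativity moves the substituted operator from one tensor factor to another.
\<close>

lemma slot_subst_twist:
  fixes \<kappa> :: "'a::ab_group_add \<Rightarrow> 'b \<Rightarrow> 'c \<Rightarrow> 'm::ab_group_add"
  assumes "module s" "\<And>x y. additive (\<lambda>a. \<kappa> a x y)"
    and inv: "\<And>a x y. \<kappa> (der s a) x y + \<kappa> a (d x) y + \<kappa> a x (d' y) = 0"
  shows "slot_subst d (\<lambda>a x. \<kappa> a x y) (twist s p) x = slot_subst d' (\<lambda>a y. \<kappa> a x y) p y"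
proof (induction p arbitrary: x y)
  case 0
  have "\<kappa> 0 x y = 0" for x y using additive.zero[OF assms(2)] .
  then show ?case by (simp add: psubst_0)
next
  case (pCons a p)
  have z: "\<kappa> 0 x y = 0" for x y using additive.zero[OF assms(2)] .
  let ?S = "\<lambda>q x y. slot_subst d (\<lambda>a x. \<kappa> a x y) q x"
  have add: "additive (\<lambda>q. ?S q x y)" for x y
    by (rule additive_slot_subst) (rule assms(2))
  have der: "?S (der1 s q) x y = - ?S q (d x) y - ?S q x (d' y)" for q x y
    by (rule slot_subst_der1[where \<kappa> = \<kappa>, OF assms(1) z inv])
  have "?S (twist s (pCons a p)) x y = ?S [:a:] x y - ?S (lam (twist s p)) x y - ?S (der1 s (twist s p)) x y"
    by (simp add: twist_pCons assms(1) additive.add[OF add] additive.diff[OF add] additive.minus[OF add])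
  also have "\<dots> = \<kappa> a x y + ?S (twist s p) x (d' y)"
    by (simp add: der slot_subst_lam z slot_subst_pCons)
  also have "\<dots> = slot_subst d' (\<lambda>a y. \<kappa> a x y) (pCons a p) y"
    by (simp add: pCons.IH slot_subst_pCons z)
  finally show ?case .
qed

section \<open>Conformal linear maps and the conformal dual\<close>

lemma chom_polynomial:
  assumes "module sU" "module sW" "f \<in> chom sU sW"
  shows "f (sU p u) = opoly (poly_scale sW) (lam + der1 sW) p (f u)"
proof -
  interpret U: module sU by fact
  have add: "f (u + v) = f u + f v" and const: "f (sU [:c:] u) = poly_scale sW c (f u)"
    and der: "f (der sU u) = (lam + der1 sW) (f u)" for u v c
    using assms by (auto simp: chom_def poly_scale_def add.commute)
  have z: "f 0 = 0" using add[of 0 0] by simp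
  have lin: "module_hom (poly_scale sW) (poly_scale sW) (lam + der1 sW)"
    by (intro linear_ops assms)
  show ?thesis
  proof (induction p)
    case 0
    then show ?case using z assms by (simp add: module_poly_scale)
  next
    case (pCons c p)
    then show ?case
      by (simp only: module_pCons[OF assms(1), of c p u] add const der opoly_pCons[OF lin])
  qed
qed

lemma map_poly_trivial_scale [simp]: "map_poly (trivial_scale [:c:]) q = smult c q"
  by (simp add: poly_eq_iff coeff_map_poly trivial_scale_def)

lemma der1_trivial_scale [simp]: "der1 trivial_scale q = 0"
  by (simp add: poly_eq_iff coeff_map_poly trivial_scale_def der1_def der_def)

lemma lam_conv_mult: "lam (q :: 'k::comm_ring_1 poly) = [:0, 1:] * q"
  by (simp add: lam_def)

text \<open>
  The conformal dual is \<open>Hom(V, k[\<lambda>])\<close> for modules over \<open>k[\<partial>]\<close>, where \<open>\<partial>\<close> acts on \<open>k[\<lambda>]\<close> as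
  multiplication by \<open>\<lambda>\<close>.
\<close>

lemma cdual_iff:
  assumes "module sV"
  shows "f \<in> cdual sV \<longleftrightarrow> (\<forall>u v. f (u + v) = f u + f v) \<and> (\<forall>p u. f (sV p u) = p * f u)"
proof
  assume f: "f \<in> cdual sV"
  have add: "f (u + v) = f u + f v" and const: "f (sV [:c:] u) = smult c (f u)"
    and der: "f (der sV u) = lam (f u)" for u v c
    using f by (auto simp: cdual_def chom_def)
  have "f (sV p u) = p * f u" for p u
  proof (induction p)
    case 0
    then show ?case using add[of 0 0] module.scale_zero_left[OF assms] by simp
  next
    case (pCons c p)
    then show ?case
      using module_pCons[OF assms, of c p u] by (simp add: add const der lam_def)
  qed
  with add show "(\<forall>u v. f (u + v) = f u + f v) \<and> (\<forall>p u. f (sV p u) = p * f u)" by blast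
next
  assume "(\<forall>u v. f (u + v) = f u + f v) \<and> (\<forall>p u. f (sV p u) = p * f u)"
  then show "f \<in> cdual sV"
    by (auto simp: cdual_def chom_def der_def lam_def)
qed

lemma cdual_scale_conv: "cdual_scale p f = (\<lambda>u. pcompose p [:0, -1:] * f u)"
proof
  fix u
  have "additive (- lam :: 'b poly \<Rightarrow> 'b poly)" by (intro additive_ops)
  then show "cdual_scale p f u = pcompose p [:0, -1:] * f u"
    unfolding cdual_scale_def chom_scale_def
    by (induction p) (simp_all add: psubst_0 psubst_pCons pcompose_pCons lam_conv_mult algebra_simps)
qed

lemma cdual_scale_const [simp]: "cdual_scale [:c:] f = (\<lambda>u. smult c (f u))"
  by (simp add: cdual_scale_conv)

lemma der_cdual [simp]: "der cdual_scale f = (\<lambda>u. - lam (f u))"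
  by (simp add: cdual_scale_conv der_def lam_def pcompose_pCons)

lemma module_cdual_scale: "module (cdual_scale :: 'k::field_char_0 poly \<Rightarrow> ('v \<Rightarrow> 'k poly) \<Rightarrow> _)"
  by standard (simp_all add: cdual_scale_conv fun_eq_iff algebra_simps pcompose_add pcompose_mult
      pcompose_1)

lemma subspace_cdual:
  assumes "module sV"
  shows "module.subspace cdual_scale (cdual sV)"
proof -
  interpret W: module "cdual_scale :: 'a poly \<Rightarrow> ('b \<Rightarrow> 'a poly) \<Rightarrow> _" by (rule module_cdual_scale)
  show ?thesis
    by (rule W.subspaceI)
      (auto simp: cdual_iff[OF assms] cdual_scale_conv algebra_simps)
qed

subsection \<open>The dual action\<close>

lemma mu_conv_smult: "mu (q :: 'k::comm_ring_1 poly poly) = smult [:0, 1:] q"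
  by (simp add: mu_def poly_eq_iff coeff_map_poly)

lemma additive_mu: "additive (mu :: 'k::comm_ring_1 poly poly \<Rightarrow> _)"
  by (simp add: additive_def mu_conv_smult smult_add_right)

text \<open>The two-variable polynomial \<open>f\<^sub>\<mu>\<^sub>-\<^sub>\<lambda>(p)\<close> for \<open>p \<in> V[\<lambda>]\<close>, whose negative defines the dual action.\<close>

definition dual_poly :: "('v::ab_group_add \<Rightarrow> 'k::field_char_0 poly) \<Rightarrow> 'v poly \<Rightarrow> 'k poly poly" where
  "dual_poly f p = psubst lam (\<lambda>w. psubst (mu - lam) const2 (f w)) p"

lemma additive_mu_lam: "additive (mu - lam :: 'k::field_char_0 poly poly \<Rightarrow> _)"
  by (intro additive_ops additive_mu)

lemma additive_const2: "additive (const2 :: 'k::field_char_0 \<Rightarrow> _)"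
  by standard simp

lemma additive_cdual: "module sV \<Longrightarrow> f \<in> cdual sV \<Longrightarrow> additive f"
  by (simp add: additive_def cdual_iff)

lemma additive_dual_inner:
  fixes f :: "'v::ab_group_add \<Rightarrow> 'k::field_char_0 poly"
  assumes "additive f"
  shows "additive (\<lambda>w. psubst (mu - lam) const2 (f w))"
proof
  fix v w
  show "psubst (mu - lam) const2 (f (v + w)) =
      psubst (mu - lam) const2 (f v) + psubst (mu - lam) const2 (f w)"
    unfolding additive.add[OF assms]
    by (rule additive.add[OF additive_psubst[OF additive_mu_lam additive_const2]])
qed

lemma additive_dual_poly: "additive f \<Longrightarrow> additive (dual_poly f)"
  unfolding dual_poly_def by (intro additive_psubst additive_lam additive_dual_inner)

text \<open>
  As \<open>g\<^sub>\<lambda>(\<partial> u) = (\<partial> + \<lambda>) g\<^sub>\<lambda>(u)\<close> and \<open>f\<^sub>\<mu>\<^sub>-\<^sub>\<lambda>\<close> turns \<open>\<partial>\<close> into \<open>\<mu> - \<lambda>\<close>, the variable \<open>\<lambda>\<close> cancels and \<open>\<partial>\<close> acts as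
  multiplication by \<open>\<mu>\<close>. Hence the coefficients of the powers of \<open>\<lambda>\<close> lie in the conformal dual.
\<close>

lemma dual_poly_polynomial:
  assumes "module sV" "f \<in> cdual sV" "g \<in> chom sV sV"
  shows "dual_poly f (g (sV p u)) = smult p (dual_poly f (g u))"
proof -
  interpret V: module sV by fact
  have f: "additive f" using assms additive_cdual by blast
  let ?h = "\<lambda>w. psubst (mu - lam) const2 (f w)"
  have h: "additive ?h" by (rule additive_dual_inner[OF f])
  have h0: "?h 0 = 0" by (rule additive.zero[OF h])
  interpret D: additive "dual_poly f" by (rule additive_dual_poly[OF f])
  have scale: "dual_poly f (map_poly (sV [:c:]) q) = smult [:c:] (dual_poly f q)" for c q
  proof -
    have "?h (sV [:c:] w) = smult [:c:] (?h w)" for w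
    proof -
      have "smult [:c:] (?h w) = psubst (mu - lam) (\<lambda>x. smult [:c:] (const2 x)) (f w)"
        by (rule psubst_commute[OF additive_mu_lam _ additive_mu_lam])
          (auto simp: additive_def smult_add_right mu_conv_smult smult_diff_right lam_def mult.commute)
      also have "\<dots> = psubst (mu - lam) const2 (map_poly ((*) c) (f w))"
        by (subst psubst_map_poly) (use additive_mu_lam in \<open>auto simp: mult.commute\<close>)
      also have "map_poly ((*) c) (f w) = f (sV [:c:] w)"
        using assms by (simp add: cdual_iff smult_conv_map_poly)
      finally show ?thesis by (rule sym)
    qed
    then have "dual_poly f (map_poly (sV [:c:]) q) = psubst lam (\<lambda>w. smult [:c:] (?h w)) q"
      unfolding dual_poly_def by (subst psubst_map_poly) (use h0 additive_lam in auto)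
    also have "\<dots> = smult [:c:] (dual_poly f q)"
      unfolding dual_poly_def
      by (rule psubst_commute[symmetric, OF additive_lam _ additive_lam])
        (use h0 in \<open>auto simp: additive_def smult_add_right lam_def\<close>)
    finally show ?thesis .
  qed
  have shift: "dual_poly f ((lam + der1 sV) q) = smult [:0, 1:] (dual_poly f q)" for q
  proof -
    have hd: "?h (der sV w) = (mu - lam) (?h w)" for w
    proof -
      have "f (der sV w) = lam (f w)"
        using assms by (simp add: cdual_iff der_def lam_def)
      then show ?thesis using psubst_lam[OF additive_mu_lam, of const2] by simp
    qed
    have "dual_poly f (der1 sV q) = (mu - lam) (dual_poly f q)"
      unfolding dual_poly_def
      by (rule psubst_der1[OF assms(1) additive_lam h additive_mu_lam hd])
        (simp add: lam_diff mu_conv_smult lam_def)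
    moreover have "dual_poly f (lam q) = lam (dual_poly f q)"
      unfolding dual_poly_def by (rule psubst_lam[OF additive_lam, of ?h, OF h0])
    ultimately show ?thesis by (simp add: D.add mu_conv_smult)
  qed
  have gadd: "g (u + v) = g u + g v" and gconst: "g (sV [:c:] u) = map_poly (sV [:c:]) (g u)"
    and gder: "g (der sV u) = (lam + der1 sV) (g u)" for u v c
    using assms(3) by (auto simp: chom_def add.commute)
  show ?thesis
  proof (induction p)
    case 0
    then show ?case using gadd[of 0 0] D.zero by simp
  next
    case (pCons c p)
    have "dual_poly f (g (sV (pCons c p) u)) =
        smult [:c:] (dual_poly f (g u)) + smult [:0, 1:] (smult p (dual_poly f (g u)))"
      by (simp only: module_pCons[OF assms(1), of c p u] gadd D.add gconst gder scale shift pCons)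
    also have "\<dots> = smult (pCons c p) (dual_poly f (g u))"
      by (simp add: smult_add_left[symmetric] del: smult_pCons)
    finally show ?case .
  qed
qed

lemma additive_chom: "f \<in> chom sU sW \<Longrightarrow> additive f"
  by (simp add: additive_def chom_def)

lemma dual_poly_coeff_in_cdual:
  assumes "module sV" "f \<in> cdual sV" "g \<in> chom sV sV"
  shows "(\<lambda>u. coeff (dual_poly f (g u)) n) \<in> cdual sV"
  using assms dual_poly_polynomial[OF assms] additive.add[OF additive_chom[OF assms(3)]]
    additive.add[OF additive_dual_poly[OF additive_cdual[OF assms(1,2)]]]
  by (simp add: cdual_iff)

text \<open>
  By \<open>k[\<mu>]\<close>-linearity in \<open>u\<close> the degree in \<open>\<lambda>\<close> on a finite generating set bounds the degree on all of
  \<open>V\<close>. So the coefficient functions do form a polynomial, and \<open>Abs_poly\<close> returns them unchanged.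
\<close>

lemma coeff_dual_action:
  assumes "fg_module sV UNIV" "f \<in> cdual sV" "phi a \<in> chom sV sV"
  shows "coeff (dual_action phi a f) n = (\<lambda>u. - coeff (dual_poly f (phi a u)) n)"
proof -
  interpret V: fg_module sV UNIV by fact
  let ?D = "\<lambda>u. dual_poly f (phi a u)"
  obtain S where S: "finite S" "V.span S = UNIV" using V.finitely_generated by blast
  interpret D: additive ?D
    using additive_chom[OF assms(3)] additive_dual_poly[OF additive_cdual[OF V.module_axioms assms(2)]]
    by (simp add: additive_def)
  \<comment> \<open>The \<open>0\<close> only keeps the set nonempty.\<close>
  define N where "N = Max (insert 0 ((\<lambda>u. degree (?D u)) ` S))"
  have N: "degree (?D u) \<le> N" for u
  proof -
    have "u \<in> V.span S" using S by simp
    then show ?thesis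
    proof (induction u rule: V.span_induct_alt)
      case base
      then show ?case using D.zero by simp
    next
      case (step c x y)
      have "degree (?D x) \<le> N" using S step by (simp add: N_def)
      then have "degree (smult c (?D x)) \<le> N" by (meson degree_smult_le le_trans)
      with step show ?case
        by (simp add: D.add dual_poly_polynomial[OF V.module_axioms assms(2,3)] degree_add_le)
    qed
  qed
  show ?thesis
    unfolding dual_action_def dual_poly_def[symmetric]
  proof (subst coeff_Abs_poly)
    fix n assume "N < n"
    then have "coeff (?D u) n = 0" for u using N[of u] by (simp add: coeff_eq_0)
    then show "(\<lambda>u. coeff (- ?D u) n) = 0" by (simp add: fun_eq_iff)
  qed simp
qed

text \<open>
  The difference \<open>\<mu> - \<lambda>\<close> in the dual action becomes \<open>\<eta> - \<omega>\<close> when the two variables are replaced by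
  commuting operators \<open>\<lambda> = \<omega>\<close> and \<open>\<mu> = \<eta>\<close>.
\<close>

lemma dual_action_operators:
  assumes "fg_module sV UNIV" "f \<in> cdual sV" "phi a \<in> chom sV sV"
    and \<omega>: "module_hom sc sc \<omega>" and \<eta>: "module_hom sc sc \<eta>"
    and comm: "\<And>x. \<omega> (\<eta> x) = \<eta> (\<omega> x)"
  shows "psubst \<omega> (\<lambda>h. opoly sc \<eta> (h u) x) (dual_action phi a f) =
    - psubst \<omega> (\<lambda>w. opoly sc (\<eta> - \<omega>) (f w) x) (phi a u)"
proof -
  interpret sc: module sc using \<omega> by (rule module_hom_domain)
  note add = additive_hom[OF \<omega>] additive_hom[OF \<eta>]
  interpret f: additive f
    using assms(1,2) additive_cdual fg_module.axioms(1) by blast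
  define G where "G = psubst \<omega> (\<lambda>c. opoly sc \<eta> c x)"
  have eG: "additive (\<lambda>c. opoly sc \<eta> c x)"
    by (simp add: additive_def opoly_add_left \<eta>)
  interpret G: additive G
    unfolding G_def by (intro additive_psubst add eG)
  have G_const: "G (const2 c) = sc c x" for c
    unfolding G_def using additive.zero[OF add(2)]
    by (subst psubst_const) (simp_all add: add sc.module_axioms opoly_pCons[OF \<eta>])
  have G_lam: "G (lam q) = \<omega> (G q)" for q
    unfolding G_def by (rule psubst_lam) (simp_all add: add sc.module_axioms)
  have G_mu: "G (mu q) = \<eta> (G q)" for q
  proof -
    have "G (mu q) = psubst \<omega> (\<lambda>c. opoly sc \<eta> (pCons 0 c) x) q"
      unfolding G_def mu_def by (subst psubst_map_poly) (simp_all add: add sc.module_axioms)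
    also have "\<dots> = psubst \<omega> (\<lambda>c. \<eta> (opoly sc \<eta> c x)) q"
      by (simp add: opoly_pCons[OF \<eta>])
    also have "\<dots> = \<eta> (G q)"
      unfolding G_def
      by (rule psubst_commute[symmetric]) (simp_all add: add comm sc.module_axioms)
    finally show ?thesis .
  qed
  have "psubst \<omega> (\<lambda>h. opoly sc \<eta> (h u) x) (dual_action phi a f) =
      G (map_poly (\<lambda>h. h u) (dual_action phi a f))"
    unfolding G_def by (subst psubst_map_poly) (simp_all add: add sc.module_axioms)
  also have "map_poly (\<lambda>h. h u) (dual_action phi a f) = - dual_poly f (phi a u)"
    by (simp add: poly_eq_iff coeff_map_poly coeff_dual_action[where phi = phi and a = a, OF assms(1-3)])
  also have "G (- dual_poly f (phi a u)) = - G (dual_poly f (phi a u))"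
    by (rule G.minus)
  also have "G (dual_poly f (phi a u)) =
      psubst \<omega> (\<lambda>w. G (psubst (mu - lam) const2 (f w))) (phi a u)"
    unfolding dual_poly_def
    by (rule psubst_commute)
      (simp_all add: additive_lam add G.additive_axioms G_lam f.zero psubst_0)
  also have "(\<lambda>w. G (psubst (mu - lam) const2 (f w))) = (\<lambda>w. opoly sc (\<eta> - \<omega>) (f w) x)"
  proof
    fix w
    have "G (psubst (mu - lam) const2 (f w)) = psubst (\<eta> - \<omega>) (\<lambda>c. G (const2 c)) (f w)"
      by (rule psubst_commute[OF additive_mu_lam _ additive_diff_op[OF add(2) add(1)]])
        (simp_all add: G.additive_axioms G.diff G_mu G_lam)
    then show "G (psubst (mu - lam) const2 (f w)) = opoly sc (\<eta> - \<omega>) (f w) x"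
      by (simp add: opoly_def G_const)
  qed
  finally show ?thesis .
qed

section \<open>Formal sums and linear extension\<close>

lemma lookup_fscale [simp]: "Poly_Mapping.lookup (fscale c t) x = c * Poly_Mapping.lookup t x"
  by (simp add: fscale_def Poly_Mapping.map.rep_eq when_def)

lemma vector_space_fscale: "vector_space (fscale :: 'k::field \<Rightarrow> ('x \<Rightarrow>\<^sub>0 'k) \<Rightarrow> _)"
  by standard (simp_all add: poly_mapping_eq_iff fun_eq_iff lookup_add algebra_simps)

lemma module_fscale: "module (fscale :: 'k::field \<Rightarrow> ('x \<Rightarrow>\<^sub>0 'k) \<Rightarrow> _)"
  using vector_space_fscale by (simp add: module_iff_vector_space)

lemma lin_ext_superset:
  assumes "module sc" "finite K" "Poly_Mapping.keys t \<subseteq> K"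
  shows "lin_ext sc g t = (\<Sum>x\<in>K. sc (Poly_Mapping.lookup t x) (g x))"
proof -
  interpret module sc by fact
  show ?thesis
    unfolding lin_ext_def
    by (rule sum.mono_neutral_left) (use assms in \<open>auto simp: in_keys_iff\<close>)
qed

lemma lin_ext_linear:
  fixes sc :: "'k::field \<Rightarrow> 'm::ab_group_add \<Rightarrow> 'm" and g :: "'x \<Rightarrow> 'm"
  assumes "module sc"
  shows "module_hom fscale sc (lin_ext sc g)"
proof -
  interpret module sc by fact
  show ?thesis
  proof (rule module_hom.intro[OF module_fscale module_axioms], unfold_locales)
    fix c and s t :: "'x \<Rightarrow>\<^sub>0 'k"
    let ?K = "Poly_Mapping.keys s \<union> Poly_Mapping.keys t"
    have "Poly_Mapping.keys (s + t) \<subseteq> ?K" by (rule keys_add)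
    then show "lin_ext sc g (s + t) = lin_ext sc g s + lin_ext sc g t"
      by (simp add: lin_ext_superset[OF assms, of ?K] lookup_add scale_left_distrib sum.distrib)
    have "Poly_Mapping.keys (fscale c t) \<subseteq> Poly_Mapping.keys t"
      by (auto simp: in_keys_iff)
    then show "lin_ext sc g (fscale c t) = sc c (lin_ext sc g t)"
      by (simp add: lin_ext_superset[OF assms, of "Poly_Mapping.keys t"] scale_sum_right)
  qed
qed

lemma lin_ext_pure [simp]: "module sc \<Longrightarrow> lin_ext sc g (pure x) = g x"
  using module.scale_one[of sc] by (simp add: lin_ext_def pure_def)

lemma lin_ext_hom:
  assumes "module_hom sc sc' H"
  shows "H (lin_ext sc g t) = lin_ext sc' (\<lambda>x. H (g x)) t"
  by (simp add: lin_ext_def module_hom.sum[OF assms] module_hom.scale[OF assms])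

lemma lin_ext_zero_fun: "module sc \<Longrightarrow> (\<And>x. x \<in> Poly_Mapping.keys t \<Longrightarrow> g x = 0) \<Longrightarrow> lin_ext sc g t = 0"
  by (simp add: lin_ext_def module.scale_zero_right[of sc])

lemma lin_ext_add_fun:
  "module sc \<Longrightarrow> lin_ext sc (\<lambda>x. g x + h x) t = lin_ext sc g t + lin_ext sc h t"
  by (simp add: lin_ext_def module.scale_right_distrib[of sc] sum.distrib)

lemma lin_ext_cong:
  "(\<And>x. x \<in> Poly_Mapping.keys t \<Longrightarrow> g x = h x) \<Longrightarrow> lin_ext sc g t = lin_ext sc h t"
  by (simp add: lin_ext_def)

lemma formal_sum_conv_pure: "lin_ext fscale pure t = t"
proof -
  have "Poly_Mapping.lookup (lin_ext fscale pure t) x = Poly_Mapping.lookup t x" for x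
    by (simp add: lin_ext_def lookup_sum pure_def lookup_single when_def if_distrib sum.delta'
        in_keys_iff cong: if_cong)
  then show ?thesis by (simp add: poly_mapping_eq_iff fun_eq_iff)
qed

lemma subspace_formal_sums: "module.subspace fscale (formal_sums X :: ('x \<Rightarrow>\<^sub>0 'k::field) set)"
proof -
  interpret module "fscale :: 'k \<Rightarrow> ('x \<Rightarrow>\<^sub>0 'k) \<Rightarrow> _" by (rule module_fscale)
  show ?thesis
  proof (rule subspaceI)
    fix s t :: "'x \<Rightarrow>\<^sub>0 'k" and c
    assume s: "s \<in> formal_sums X"
    have "Poly_Mapping.keys (fscale c s) \<subseteq> Poly_Mapping.keys s" by (auto simp: in_keys_iff)
    with s show "fscale c s \<in> formal_sums X" by (simp add: formal_sums_def)
    assume "t \<in> formal_sums X"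
    with s keys_add[of s t] show "s + t \<in> formal_sums X" by (auto simp: formal_sums_def)
  qed (simp add: formal_sums_def)
qed

lemma pure_in_formal_sums [simp]: "pure x \<in> (formal_sums X :: ('x \<Rightarrow>\<^sub>0 'k::field) set) \<longleftrightarrow> x \<in> X"
  by (simp add: pure_def formal_sums_def)

lemma lin_ext_in_subspace:
  assumes "module sc" "module.subspace sc S" "\<And>x. x \<in> Poly_Mapping.keys t \<Longrightarrow> g x \<in> S"
  shows "lin_ext sc g t \<in> S"
  unfolding lin_ext_def
  by (intro module.subspace_sum[OF assms(1,2)] module.subspace_scale[OF assms(1,2)] assms(3))

section \<open>Invariant trilinear forms\<close>

text \<open>
  These are the linear maps on a threefold tensor product that vanish on the image of the total derivation.
  Working with them replaces computations modulo multilinearity relations and modulo that image by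
  computations with equations.
\<close>

definition invariant_form ::
  "('k::field_char_0 poly \<Rightarrow> 'a::ab_group_add \<Rightarrow> 'a) \<Rightarrow> ('k poly \<Rightarrow> 'b::ab_group_add \<Rightarrow> 'b) \<Rightarrow>
   ('k poly \<Rightarrow> 'c::ab_group_add \<Rightarrow> 'c) \<Rightarrow> ('k \<Rightarrow> 'm::ab_group_add \<Rightarrow> 'm) \<Rightarrow> ('a \<Rightarrow> 'b \<Rightarrow> 'c \<Rightarrow> 'm) \<Rightarrow> bool" where
  "invariant_form s1 s2 s3 sc \<tau> \<longleftrightarrow>
     (\<forall>y z. module_hom (\<lambda>c. s1 [:c:]) sc (\<lambda>x. \<tau> x y z)) \<and>
     (\<forall>x z. module_hom (\<lambda>c. s2 [:c:]) sc (\<lambda>y. \<tau> x y z)) \<and>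
     (\<forall>x y. module_hom (\<lambda>c. s3 [:c:]) sc (\<lambda>z. \<tau> x y z)) \<and>
     (\<forall>x y z. \<tau> (der s1 x) y z + \<tau> x (der s2 y) z + \<tau> x y (der s3 z) = 0)"

abbreviation uncurry3 :: "('a \<Rightarrow> 'b \<Rightarrow> 'c \<Rightarrow> 'm) \<Rightarrow> 'a \<times> 'b \<times> 'c \<Rightarrow> 'm" where
  "uncurry3 \<tau> \<equiv> \<lambda>(x, y, z). \<tau> x y z"

abbreviation total_der :: "('k::field_char_0 poly \<Rightarrow> 'a \<Rightarrow> 'a) \<Rightarrow> ('a \<times> 'a \<times> 'a \<Rightarrow>\<^sub>0 'k) \<Rightarrow> 'a \<times> 'a \<times> 'a \<Rightarrow>\<^sub>0 'k" where
  "total_der s \<equiv> der_1 s + der_2 s + der_3 s"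

lemma der_slot_linear:
  "module_hom fscale fscale (der_1 s)" "module_hom fscale fscale (der_2 s)"
  "module_hom fscale fscale (der_3 s)"
  unfolding der_1_def der_2_def der_3_def by (intro lin_ext_linear module_fscale)+

lemma total_der_linear: "module_hom fscale fscale (total_der s)"
  by (intro linear_plus_op der_slot_linear)

lemma lin_ext_der_slot:
  assumes "module sc"
  shows "lin_ext sc g (der_1 s t) = lin_ext sc (\<lambda>(x, y, z). g (der s x, y, z)) t"
    and "lin_ext sc g (der_2 s t) = lin_ext sc (\<lambda>(x, y, z). g (x, der s y, z)) t"
    and "lin_ext sc g (der_3 s t) = lin_ext sc (\<lambda>(x, y, z). g (x, y, der s z)) t"
  unfolding der_1_def der_2_def der_3_def
  by (simp_all add: lin_ext_hom[OF lin_ext_linear[OF assms]] case_prod_unfold assms)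

lemma lin_ext_total_der:
  assumes "module sc" "invariant_form s s s sc \<tau>"
  shows "lin_ext sc (uncurry3 \<tau>) (total_der s t) = 0"
proof -
  interpret H: module_hom fscale sc "lin_ext sc (uncurry3 \<tau>)" by (rule lin_ext_linear) fact
  have "lin_ext sc (uncurry3 \<tau>) (total_der s t) =
      lin_ext sc (\<lambda>(x, y, z). \<tau> (der s x) y z + \<tau> x (der s y) z + \<tau> x y (der s z)) t"
    by (simp only: plus_fun_apply H.add lin_ext_der_slot[OF assms(1)])
      (simp add: lin_ext_add_fun[OF assms(1), symmetric] case_prod_unfold)
  also have "\<dots> = 0"
    by (rule lin_ext_zero_fun) (use assms in \<open>auto simp: invariant_form_def\<close>)
  finally show ?thesis .
qed

text \<open>The generators of \<open>tensor3_null\<close>, on which linear maps can be tested.\<close>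

definition tensor3_relations where
  "tensor3_relations s A = (\<Union>b\<in>A. \<Union>c\<in>A.
     slot_relations s A (\<lambda>x. (x, b, c)) \<union> slot_relations s A (\<lambda>x. (b, x, c)) \<union>
     slot_relations s A (\<lambda>x. (b, c, x)))"

lemma in_der_image_iff_span:
  "in_der_image s A t \<longleftrightarrow>
     t \<in> module.span fscale (tensor3_relations s A \<union> total_der s ` formal_sums (A \<times> A \<times> A))"
  (is "_ \<longleftrightarrow> t \<in> module.span fscale (?R \<union> ?D)")
proof -
  interpret F: module "fscale :: 'a \<Rightarrow> ('b \<times> 'b \<times> 'b \<Rightarrow>\<^sub>0 'a) \<Rightarrow> _" by (rule module_fscale)
  have D: "F.span ?D = ?D"
    unfolding F.span_eq_iff
    by (rule module_hom.subspace_image[OF total_der_linear subspace_formal_sums])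
  show ?thesis
  proof
    assume "in_der_image s A t"
    then obtain w where w: "w \<in> formal_sums (A \<times> A \<times> A)" "t - total_der s w \<in> F.span ?R"
      unfolding in_der_image_def tensor3_null_def tensor3_relations_def[symmetric] by blast
    have "t - total_der s w \<in> F.span (?R \<union> ?D)"
      using w(2) F.span_mono[OF Un_upper1] by (rule rev_subsetD)
    moreover have "total_der s w \<in> F.span (?R \<union> ?D)"
      using w(1) by (intro F.span_base UnI2 imageI)
    ultimately have "(t - total_der s w) + total_der s w \<in> F.span (?R \<union> ?D)"
      by (rule F.span_add)
    then show "t \<in> F.span (?R \<union> ?D)" by (simp only: diff_add_cancel)
  next
    assume "t \<in> F.span (?R \<union> ?D)"
    then obtain n d where t: "t = n + d" "n \<in> F.span ?R" "d \<in> ?D"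
      unfolding F.span_Un D by (elim CollectE exE conjE) (rule that)
    from t(3) obtain w where w: "d = total_der s w" "w \<in> formal_sums (A \<times> A \<times> A)"
      by (rule imageE)
    have "t - total_der s w = n" unfolding t(1) w(1) by (rule add_diff_cancel_right')
    with t(2) have "t - total_der s w \<in> F.span ?R" by (simp only:)
    with w(2) show "in_der_image s A t"
      unfolding in_der_image_def tensor3_null_def tensor3_relations_def[symmetric] by (rule bexI[rotated])
  qed
qed

lemma slot_relations_killed:
  assumes "module_hom (\<lambda>c. s [:c:]) sc (\<lambda>x. g (slot x))" "t \<in> slot_relations s A slot"
  shows "lin_ext sc g t = 0"
proof -
  note sc = module_hom_codomain[OF assms(1)]
  note add = module_hom.add[OF assms(1)] and scale = module_hom.scale[OF assms(1)]
  interpret H: module_hom fscale sc "lin_ext sc g" by (rule lin_ext_linear) (rule sc)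
  consider x y where "t = pure (slot (x + y)) - pure (slot x) - pure (slot y)"
    | c x where "t = pure (slot (s [:c:] x)) - fscale c (pure (slot x))"
    using assms(2) unfolding slot_relations_def by blast
  then show ?thesis
    by cases (simp_all add: H.diff H.scale sc add scale)
qed

lemma invariant_form_kills_der_image:
  assumes "module sc" "invariant_form s s s sc \<tau>" "in_der_image s A t"
  shows "lin_ext sc (uncurry3 \<tau>) t = 0"
proof -
  interpret H: module_hom fscale sc "lin_ext sc (uncurry3 \<tau>)" by (rule lin_ext_linear) fact
  show ?thesis
  proof (rule H.eq_0_on_span[OF _ iffD1[OF in_der_image_iff_span assms(3)]])
  fix u assume "u \<in> tensor3_relations s A \<union> total_der s ` formal_sums (A \<times> A \<times> A)"
  moreover have "lin_ext sc (uncurry3 \<tau>) u = 0" if "u \<in> tensor3_relations s A"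
  proof -
    have lin: "module_hom (\<lambda>c. s [:c:]) sc (\<lambda>x. uncurry3 \<tau> (x, b, c))"
      "module_hom (\<lambda>c. s [:c:]) sc (\<lambda>x. uncurry3 \<tau> (b, x, c))"
      "module_hom (\<lambda>c. s [:c:]) sc (\<lambda>x. uncurry3 \<tau> (b, c, x))" for b c
      using assms(2) unfolding invariant_form_def case_prod_conv by blast+
    consider b c where "u \<in> slot_relations s A (\<lambda>x. (x, b, c))"
      | b c where "u \<in> slot_relations s A (\<lambda>x. (b, x, c))"
      | b c where "u \<in> slot_relations s A (\<lambda>x. (b, c, x))"
      using \<open>u \<in> tensor3_relations s A\<close> unfolding tensor3_relations_def by blast
    then show ?thesis
    proof cases
      case 1
      then show ?thesis by (rule slot_relations_killed[where g = "uncurry3 \<tau>" and slot = "\<lambda>x. (x, b, c)", OF lin(1)])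
    next
      case 2
      then show ?thesis by (rule slot_relations_killed[where g = "uncurry3 \<tau>" and slot = "\<lambda>x. (b, x, c)", OF lin(2)])
    next
      case 3
      then show ?thesis by (rule slot_relations_killed[where g = "uncurry3 \<tau>" and slot = "\<lambda>x. (b, c, x)", OF lin(3)])
    qed
  qed
  moreover have "lin_ext sc (uncurry3 \<tau>) u = 0" if "u \<in> total_der s ` formal_sums (A \<times> A \<times> A)"
    using that by (rule imageE) (simp only: lin_ext_total_der[OF assms(1,2)])
  ultimately show "lin_ext sc (uncurry3 \<tau>) u = 0" by (elim UnE)
  qed
qed

lemma separating_functional:
  fixes sc :: "'k::field \<Rightarrow> 'm::ab_group_add \<Rightarrow> 'm"
  assumes "vector_space sc" "t \<notin> module.span sc S"
  shows "\<exists>\<phi>. module_hom sc (*) \<phi> \<and> (\<forall>x\<in>S. \<phi> x = 0) \<and> \<phi> t \<noteq> 0"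
proof -
  interpret vector_space sc by fact
  interpret vector_space_pair sc "(*) :: 'k \<Rightarrow> 'k \<Rightarrow> 'k"
    by unfold_locales (simp_all add: algebra_simps)
  obtain B where B: "B \<subseteq> S" "independent B" "S \<subseteq> span B"
    using maximal_independent_subset by blast
  have "t \<notin> span B" using assms(2) span_mono[OF B(1)] by blast
  then have ind: "independent (insert t B)" and "t \<notin> B"
    using B(2) by (auto simp: independent_insert span_base)
  obtain \<phi> where \<phi>: "Vector_Spaces.linear sc (*) \<phi>" "\<forall>x\<in>insert t B. \<phi> x = (if x = t then 1 else 0)"
    using linear_independent_extend[OF ind, of "\<lambda>x. if x = t then 1 else 0"] by blast
  have hom: "module_hom sc (*) \<phi>"
    using \<phi>(1) by (simp add: Vector_Spaces.linear_def)
  have "\<phi> x = 0" if "x \<in> S" for x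
    by (rule module_hom.eq_0_on_span[OF hom, of B]) (use \<phi>(2) B \<open>t \<notin> B\<close> that in auto)
  with hom \<phi>(2) show ?thesis by auto
qed

text \<open>
  Otherwise a linear functional separates \<open>t\<close> from the relations and the image of the total derivation. It
  gives a form on \<open>A\<close> only; composing with a \<open>k[\<partial>]\<close>-linear projection \<open>\<pi>\<close> onto \<open>A\<close> extends the form to the
  whole type, so that forms need no side conditions on their arguments.
\<close>

lemma in_der_image_if_forms_vanish:
  fixes s :: "'k::field_char_0 poly \<Rightarrow> 'a::ab_group_add \<Rightarrow> 'a"
  assumes s: "module s" and t: "t \<in> formal_sums (A \<times> A \<times> A)"
    and \<pi>: "module_hom s s \<pi>" "\<And>x. \<pi> x \<in> A" "\<And>x. x \<in> A \<Longrightarrow> \<pi> x = x"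
    and van: "\<And>\<tau>. invariant_form s s s (*) \<tau> \<Longrightarrow> (\<And>x y z. \<tau> (\<pi> x) (\<pi> y) (\<pi> z) = \<tau> x y z) \<Longrightarrow>
      lin_ext (*) (uncurry3 \<tau>) t = 0"
  shows "in_der_image s A t"
proof (rule ccontr)
  assume "\<not> in_der_image s A t"
  then obtain \<phi> where \<phi>: "module_hom fscale (*) \<phi>"
    and zero: "\<And>u. u \<in> tensor3_relations s A \<Longrightarrow> \<phi> u = 0"
      "\<And>w. w \<in> formal_sums (A \<times> A \<times> A) \<Longrightarrow> \<phi> (total_der s w) = 0"
    and "\<phi> t \<noteq> 0"
    using separating_functional[OF vector_space_fscale] unfolding in_der_image_iff_span by blast
  interpret \<phi>: module_hom fscale "(*)" \<phi> by fact
  interpret \<pi>: module_hom s s \<pi> by fact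
  define \<tau> where "\<tau> x y z = \<phi> (pure (\<pi> x, \<pi> y, \<pi> z))" for x y z
  have rel: "\<phi> u = 0" if "u \<in> slot_relations s A (\<lambda>x. (x, b, c)) \<or>
      u \<in> slot_relations s A (\<lambda>x. (b, x, c)) \<or> u \<in> slot_relations s A (\<lambda>x. (b, c, x))"
      "b \<in> A" "c \<in> A" for u b c
    by (rule zero(1)) (use that in \<open>auto simp: tensor3_relations_def\<close>)
  have lin: "module_hom (\<lambda>c. s [:c:]) (*) (\<lambda>x. \<phi> (pure (slot (\<pi> x))))"
    if slot: "\<And>u. u \<in> slot_relations s A slot \<Longrightarrow> \<phi> u = 0" for slot
  proof (rule module_hom.intro[OF scalar_module[OF s] \<phi>.m2.module_axioms], unfold_locales)
    fix x y c
    have "\<phi> (pure (slot (\<pi> x + \<pi> y)) - pure (slot (\<pi> x)) - pure (slot (\<pi> y))) = 0"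
      by (rule slot, unfold slot_relations_def, rule UnI1, intro CollectI exI conjI) (use \<pi>(2) in simp_all)
    then show "\<phi> (pure (slot (\<pi> (x + y)))) = \<phi> (pure (slot (\<pi> x))) + \<phi> (pure (slot (\<pi> y)))"
      by (simp add: \<pi>.add \<phi>.add \<phi>.diff diff_diff_eq)
    have "\<phi> (pure (slot (s [:c:] (\<pi> x))) - fscale c (pure (slot (\<pi> x)))) = 0"
      by (rule slot, unfold slot_relations_def, rule UnI2, intro CollectI exI conjI) (use \<pi>(2) in simp_all)
    then show "\<phi> (pure (slot (\<pi> (s [:c:] x)))) = c * \<phi> (pure (slot (\<pi> x)))"
      by (simp add: \<pi>.scale \<phi>.diff \<phi>.scale)
  qed
  have "invariant_form s s s (*) \<tau>"
    unfolding invariant_form_def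
  proof (intro conjI allI)
    fix x y z
    show "module_hom (\<lambda>c. s [:c:]) (*) (\<lambda>x. \<tau> x y z)"
      unfolding \<tau>_def by (rule lin) (use \<pi>(2) rel in blast)
    show "module_hom (\<lambda>c. s [:c:]) (*) (\<lambda>y. \<tau> x y z)"
      unfolding \<tau>_def by (rule lin) (use \<pi>(2) rel in blast)
    show "module_hom (\<lambda>c. s [:c:]) (*) (\<lambda>z. \<tau> x y z)"
      unfolding \<tau>_def by (rule lin) (use \<pi>(2) rel in blast)
    have "\<phi> (total_der s (pure (\<pi> x, \<pi> y, \<pi> z))) = 0"
      by (rule zero(2)) (use \<pi>(2) in simp)
    then show "\<tau> (der s x) y z + \<tau> x (der s y) z + \<tau> x y (der s z) = 0"
      by (simp add: \<tau>_def der_1_def der_2_def der_3_def module_fscale \<phi>.add der_def \<pi>.scale)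
  qed
  moreover have "\<tau> (\<pi> x) (\<pi> y) (\<pi> z) = \<tau> x y z" for x y z
    by (simp add: \<tau>_def \<pi>)
  ultimately have "lin_ext (*) (uncurry3 \<tau>) t = 0" by (rule van)
  moreover have "lin_ext (*) (uncurry3 \<tau>) t = lin_ext (*) (\<lambda>u. \<phi> (pure u)) t"
    by (rule lin_ext_cong) (use t \<pi>(3) in \<open>auto simp: \<tau>_def formal_sums_def\<close>)
  moreover have "\<dots> = \<phi> t"
    using lin_ext_hom[OF \<phi>, of pure t] by (simp add: formal_sum_conv_pure)
  ultimately show False using \<open>\<phi> t \<noteq> 0\<close> by simp
qed

section \<open>The Yang-Baxter form of a product and an action\<close>

text \<open>
  The commutative product and the skew-commutative bracket are treated together. The parameter \<open>e\<close> is
  \<open>True\<close> for the product and \<open>False\<close> for the bracket.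
\<close>

definition signed :: "bool \<Rightarrow> 'a::uminus \<Rightarrow> 'a" where
  "signed e x = (if e then x else - x)"

lemma signed_signed [simp]: "signed e (signed e x) = (x::'a::ab_group_add)"
  by (simp add: signed_def)

lemma signed_0 [simp]: "signed e 0 = (0::'a::ab_group_add)"
  by (simp add: signed_def)

lemma signed_minus: "signed e (- x) = - signed e (x::'a::ab_group_add)"
  by (simp add: signed_def)

lemma signed_additive: "additive f \<Longrightarrow> f (signed e x) = signed e (f x)"
  by (simp add: signed_def additive.minus)

lemma signed_sum: "signed e (\<Sum>i\<in>I. f i) = (\<Sum>i\<in>I. signed e (f i :: 'a::ab_group_add))"
  by (simp add: signed_def sum_negf)

lemma sum_fun_apply: "(\<Sum>i\<in>I. F i) x = (\<Sum>i\<in>I. F i x)"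
  by (induction I rule: infinite_finite_induct) simp_all

text \<open>
  A conformal product that is commutative up to the sign \<open>e\<close>, acting on \<open>V\<close>. The associative product with \<open>l\<close>
  and the bracket with \<open>\<rho>\<close> are both of this kind.
\<close>

locale commutative_product_with_action =
  P: conformal_product sP UNIV q + V: fg_module sV UNIV
  for sP :: "'k::field_char_0 poly \<Rightarrow> 'p::ab_group_add \<Rightarrow> 'p" and q
    and sV :: "'k poly \<Rightarrow> 'v::ab_group_add \<Rightarrow> 'v" +
  fixes phi :: "'p \<Rightarrow> 'v \<Rightarrow> 'v poly" and e :: bool
  assumes symmetric: "q a b = signed e (twist sP (q b a))"
    and action_gc: "phi a \<in> chom sV sV"
    and action_hom: "module_hom sP (chom_scale sV) phi"
    and free: "free_module sV"
begin

abbreviation "psP \<equiv> poly_scale sP"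
abbreviation "dW \<equiv> der (cdual_scale :: 'k poly \<Rightarrow> ('v \<Rightarrow> 'k poly) \<Rightarrow> _)"

lemma additive_q_left: "additive (\<lambda>a. q a b)" and additive_q_right: "additive (q a)"
  using P.add_left P.add_right by (simp_all add: additive_def)

lemma q_scale_left: "psP c (q a b) = q (sP [:c:] a) b"
  and q_scale_right: "psP c (q a b) = q a (sP [:c:] b)"
  using P.scalar_left P.scalar_right by (simp_all add: poly_scale_def)

lemma q_polynomial_left: "q (sP p a) b = opoly psP (- lam) p (q a b)"
proof (rule opoly_unique)
  interpret l: additive "\<lambda>a. q a b" by (rule additive_q_left)
  show "q (sP 0 a) b = 0" using l.zero by simp
  show "q (sP (pCons c p) a) b = psP c (q a b) + (- lam) (q (sP p a) b)" for c p
    using P.der_left[of "sP p a" b]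
    by (simp add: module_pCons[OF P.module_axioms, of c p a] l.add q_scale_left)
qed (intro linear_ops P.module_axioms)

lemma q_polynomial_right: "q a (sP p b) = opoly psP (lam + der1 sP) p (q a b)"
proof (rule opoly_unique)
  interpret r: additive "q a" by (rule additive_q_right)
  show "q a (sP 0 b) = 0" using r.zero by simp
  show "q a (sP (pCons c p) b) = psP c (q a b) + (lam + der1 sP) (q a (sP p b))" for c p
    using P.der_right[of a "sP p b"]
    by (simp add: module_pCons[OF P.module_axioms, of c p b] r.add q_scale_right add.commute[of "lam _"])
qed (intro linear_ops P.module_axioms)

lemma action_add_left: "phi (a + b) u = phi a u + phi b u"
  using module_hom.add[OF action_hom] by simp

lemma action_polynomial_left: "phi (sP p a) u = opoly (poly_scale sV) (- lam) p (phi a u)"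
  using module_hom.scale[OF action_hom] by (simp add: chom_scale_def opoly_def poly_scale_def)

lemma action_scale_left: "phi (sP [:c:] a) u = poly_scale sV c (phi a u)"
proof -
  have lin: "module_hom (poly_scale sV) (poly_scale sV) (- lam)"
    by (intro linear_ops V.module_axioms)
  show ?thesis
    by (simp add: action_polynomial_left opoly_pCons[OF lin] V.module_axioms module_poly_scale)
qed

text \<open>
  The action of \<open>P\<close> on \<open>V\<^sup>*\<^sup>c\<close> in the semi-direct product: \<open>-l\<^sup>*\<close> for the product and \<open>\<rho>\<^sup>*\<close> for the bracket.
\<close>

definition dual :: "'p \<Rightarrow> ('v \<Rightarrow> 'k poly) \<Rightarrow> ('v \<Rightarrow> 'k poly) poly" where
  "dual a f = - signed e (dual_action phi a f)"

text \<open>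
  For \<open>r = \<Sum>\<^sub>i (a\<^sub>i \<otimes> f\<^sub>i - f\<^sub>i \<otimes> a\<^sub>i)\<close>, the component in \<open>P \<otimes> V\<^sup>*\<^sup>c \<otimes> V\<^sup>*\<^sup>c\<close> of the Yang-Baxter expression is a sum over
  pairs of indices. This is the value under \<open>\<tau>\<close> of its term for the pair \<open>(a, f)\<close>, \<open>(b, g)\<close>. The sign in the
  last summand comes from reordering the factors of a product.
\<close>

definition yb_form ::
  "('p \<Rightarrow> ('v \<Rightarrow> 'k poly) \<Rightarrow> ('v \<Rightarrow> 'k poly) \<Rightarrow> 'm::ab_group_add) \<Rightarrow>
   'p \<Rightarrow> ('v \<Rightarrow> 'k poly) \<Rightarrow> 'p \<Rightarrow> ('v \<Rightarrow> 'k poly) \<Rightarrow> 'm" where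
  "yb_form \<tau> a f b g =
     slot_subst dW (\<lambda>z x. \<tau> z x g) (q a b) f
   - slot_subst dW (\<lambda>h y. \<tau> a h y) (dual b f) g
   - signed e (slot_subst dW (\<lambda>h y. \<tau> a y h) (dual b f) g)"

lemma yb_form_hom:
  assumes "\<And>i. additive (H i)"
  shows "yb_form (\<lambda>x y z. \<Sum>i\<in>I. H i (\<tau> i x y z)) a f b g = (\<Sum>i\<in>I. H i (yb_form (\<tau> i) a f b g))"
  unfolding yb_form_def slot_subst_sum slot_subst_hom[OF assms, symmetric]
  by (simp add: additive.diff[OF assms] signed_additive[OF assms, symmetric] sum_subtractf signed_sum)

section \<open>Evaluation of forms at two vectors\<close>

text \<open>
  The form \<open>f\<^sub>-\<^sub>\<lambda>(u) g\<^sub>\<lambda>\<^sub>+\<^sub>\<partial>(v) a\<close> with values in \<open>P[\<lambda>]\<close>. On its three arguments, \<open>\<partial>\<close> acts as \<open>\<partial>\<close>, \<open>\<lambda>\<close> and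
  \<open>-\<lambda> - \<partial>\<close>, and these sum to zero.
\<close>

definition eval_form :: "'v \<Rightarrow> 'v \<Rightarrow> 'p \<Rightarrow> ('v \<Rightarrow> 'k poly) \<Rightarrow> ('v \<Rightarrow> 'k poly) \<Rightarrow> 'p poly" where
  "eval_form u v a f g =
     opoly psP (- lam) (f u) (opoly psP (lam + der1 sP) (g v) [:a:])"

lemma module_psP: "module psP"
  by (intro module_poly_scale P.module_axioms)

lemma additive_psP: "additive (psP c)"
  by standard (rule module.scale_right_distrib[OF module_psP])

lemma linear_lam: "module_hom psP psP lam"
  and linear_minus_lam: "module_hom psP psP (- lam)"
  and linear_lam_der: "module_hom psP psP (lam + der1 sP)"
  and linear_twist_op: "module_hom psP psP (- lam - der1 sP)"
  by (intro linear_ops P.module_axioms)+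

lemma lam_der_commute: "(- lam) ((lam + der1 sP) x) = (lam + der1 sP) ((- lam) x)"
  by (simp add: P.module_axioms der1_minus lam_add lam_minus)

lemma eval_form_swap:
  "eval_form u v a f g = opoly psP (lam + der1 sP) (g v) (opoly psP (- lam) (f u) [:a:])"
  unfolding eval_form_def by (rule opoly_commute[OF linear_minus_lam linear_lam_der lam_der_commute])

lemma invariant_eval_form:
  "invariant_form sP cdual_scale cdual_scale psP (eval_form u v)"
  unfolding invariant_form_def
proof (intro conjI allI)
  fix a and f g :: "'v \<Rightarrow> 'k poly"
  have s: "module (\<lambda>c. (cdual_scale :: 'k poly \<Rightarrow> ('v \<Rightarrow> 'k poly) \<Rightarrow> _) [:c:])"
    by (rule scalar_module[OF module_cdual_scale])
  have "module_hom (\<lambda>c. sP [:c:]) psP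
      (opoly psP (- lam) (f u) \<circ> (opoly psP (lam + der1 sP) (g v) \<circ> const1))"
    by (intro module_hom_compose[of _ psP] const1_linear P.module_axioms opoly_linear
        linear_minus_lam linear_lam_der)
  then show "module_hom (\<lambda>c. sP [:c:]) psP (\<lambda>a. eval_form u v a f g)"
    by (simp add: eval_form_def comp_def)
  show "module_hom (\<lambda>c. cdual_scale [:c:]) psP (\<lambda>f. eval_form u v a f g)"
    using s by (simp add: module_hom_iff module_psP eval_form_def
        opoly_add_left[OF linear_minus_lam] opoly_smult[OF linear_minus_lam])
  show "module_hom (\<lambda>c. cdual_scale [:c:]) psP (\<lambda>g. eval_form u v a f g)"
    using s by (simp add: module_hom_iff module_psP eval_form_swap
        opoly_add_left[OF linear_lam_der] opoly_smult[OF linear_lam_der])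
  have 1: "eval_form u v (der sP a) f g = der1 sP (eval_form u v a f g)"
  proof -
    have "der1 sP (opoly psP (- lam) p x) = opoly psP (- lam) p (der1 sP x)" for p x
      by (rule opoly_hom[OF linear_minus_lam linear_minus_lam der1_linear])
        (simp_all add: P.module_axioms der1_minus)
    moreover have "der1 sP (opoly psP (lam + der1 sP) p x) = opoly psP (lam + der1 sP) p (der1 sP x)" for p x
      by (rule opoly_hom[OF linear_lam_der linear_lam_der der1_linear])
        (simp_all add: P.module_axioms der1_add)
    ultimately show ?thesis by (simp add: eval_form_def P.module_axioms)
  qed
  have 2: "eval_form u v a (der cdual_scale f) g = lam (eval_form u v a f g)"
    by (simp add: eval_form_def opoly_minus_left[OF linear_minus_lam] opoly_lam[OF linear_minus_lam])
  have 3: "eval_form u v a f (der cdual_scale g) = - (lam + der1 sP) (eval_form u v a f g)"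
    by (simp add: eval_form_swap opoly_minus_left[OF linear_lam_der] opoly_lam[OF linear_lam_der])
  show "eval_form u v (der sP a) f g + eval_form u v a (der cdual_scale f) g +
      eval_form u v a f (der cdual_scale g) = 0"
    unfolding 1 2 3 by simp
qed

text \<open>
  Under the evaluation, \<open>\<partial>\<close> on the second slot is \<open>\<lambda>\<close>; so the variable that is replaced by this operator
  reappears as \<open>\<lambda>\<close>.
\<close>

lemma slot_subst_eval_form:
  "slot_subst dW (\<lambda>z x. eval_form u v z x g) p f =
     opoly psP (- lam) (f u) (opoly psP (lam + der1 sP) (g v) p)"
proof (induction p arbitrary: f)
  case 0
  have "eval_form u v 0 x g = 0" for x
    using module_hom.zero invariant_eval_form[of u v] unfolding invariant_form_def by blast
  then show ?case
    using module_hom.zero[OF opoly_linear[OF linear_minus_lam]]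
      module_hom.zero[OF opoly_linear[OF linear_lam_der]]
    by (simp del: uminus_apply plus_fun_apply)
next
  case (pCons a p)
  let ?L = "opoly psP (- lam) (f u)" and ?R = "opoly psP (lam + der1 sP) (g v)"
  have z: "eval_form u v 0 x g = 0" for x
    using module_hom.zero invariant_eval_form[of u v] unfolding invariant_form_def by blast
  have shift: "opoly psP (- lam) (dW f u) x = lam (?L x)" for x
    by (simp add: opoly_minus_left[OF linear_minus_lam] opoly_lam[OF linear_minus_lam])
  have "slot_subst dW (\<lambda>z x. eval_form u v z x g) (pCons a p) f = ?L (?R [:a:]) + lam (?L (?R p))"
    by (simp only: slot_subst_pCons[where \<kappa> = "\<lambda>z x. eval_form u v z x g", OF z] pCons.IH shift)
      (simp only: eval_form_def)
  also have "lam (?L (?R p)) = ?L (?R (lam p))"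
    by (subst opoly_hom[OF linear_minus_lam linear_minus_lam linear_lam], simp add: lam_minus,
        subst opoly_hom[OF linear_lam_der linear_lam_der linear_lam])
      (simp_all add: lam_add P.module_axioms)
  also have "?L (?R [:a:]) + \<dots> = ?L (?R (pCons a p))"
    by (simp only: module_hom.add[OF opoly_linear[OF linear_minus_lam], symmetric]
        module_hom.add[OF opoly_linear[OF linear_lam_der], symmetric] pCons_conv_lam[symmetric])
  finally show ?case .
qed

text \<open>
  With \<open>\<eta> - \<omega> = \<partial>\<close> the function \<open>f\<close> in the dual action is evaluated at \<open>\<partial>\<close>, which is the way \<open>f \<otimes> a\<close> acts as
  \<open>w \<mapsto> f\<^sub>\<partial>(w) a\<close>. The polynomial \<open>g(v)\<close> is evaluated at \<open>-\<omega>\<close>, where it can be absorbed into \<open>\<phi>(b)\<close>. The two cases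
  needed are \<open>(\<omega>, \<eta>) = (-\<lambda> - \<partial>, -\<lambda>)\<close> and \<open>(\<omega>, \<eta>) = (\<lambda>, \<lambda> + \<partial>)\<close>.
\<close>

lemma slot_subst_dual_action:
  assumes f: "f \<in> cdual sV"
    and \<omega>: "module_hom psP psP \<omega>" and \<eta>: "module_hom psP psP \<eta>"
    and comm: "\<And>x. \<omega> (\<eta> x) = \<eta> (\<omega> x)" and diff: "\<eta> - \<omega> = der1 sP"
  shows "slot_subst dW (\<lambda>h y. opoly psP \<eta> (h u) (opoly psP (- \<omega>) (y v) [:a:])) (dual_action phi b f) g =
    - psubst \<omega> (\<lambda>w. [:sP (f w) a:]) (phi (sP (g v) b) u)"
proof -
  have neg: "module_hom psP psP (- \<omega>)" by (rule linear_minus_op) fact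
  have add: "additive \<omega>" "additive \<eta>" using \<omega> \<eta> additive_hom by blast+
  interpret f: additive f by (rule additive_cdual[OF V.module_axioms f])
  have zero: "opoly psP \<eta> 0 x = 0" for x by (simp add: module_psP)
  have shift: "opoly psP (- \<omega>) (- lam p) x = \<omega> (opoly psP (- \<omega>) p x)" for p x
    by (simp add: opoly_minus_left[OF neg] opoly_lam[OF neg])
  have 1: "slot_subst dW (\<lambda>h y. opoly psP \<eta> (h u) (opoly psP (- \<omega>) (y v) [:a:])) F g =
      psubst \<omega> (\<lambda>h. opoly psP \<eta> (h u) (opoly psP (- \<omega>) (g v) [:a:])) F" for F g
  proof (induction F arbitrary: g)
    case 0
    then show ?case by (simp add: zero psubst_0)
  next
    case (pCons h F)
    let ?k = "\<lambda>h. opoly psP \<eta> (h u) (opoly psP (- \<omega>) (g v) [:a:])"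
    have "opoly psP \<eta> (h u) (\<omega> y) = \<omega> (opoly psP \<eta> (h u) y)" for h y
      by (rule opoly_hom[OF \<eta> \<eta> \<omega> comm, symmetric])
    then have "slot_subst dW (\<lambda>h y. opoly psP \<eta> (h u) (opoly psP (- \<omega>) (y v) [:a:])) (pCons h F) g =
        ?k h + psubst \<omega> (\<lambda>h. \<omega> (?k h)) F"
      by (simp add: slot_subst_pCons zero pCons shift del: uminus_apply)
    also have "psubst \<omega> (\<lambda>h. \<omega> (?k h)) F = \<omega> (psubst \<omega> ?k F)"
      by (rule psubst_commute[symmetric]) (simp_all add: add zero)
    finally show ?case by (simp add: psubst_pCons add zero del: uminus_apply)
  qed
  have commd: "der1 sP (\<omega> x) = \<omega> (der1 sP x)" for x
    using comm by (simp add: diff[symmetric] additive.diff[OF add(1)])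
  have 2: "opoly psP (der1 sP) p (opoly psP (- \<omega>) p' [:a:]) = opoly psP (- \<omega>) p' [:sP p a:]" for p p'
  proof -
    have "opoly psP (der1 sP) p (opoly psP (- \<omega>) p' [:a:]) =
        opoly psP (- \<omega>) p' (opoly psP (der1 sP) p [:a:])"
      by (rule opoly_commute[OF der1_linear neg])
        (simp_all add: P.module_axioms commd der1_minus)
    then show ?thesis by (simp add: opoly_der1_const P.module_axioms)
  qed
  let ?k = "\<lambda>w. [:sP (f w) a:]"
  have k: "additive ?k" by standard (simp add: f.add P.scale_left_distrib)
  have k0: "?k 0 = 0" using additive.zero[OF k] .
  have k_scale: "psubst \<omega> ?k (poly_scale sV c p) = psP c (psubst \<omega> ?k p)" for c p
  proof -
    have "psubst \<omega> ?k (poly_scale sV c p) = psubst \<omega> (\<lambda>w. psP c (?k w)) p"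
      unfolding poly_scale_def[of sV] using k0 f
      by (subst psubst_map_poly)
        (simp_all add: add V.module_axioms P.module_axioms cdual_iff mult.commute)
    also have "\<dots> = psP c (psubst \<omega> ?k p)"
      using k0 module.scale_zero_right[OF module_psP] additive_psP
      by (intro psubst_commute[symmetric]) (simp_all add: add module_hom.scale[OF \<omega>])
    finally show ?thesis .
  qed
  have k_lin: "module_hom (poly_scale sV) psP (psubst \<omega> ?k)"
    using additive.add[OF additive_psubst[OF add(1) k]] k_scale
    by (simp add: module_hom_iff module_psP module_poly_scale V.module_axioms)
  have lamV: "module_hom (poly_scale sV) (poly_scale sV) (- lam)"
    by (intro linear_ops V.module_axioms)
  have "slot_subst dW (\<lambda>h y. opoly psP \<eta> (h u) (opoly psP (- \<omega>) (y v) [:a:])) (dual_action phi b f) g =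
      - psubst \<omega> (\<lambda>w. opoly psP (- \<omega>) (g v) (?k w)) (phi b u)"
    unfolding 1
    by (subst dual_action_operators[OF V.fg_module_axioms f action_gc \<omega> \<eta> comm]) (simp only: diff 2)
  also have "psubst \<omega> (\<lambda>w. opoly psP (- \<omega>) (g v) (?k w)) (phi b u) =
      opoly psP (- \<omega>) (g v) (psubst \<omega> ?k (phi b u))"
  proof (rule psubst_commute[where h = ?k, symmetric, OF add(1) k0 add(1) additive_hom[OF opoly_linear[OF neg]]])
    show "opoly psP (- \<omega>) (g v) (\<omega> x) = \<omega> (opoly psP (- \<omega>) (g v) x)" for x
      by (rule opoly_hom[OF neg neg \<omega>, symmetric]) (simp add: additive.minus[OF add(1)])
  qed
  also have "\<dots> = psubst \<omega> ?k (opoly (poly_scale sV) (- lam) (g v) (phi b u))"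
  proof (rule opoly_hom[OF lamV neg k_lin, symmetric])
    show "psubst \<omega> ?k ((- lam) x) = (- \<omega>) (psubst \<omega> ?k x)" for x
      using k0 by (simp add: module_hom.neg[OF k_lin] psubst_lam add)
  qed
  finally show ?thesis by (simp only: action_polynomial_left)
qed

text \<open>
  The three summands become the three terms of the operator identity for the rank-one operators
  \<open>v \<mapsto> f\<^sub>\<partial>(v) a\<close> and \<open>v \<mapsto> g\<^sub>\<partial>(v) b\<close>.
\<close>

lemma yb_form_eval_form:
  assumes f: "f \<in> cdual sV"
  shows "yb_form (eval_form u v) a f b g =
    q (sP (f u) a) (sP (g v) b)
    - signed e (psubst (- lam - der1 sP) (\<lambda>w. [:sP (f w) a:]) (phi (sP (g v) b) u))
    - psubst lam (\<lambda>w. [:sP (f w) a:]) (phi (sP (g u) b) v)"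
proof -
  have 1: "slot_subst dW (\<lambda>z x. eval_form u v z x g) (q a b) f = q (sP (f u) a) (sP (g v) b)"
    by (simp only: slot_subst_eval_form q_polynomial_right[symmetric] q_polynomial_left[symmetric])
  have slot_signed: "slot_subst dW \<kappa> (dual b f) y = - signed e (slot_subst dW \<kappa> (dual_action phi b f) y)"
    if "\<And>y. additive (\<lambda>h. \<kappa> h y)" for \<kappa> :: "_ \<Rightarrow> _ \<Rightarrow> 'p poly" and y
  proof -
    interpret S: additive "\<lambda>p. slot_subst dW \<kappa> p y" by (rule additive_slot_subst) (rule that)
    show ?thesis
      by (simp add: dual_def signed_def S.minus del: der_cdual)
  qed
  have add: "additive (\<lambda>h. eval_form u v a h y)" "additive (\<lambda>h. eval_form u v a y h)" for y
    using invariant_eval_form[of u v] additive_hom unfolding invariant_form_def by blast+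
  have ops: "- (- lam - der1 sP) = lam + der1 sP" by (simp add: fun_eq_iff)
  have 2: "slot_subst dW (\<lambda>h y. eval_form u v a h y) (dual_action phi b f) g =
      - psubst (- lam - der1 sP) (\<lambda>w. [:sP (f w) a:]) (phi (sP (g v) b) u)"
    using slot_subst_dual_action[OF f linear_twist_op linear_minus_lam, of u v a b g]
    unfolding ops eval_form_def
    by (simp add: fun_eq_iff P.module_axioms lam_minus lam_diff der1_minus del: plus_fun_apply)
  have 3: "slot_subst dW (\<lambda>h y. eval_form u v a y h) (dual_action phi b f) g =
      - psubst lam (\<lambda>w. [:sP (f w) a:]) (phi (sP (g u) b) v)"
    using slot_subst_dual_action[OF f linear_lam linear_lam_der, of v u a b g]
    unfolding eval_form_swap
    by (simp add: fun_eq_iff P.module_axioms lam_add)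
  show ?thesis
    unfolding yb_form_def 1 slot_signed[OF add(1)] slot_signed[OF add(2)] 2 3
    by (simp add: signed_minus)
qed

lemma psubst_insert_hom:
  assumes \<omega>: "module_hom psP psP \<omega>" and f: "f \<in> cdual sV"
  shows "psP c (psubst \<omega> (\<lambda>w. [:sP (f w) a:]) p) = psubst \<omega> (\<lambda>w. [:sP [:c:] (sP (f w) a):]) p"
proof -
  have "f 0 = 0" using additive.zero[OF additive_cdual[OF V.module_axioms f]] .
  then have "psP c (psubst \<omega> (\<lambda>w. [:sP (f w) a:]) p) = psubst \<omega> (\<lambda>w. psP c [:sP (f w) a:]) p"
    using additive_psP additive_hom[OF \<omega>]
    by (intro psubst_commute) (simp_all add: module_hom.scale[OF \<omega>])
  then show ?thesis by (simp add: P.module_axioms)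
qed

text \<open>
  On the evaluation forms, the Yang-Baxter expression is the defect of the operator
  \<open>v \<mapsto> \<Sum>\<^sub>i f\<^sub>i\<^sub>,\<^sub>\<partial>(v) a\<^sub>i\<close>.
\<close>

lemma sum_yb_form_eval_form:
  assumes K: "finite K" and f: "\<And>i. i \<in> K \<Longrightarrow> f i \<in> cdual sV"
    and T: "\<And>v. T v = (\<Sum>i\<in>K. sP [:c i:] (sP (f i v) (a i)))"
  shows "(\<Sum>i\<in>K. \<Sum>j\<in>K. psP (c i * c j) (yb_form (eval_form u v) (a i) (f i) (a j) (f j))) =
    q (T u) (T v) - map_poly T (phi (T u) v) - signed e (map_poly T (twist sV (phi (T v) u)))"
proof -
  interpret psP: module psP by (rule module_psP)
  let ?k = "\<lambda>i w. [:sP (f i w) (a i):]"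
  let ?k' = "\<lambda>i w. [:sP [:c i:] (sP (f i w) (a i)):]"
  have f0: "f i 0 = 0" if "i \<in> K" for i
    using additive.zero[OF additive_cdual[OF V.module_axioms f[OF that]]] .
  have T0: "T 0 = 0" by (simp add: T f0)
  have Tadd: "T (v + w) = T v + T w" for v w
    unfolding T sum.distrib[symmetric]
    by (rule sum.cong) (use f in \<open>auto simp: cdual_iff V.module_axioms P.scale_left_distrib P.scale_right_distrib\<close>)
  have Tscale: "T (sV p v) = sP p (T v)" for p v
    unfolding T P.scale_sum_right
    by (rule sum.cong) (use f in \<open>auto simp: cdual_iff V.module_axioms mult.commute mult.left_commute\<close>)
  have 1: "(\<Sum>i\<in>K. \<Sum>j\<in>K. psP (c i * c j) (q (sP (f i u) (a i)) (sP (f j v) (a j)))) = q (T u) (T v)"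
  proof -
    have "psP (c i * c j) (q x y) = q (sP [:c i:] x) (sP [:c j:] y)" for i j x y
    proof -
      have "psP (c i) (psP (c j) (q x y)) = q (sP [:c i:] x) (sP [:c j:] y)"
        unfolding q_scale_right[of "c j"] by (rule q_scale_left)
      then show ?thesis by (simp only: psP.scale_scale)
    qed
    then show ?thesis
      by (subst sum.swap) (simp add: T additive.sum[OF additive_q_left] additive.sum[OF additive_q_right])
  qed
  have 2: "(\<Sum>i\<in>K. \<Sum>j\<in>K. psP (c i * c j) (psubst \<omega> (?k i) (phi (sP (f j v) (a j)) u))) =
      psubst \<omega> (\<lambda>w. [:T w:]) (phi (T v) u)" if \<omega>: "module_hom psP psP \<omega>" for \<omega> u v
  proof -
    have add: "additive \<omega>" using \<omega> additive_hom by blast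
    have kz: "?k' i 0 = 0" if "i \<in> K" for i by (simp add: f0 that)
    have kk: "psubst \<omega> (?k' i) p = psP (c i) (psubst \<omega> (?k i) p)" if "i \<in> K" for i p
      by (rule psubst_insert_hom[OF \<omega> f[OF that], symmetric])
    have kT: "additive (\<lambda>w. [:T w:])" by standard (simp add: Tadd)
    have Tsc: "psP c (psubst \<omega> (\<lambda>w. [:T w:]) p) = psubst \<omega> (\<lambda>w. [:T w:]) (poly_scale sV c p)" for c p
    proof -
      have "psP c (psubst \<omega> (\<lambda>w. [:T w:]) p) = psubst \<omega> (\<lambda>w. psP c [:T w:]) p"
        using additive_psP T0 by (intro psubst_commute) (simp_all add: add module_hom.scale[OF \<omega>])
      also have "\<dots> = psubst \<omega> (\<lambda>w. [:T w:]) (poly_scale sV c p)"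
        unfolding poly_scale_def[of sV]
        by (subst psubst_map_poly) (simp_all add: add T0 V.module_axioms P.module_axioms Tscale)
      finally show ?thesis .
    qed
    have combine: "(\<Sum>i\<in>K. psubst \<omega> (?k' i) p) = psubst \<omega> (\<lambda>w. [:T w:]) p" for p
    proof -
      have "psubst \<omega> (\<lambda>w. [:T w:]) p = psubst \<omega> (\<lambda>w. \<Sum>i\<in>K. ?k' i w) p"
        by (simp add: T additive.sum[OF additive_const1])
      also have "\<dots> = (\<Sum>i\<in>K. psubst \<omega> (?k' i) p)"
        by (induction p) (simp_all add: psubst_0 psubst_pCons add K kz f0 sum.distrib additive.sum[OF add])
      finally show ?thesis by (rule sym)
    qed
    have phi_T: "(\<Sum>j\<in>K. phi (sP [:c j:] (sP (f j v) (a j))) u) = phi (T v) u"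
    proof -
      have "additive (\<lambda>x. phi x u)" by standard (rule action_add_left)
      then show ?thesis unfolding T by (rule additive.sum[symmetric])
    qed
    have "(\<Sum>i\<in>K. \<Sum>j\<in>K. psP (c i * c j) (psubst \<omega> (?k i) (phi (sP (f j v) (a j)) u))) =
        (\<Sum>j\<in>K. psP (c j) (\<Sum>i\<in>K. psubst \<omega> (?k' i) (phi (sP (f j v) (a j)) u)))"
      by (subst sum.swap, simp only: psP.scale_sum_right, intro sum.cong refl)
        (simp add: kk mult.commute del: P.scale_scale)
    also have "\<dots> = psubst \<omega> (\<lambda>w. [:T w:]) (\<Sum>j\<in>K. phi (sP [:c j:] (sP (f j v) (a j))) u)"
      unfolding combine
      by (simp add: additive.sum[OF additive_psubst[OF add kT]] Tsc action_scale_left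
          del: P.scale_scale)
    finally show ?thesis unfolding phi_T .
  qed
  have lam_T: "psubst lam (\<lambda>w. [:T w:]) p = map_poly T p" for p
    using psubst_map_poly[of lam const1 T p] by (simp add: additive_lam T0)
  have twist_T: "psubst (- lam - der1 sP) (\<lambda>w. [:T w:]) p = map_poly T (twist sV p)" for p
  proof -
    have "map_poly T (twist sV p) = twist sP (map_poly T p)"
      by (rule twist_map_poly) (simp_all add: V.module_axioms P.module_axioms additive_def Tadd der_def Tscale)
    also have "\<dots> = psubst (- lam - der1 sP) (\<lambda>w. [:T w:]) p"
      by (rule psubst_map_poly[OF additive_twist_op[OF P.module_axioms]]) (simp_all add: T0)
    finally show ?thesis by (rule sym)
  qed
  have "(\<Sum>i\<in>K. \<Sum>j\<in>K. psP (c i * c j) (yb_form (eval_form u v) (a i) (f i) (a j) (f j))) =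
     (\<Sum>i\<in>K. \<Sum>j\<in>K. psP (c i * c j) (q (sP (f i u) (a i)) (sP (f j v) (a j))))
     - signed e (\<Sum>i\<in>K. \<Sum>j\<in>K. psP (c i * c j) (psubst (- lam - der1 sP) (?k i) (phi (sP (f j v) (a j)) u)))
     - (\<Sum>i\<in>K. \<Sum>j\<in>K. psP (c i * c j) (psubst lam (?k i) (phi (sP (f j u) (a j)) v)))"
    by (simp add: yb_form_eval_form[OF f] psP.scale_right_diff_distrib sum_subtractf signed_sum
        signed_additive[OF additive_psP] cong: sum.cong)
  then show ?thesis
    unfolding 1 2[OF linear_twist_op] 2[OF linear_lam] lam_T twist_T by simp
qed


section \<open>Invariant forms on the conformal dual of a free module\<close>

definition basis :: "'v set" where
  "basis = (SOME B. \<not> V.dependent B \<and> V.span B = UNIV)"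

lemma independent_basis: "\<not> V.dependent basis" and span_basis: "V.span basis = UNIV"
  using someI_ex[OF free[unfolded free_module_def]] unfolding basis_def by auto

text \<open>
  Finitely many basis vectors span a finite generating set, hence everything; and no proper subset of a
  basis spans.
\<close>

lemma finite_basis: "finite basis"
proof -
  obtain S where S: "finite S" "V.span S = UNIV" using V.finitely_generated by blast
  have "\<exists>F. finite F \<and> F \<subseteq> basis \<and> x \<in> V.span F" for x
  proof -
    have "x \<in> V.span basis" by (simp add: span_basis)
    then obtain F c where "finite F" "F \<subseteq> basis" "x = (\<Sum>v\<in>F. sV (c v) v)"
      unfolding V.span_explicit by blast
    then show ?thesis by (intro exI[of _ F]) (auto intro: V.span_sum V.span_scale V.span_base)
  qed
  then obtain F where F: "\<And>x. finite (F x)" "\<And>x. F x \<subseteq> basis" "\<And>x. x \<in> V.span (F x)" by metis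
  have "S \<subseteq> V.span (\<Union>x\<in>S. F x)"
    using F(3) V.span_mono[of "F _" "\<Union>x\<in>S. F x"] by blast
  then have "V.span (\<Union>x\<in>S. F x) = UNIV"
    using S(2) V.span_minimal[OF _ V.subspace_span] by blast
  then have "basis = (\<Union>x\<in>S. F x)"
    using V.spanning_subset_independent[OF _ independent_basis, of "\<Union>x\<in>S. F x"] F(2) by blast
  with S(1) F(1) show ?thesis by simp
qed

definition coord :: "'v \<Rightarrow> 'v \<Rightarrow> 'k poly" where
  "coord b v = V.representation basis v b"

lemma coord_sum: "(\<Sum>b\<in>basis. sV (coord b v) b) = v"
  unfolding coord_def
  by (rule V.sum_representation_eq) (simp_all add: independent_basis span_basis finite_basis)

lemma coord_in_cdual: "coord b \<in> cdual sV"
  by (simp add: cdual_iff V.module_axioms coord_def V.representation_add V.representation_scale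
      independent_basis span_basis)

text \<open>
  \<open>\<Sum>\<^sub>b f(b) b\<^sup>*\<close>, with \<open>b\<^sup>*\<close> the coordinate functions. It is defined for every function on \<open>V\<close> and so projects the
  whole function type onto the conformal dual.
\<close>

definition dual_proj :: "('v \<Rightarrow> 'k poly) \<Rightarrow> 'v \<Rightarrow> 'k poly" where
  "dual_proj f = (\<Sum>b\<in>basis. (\<lambda>v. f b * coord b v))"

lemma dual_proj_apply: "dual_proj f v = (\<Sum>b\<in>basis. f b * coord b v)"
  by (simp add: dual_proj_def sum_fun_apply)

lemma dual_proj_in_cdual: "dual_proj f \<in> cdual sV"
  using coord_in_cdual
  by (auto simp: cdual_iff V.module_axioms dual_proj_apply sum.distrib algebra_simps sum_distrib_left)

lemma dual_proj_id:
  assumes "f \<in> cdual sV"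
  shows "dual_proj f = f"
proof
  fix v
  have add: "additive f" by (rule additive_cdual[OF V.module_axioms assms])
  have "f v = f (\<Sum>b\<in>basis. sV (coord b v) b)" by (simp add: coord_sum)
  also have "\<dots> = dual_proj f v"
    using assms by (simp add: additive.sum[OF add] dual_proj_apply cdual_iff V.module_axioms mult.commute)
  finally show "dual_proj f v = f v" by (rule sym)
qed

lemma dual_proj_hom: "module_hom cdual_scale cdual_scale dual_proj"
  by (simp add: module_hom_iff module_cdual_scale fun_eq_iff dual_proj_apply cdual_scale_conv
      sum.distrib algebra_simps sum_distrib_left)

text \<open>
  For the rest of this section, \<open>subst1 p x y\<close> is \<open>\<tau>\<close> with the polynomial \<open>p \<in> P[\<lambda>]\<close> in its first slot and \<open>\<lambda>\<close> acting as \<open>\<partial>\<close>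
  on \<open>x\<close>. By invariance \<open>\<lambda> + \<partial>\<close> then acts as \<open>-\<partial>\<close> on \<open>y\<close>.
\<close>

context
  fixes sc :: "'k \<Rightarrow> 'm::ab_group_add \<Rightarrow> 'm"
    and \<tau> :: "'p \<Rightarrow> ('v \<Rightarrow> 'k poly) \<Rightarrow> ('v \<Rightarrow> 'k poly) \<Rightarrow> 'm"
  assumes inv: "invariant_form sP (cdual_scale :: 'k poly \<Rightarrow> ('v \<Rightarrow> 'k poly) \<Rightarrow> _) cdual_scale sc \<tau>"
begin

abbreviation subst1 where "subst1 p x y \<equiv> slot_subst dW (\<lambda>z x. \<tau> z x y) p x"

lemma form_linear:
  "module_hom (\<lambda>c. sP [:c:]) sc (\<lambda>a. \<tau> a x y)"
  "module_hom (\<lambda>c. cdual_scale [:c:]) sc (\<lambda>x. \<tau> a x y)"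
  "module_hom (\<lambda>c. cdual_scale [:c:]) sc (\<lambda>y. \<tau> a x y)"
  "\<tau> (der sP a) x y + \<tau> a (dW x) y + \<tau> a x (dW y) = 0"
  using inv unfolding invariant_form_def by blast+

lemma form_0: "\<tau> 0 x y = 0"
  using module_hom.zero[OF form_linear(1)] .

lemma subst1_pCons: "subst1 (pCons a p) x y = \<tau> a x y + subst1 p (dW x) y"
  by (rule slot_subst_pCons) (rule form_0)

lemma subst1_linear_poly: "module_hom psP sc (\<lambda>p. subst1 p x y)"
proof -
  have add: "additive (\<lambda>p. subst1 p x y)"
    by (rule additive_slot_subst) (rule additive_hom[OF form_linear(1)])
  have "subst1 (psP c p) x y = sc c (subst1 p x y)" for c p
  proof -
    have "subst1 (psP c p) x y = slot_subst dW (\<lambda>a x. \<tau> (sP [:c:] a) x y) p x"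
      unfolding poly_scale_def by (rule slot_subst_map_poly) (simp_all add: form_0)
    also have "\<dots> = sc c (subst1 p x y)"
      using module_hom.scale[OF form_linear(1)]
      by (simp add: slot_subst_def module.scale_sum_right[OF module_hom_codomain[OF form_linear(1)]])
    finally show ?thesis .
  qed
  with additive.add[OF add] module_hom_codomain[OF form_linear(1)] show ?thesis
    by (simp add: module_hom_iff module_psP)
qed

lemma subst1_linear_left: "module_hom (\<lambda>c. cdual_scale [:c:]) sc (\<lambda>x. subst1 p x y)"
proof -
  interpret sc: module sc by (rule module_hom_codomain[OF form_linear(1)])
  note W = module_hom_domain[OF form_linear(2)]
  show ?thesis
  proof (rule module_hom.intro[OF W sc.module_axioms], unfold_locales)
    fix x x' c
    show "subst1 p (x + x') y = subst1 p x y + subst1 p x' y"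
      using module_hom.add[OF form_linear(2)]
      by (induction p arbitrary: x x')
        (simp_all add: form_0 subst1_pCons module_hom.add[OF der_linear[OF module_cdual_scale]] del: der_cdual)
    show "subst1 p (cdual_scale [:c:] x) y = sc c (subst1 p x y)"
      using module_hom.scale[OF form_linear(2)]
      by (induction p arbitrary: x)
        (simp_all add: form_0 subst1_pCons module_hom.scale[OF der_linear[OF module_cdual_scale]]
          sc.scale_right_distrib del: der_cdual cdual_scale_const)
  qed
qed

lemma subst1_linear_right: "module_hom (\<lambda>c. cdual_scale [:c:]) sc (\<lambda>y. subst1 p x y)"
proof -
  interpret sc: module sc by (rule module_hom_codomain[OF form_linear(1)])
  note W = module_hom_domain[OF form_linear(2)]
  show ?thesis
    using module_hom.add[OF form_linear(3)] module_hom.scale[OF form_linear(3)]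
    by (simp add: module_hom_iff W sc.module_axioms slot_subst_def sum.distrib sc.scale_sum_right
        del: der_cdual cdual_scale_const)
qed

lemma subst1_lam: "subst1 (lam p) x y = subst1 p (dW x) y"
  by (rule slot_subst_lam) (rule form_0)

lemma subst1_lam_der: "subst1 ((lam + der1 sP) p) x y = - subst1 p x (dW y)"
proof -
  have "subst1 (der1 sP p) x y = - subst1 p (dW x) y - subst1 p x (dW y)"
    by (rule slot_subst_der1[where \<kappa> = \<tau>, OF P.module_axioms form_0 form_linear(4)])
  then show ?thesis
    using module_hom.add[OF subst1_linear_poly] by (simp add: subst1_lam)
qed

text \<open>
  On the dual, \<open>-\<partial>\<close> is multiplication by \<open>\<lambda>\<close>. So a polynomial in \<open>-\<lambda>\<close>, or in \<open>\<lambda> + \<partial>\<close>, is absorbed into the second, or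
  the third, slot as a factor.
\<close>

lemma subst1_opoly_left: "subst1 (opoly psP (- lam) P p) x y = subst1 p (\<lambda>v. P * x v) y"
proof (induction P arbitrary: x)
  case 0
  have "(\<lambda>v. 0 * x v) = 0" by (simp add: fun_eq_iff)
  then show ?case
    using module_hom.zero[OF subst1_linear_poly[where x = x and y = y]]
      module_hom.zero[OF subst1_linear_left[where p = p and y = y]]
    by (simp only: opoly_0[OF module_psP])
next
  case (pCons c P)
  have "subst1 (opoly psP (- lam) (pCons c P) p) x y = subst1 (psP c p) x y - subst1 (opoly psP (- lam) P p) (dW x) y"
    by (simp add: opoly_pCons[OF linear_minus_lam] module_hom.diff[OF subst1_linear_poly] subst1_lam del: der_cdual)
  also have "\<dots> = subst1 p (\<lambda>v. smult c (x v)) y - subst1 p (\<lambda>v. P * dW x v) y"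
    using module_hom.scale[OF subst1_linear_poly] module_hom.scale[OF subst1_linear_left]
    by (simp add: pCons.IH del: der_cdual)
  also have "\<dots> = subst1 p ((\<lambda>v. smult c (x v)) - (\<lambda>v. P * dW x v)) y"
    by (rule module_hom.diff[OF subst1_linear_left, symmetric])
  also have "(\<lambda>v. smult c (x v)) - (\<lambda>v. P * dW x v) = (\<lambda>v. pCons c P * x v)"
    by (simp add: fun_eq_iff lam_def)
  finally show ?case .
qed

lemma subst1_opoly_right: "subst1 (opoly psP (lam + der1 sP) P p) x y = subst1 p x (\<lambda>v. P * y v)"
proof (induction P arbitrary: y)
  case 0
  have "(\<lambda>v. 0 * y v) = 0" by (simp add: fun_eq_iff)
  then show ?case
    using module_hom.zero[OF subst1_linear_poly[where x = x and y = y]]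
      module_hom.zero[OF subst1_linear_right[where p = p and x = x]]
    by (simp only: opoly_0[OF module_psP])
next
  case (pCons c P)
  have "subst1 (opoly psP (lam + der1 sP) (pCons c P) p) x y =
      subst1 (psP c p) x y - subst1 (opoly psP (lam + der1 sP) P p) x (dW y)"
    unfolding opoly_pCons[OF linear_lam_der] module_hom.add[OF subst1_linear_poly] subst1_lam_der by simp
  also have "\<dots> = subst1 p x (\<lambda>v. smult c (y v)) - subst1 p x (\<lambda>v. P * dW y v)"
    using module_hom.scale[OF subst1_linear_poly] module_hom.scale[OF subst1_linear_right]
    by (simp add: pCons.IH del: der_cdual)
  also have "\<dots> = subst1 p x ((\<lambda>v. smult c (y v)) - (\<lambda>v. P * dW y v))"
    by (rule module_hom.diff[OF subst1_linear_right, symmetric])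
  also have "(\<lambda>v. smult c (y v)) - (\<lambda>v. P * dW y v) = (\<lambda>v. pCons c P * y v)"
    by (simp add: fun_eq_iff lam_def)
  finally show ?case .
qed

text \<open>
  The evaluations at basis vectors determine every invariant form: after expanding \<open>f\<close> and \<open>g\<close> in the dual
  basis, their polynomial coefficients are moved into the first argument, where they become polynomials
  in \<open>-\<lambda>\<close> and \<open>\<lambda> + \<partial>\<close>.
\<close>

lemma form_via_eval_forms:
  "\<tau> a (dual_proj f) (dual_proj g) =
     (\<Sum>bb\<in>basis \<times> basis. subst1 (eval_form (fst bb) (snd bb) a f g) (coord (fst bb)) (coord (snd bb)))"
proof -
  have "subst1 (eval_form b b' a f g) (coord b) (coord b') =
      \<tau> a (\<lambda>v. f b * coord b v) (\<lambda>v. g b' * coord b' v)" for b b'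
    unfolding eval_form_def subst1_opoly_left subst1_opoly_right
    by (simp add: subst1_pCons form_0 del: der_cdual)
  then show ?thesis
    unfolding dual_proj_def
    by (simp only: module_hom.sum[OF form_linear(2)])
      (simp only: module_hom.sum[OF form_linear(3)] sum.cartesian_product case_prod_unfold)
qed

text \<open>
  \<open>yb_form\<close> is linear in the form, so the expansion into evaluation forms applies to it.
\<close>

lemma sum_yb_form_vanishes:
  assumes proj: "\<And>a f g. \<tau> a (dual_proj f) (dual_proj g) = \<tau> a f g"
    and van: "\<And>u v. (\<Sum>i\<in>K. \<Sum>j\<in>K. psP (c i * c j) (yb_form (eval_form u v) (a i) (f i) (a j) (f j))) = 0"
  shows "(\<Sum>i\<in>K. \<Sum>j\<in>K. sc (c i * c j) (yb_form \<tau> (a i) (f i) (a j) (f j))) = 0"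
proof -
  interpret sc: module sc by (rule module_hom_codomain[OF form_linear(1)])
  define H where "H bb p = subst1 p (coord (fst bb)) (coord (snd bb))" for bb p
  define E where "E bb = eval_form (fst bb) (snd bb)" for bb
  have H: "module_hom psP sc (H bb)" for bb
    unfolding H_def by (rule subst1_linear_poly)
  have "\<tau> a f g = (\<Sum>bb\<in>basis \<times> basis. H bb (E bb a f g))" for a f g
    using form_via_eval_forms[of a f g] unfolding proj H_def E_def .
  then have \<tau>: "\<tau> = (\<lambda>a f g. \<Sum>bb\<in>basis \<times> basis. H bb (E bb a f g))"
    by (intro ext)
  have yb: "yb_form \<tau> a f b g = (\<Sum>bb\<in>basis \<times> basis. H bb (yb_form (E bb) a f b g))" for a f b g
    by (subst \<tau>) (rule yb_form_hom, rule additive_hom[OF H])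
  have "(\<Sum>i\<in>K. \<Sum>j\<in>K. sc (c i * c j) (yb_form \<tau> (a i) (f i) (a j) (f j))) =
      (\<Sum>i\<in>K. \<Sum>j\<in>K. \<Sum>bb\<in>basis \<times> basis. H bb (psP (c i * c j) (yb_form (E bb) (a i) (f i) (a j) (f j))))"
    by (simp only: yb sc.scale_sum_right module_hom.scale[OF H])
  also have "\<dots> = (\<Sum>bb\<in>basis \<times> basis. \<Sum>i\<in>K. \<Sum>j\<in>K. H bb (psP (c i * c j) (yb_form (E bb) (a i) (f i) (a j) (f j))))"
    by (simp only: sum.swap[of _ "basis \<times> basis" K])
  also have "\<dots> = (\<Sum>bb\<in>basis \<times> basis. H bb (\<Sum>i\<in>K. \<Sum>j\<in>K. psP (c i * c j) (yb_form (E bb) (a i) (f i) (a j) (f j))))"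
    by (simp only: module_hom.sum[OF H])
  also have "\<dots> = 0"
    by (simp add: E_def van module_hom.zero[OF H])
  finally show ?thesis .
qed

end

end

section \<open>Evaluating the Yang-Baxter expressions through a form\<close>

lemma invariant_form_swap12:
  "invariant_form s1 s2 s3 sc \<tau> \<Longrightarrow> invariant_form s2 s1 s3 sc (\<lambda>y x z. \<tau> x y z)"
  unfolding invariant_form_def by (simp add: add.commute)

lemma invariant_form_swap23:
  "invariant_form s1 s2 s3 sc \<tau> \<Longrightarrow> invariant_form s1 s3 s2 sc (\<lambda>x z y. \<tau> x y z)"
  unfolding invariant_form_def by (simp add: add.commute add.left_commute)

lemma invariant_formD:
  assumes "invariant_form s1 s2 s3 sc \<tau>"
  shows "module_hom (\<lambda>c. s1 [:c:]) sc (\<lambda>x. \<tau> x y z)"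
    and "\<tau> (der s1 x) y z + \<tau> x (der s2 y) z + \<tau> x y (der s3 z) = 0"
  using assms unfolding invariant_form_def by blast+

lemma der_slot_funpow:
  "(der_1 s ^^ k) (pure (x, y, z)) = (pure ((der s ^^ k) x, y, z) :: _ \<Rightarrow>\<^sub>0 'k::field_char_0)"
  "(der_2 s ^^ k) (pure (x, y, z)) = (pure (x, (der s ^^ k) y, z) :: _ \<Rightarrow>\<^sub>0 'k::field_char_0)"
  "(der_3 s ^^ k) (pure (x, y, z)) = (pure (x, y, (der s ^^ k) z) :: _ \<Rightarrow>\<^sub>0 'k::field_char_0)"
  by (induction k) (simp_all add: der_1_def der_2_def der_3_def module_fscale)

lemma der_slot_commute:
  "der_1 s (der_3 s t) = der_3 s (der_1 s t)" "der_2 s (der_3 s t) = der_3 s (der_2 s t)"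
  unfolding der_1_def der_2_def der_3_def
  by (simp_all add: lin_ext_hom[OF lin_ext_linear[OF module_fscale]] module_fscale case_prod_unfold)

lemma lin_ext_psubst_slot:
  assumes "module sc"
  shows "lin_ext sc (uncurry3 \<tau>) (psubst (der_1 s) (\<lambda>z. pure (x, y, z)) p) =
      slot_subst (der s) (\<lambda>z x. \<tau> x y z) p x"
    and "lin_ext sc (uncurry3 \<tau>) (psubst (der_2 s) (\<lambda>z. pure (z, x, y)) p) =
      slot_subst (der s) (\<lambda>z x. \<tau> z x y) p x"
    and "lin_ext sc (uncurry3 \<tau>) (psubst (der_2 s) (\<lambda>z. pure (x, y, z)) p) =
      slot_subst (der s) (\<lambda>z y. \<tau> x y z) p y"
    and "lin_ext sc (uncurry3 \<tau>) (psubst (der_3 s) (\<lambda>z. pure (x, z, y)) p) =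
      slot_subst (der s) (\<lambda>z y. \<tau> x z y) p y"
  unfolding psubst_def slot_subst_def module_hom.sum[OF lin_ext_linear[OF assms]]
  by (simp_all add: der_slot_funpow assms)

text \<open>
  Invariance of \<open>\<tau>\<close> replaces the operator \<open>-(\<partial> \<otimes> I \<otimes> I + I \<otimes> \<partial> \<otimes> I)\<close> by \<open>I \<otimes> I \<otimes> \<partial>\<close>. This iterates, since the two operators
  commute.
\<close>

lemma lin_ext_psubst_minus_der:
  assumes "module sc" and inv: "invariant_form s s s sc \<tau>"
  shows "lin_ext sc (uncurry3 \<tau>) (psubst (- (der_1 s + der_2 s)) (\<lambda>z. pure (x, z, y)) p) =
      slot_subst (der s) (\<lambda>z y. \<tau> x z y) p y"
proof -
  let ?T = "lin_ext sc (uncurry3 \<tau>)"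
  interpret T: module_hom fscale sc ?T by (rule lin_ext_linear) fact
  interpret d3: module_hom fscale fscale "der_3 s" by (rule der_slot_linear)
  define \<theta> where "\<theta> = - (der_1 s + der_2 s)"
  have comm: "der_3 s (\<theta> w) = \<theta> (der_3 s w)" for w
    by (simp add: \<theta>_def d3.neg d3.add d3.diff der_slot_commute)
  have comm_k: "der_3 s ((\<theta> ^^ k) w) = (\<theta> ^^ k) (der_3 s w)" for k w
    by (induction k) (simp_all add: comm)
  have 1: "?T (\<theta> w) = ?T (der_3 s w)" for w
  proof -
    have "?T (der_1 s w) + (?T (der_2 s w) + ?T (der_3 s w)) = 0"
      using lin_ext_total_der[OF assms, of w] by (simp add: T.add add.assoc)
    then have "- ?T (der_1 s w) = ?T (der_2 s w) + ?T (der_3 s w)" by (rule minus_unique)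
    then show ?thesis by (simp add: \<theta>_def T.neg T.diff)
  qed
  have "?T ((\<theta> ^^ k) w) = ?T ((der_3 s ^^ k) w)" for k w
  proof (induction k arbitrary: w)
    case (Suc k)
    have "?T ((\<theta> ^^ Suc k) w) = ?T ((\<theta> ^^ k) (der_3 s w))" by (simp add: 1 comm_k)
    also have "\<dots> = ?T ((der_3 s ^^ Suc k) w)" by (simp only: Suc funpow_Suc_right comp_apply)
    finally show ?case .
  qed simp
  then show ?thesis
    unfolding \<theta>_def[symmetric] psubst_def slot_subst_def T.sum
    by (simp add: der_slot_funpow assms)
qed

text \<open>
  The common value of both Yang-Baxter expressions, under an invariant form, on \<open>x \<otimes> x'\<close> and \<open>y \<otimes> y'\<close>. For
  \<open>cyb\<close> the last term has to be rewritten by skew-commutativity.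
\<close>

definition yb_pair ::
  "('k::field_char_0 poly \<Rightarrow> 'a::ab_group_add \<Rightarrow> 'a) \<Rightarrow> ('a \<Rightarrow> 'a \<Rightarrow> 'a poly) \<Rightarrow>
   ('a \<Rightarrow> 'a \<Rightarrow> 'a \<Rightarrow> 'm::ab_group_add) \<Rightarrow> 'a \<times> 'a \<Rightarrow> 'a \<times> 'a \<Rightarrow> 'm" where
  "yb_pair s prd \<tau> = (\<lambda>(x, x') (y, y').
       slot_subst (der s) (\<lambda>z x'. \<tau> z x' y') (prd x y) x'
     - slot_subst (der s) (\<lambda>z y'. \<tau> x z y') (prd y x') y'
     + slot_subst (der s) (\<lambda>z x. \<tau> x y z) (prd x' y') x)"

lemma lin_ext_ayb:
  assumes sc: "module sc" and inv: "invariant_form s s s sc \<tau>"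
  shows "lin_ext sc (uncurry3 \<tau>) (ayb s prd r) =
    lin_ext sc (\<lambda>p. lin_ext sc (yb_pair s prd \<tau> p) r) r"
proof -
  interpret T: module_hom fscale sc "lin_ext sc (uncurry3 \<tau>)" by (rule lin_ext_linear) fact
  have pair: "lin_ext sc (uncurry3 \<tau>)
        (psubst (der_1 s) (\<lambda>z. pure (x, y, z)) (prd x' y')
       - psubst (- (der_1 s + der_2 s)) (\<lambda>z. pure (x, z, y')) (prd y x')
       + psubst (der_2 s) (\<lambda>z. pure (z, x', y')) (prd x y)) = yb_pair s prd \<tau> (x, x') (y, y')" for x x' y y'
    unfolding T.add T.diff lin_ext_psubst_slot[OF sc] lin_ext_psubst_minus_der[OF sc inv]
      yb_pair_def prod.case by (simp only: algebra_simps)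
  show ?thesis
    unfolding ayb_def lin_ext_hom[OF T.module_hom_axioms]
  proof (rule lin_ext_cong, clarify)
    fix x x'
    show "lin_ext sc (uncurry3 \<tau>) (lin_ext fscale (\<lambda>(y, y').
         psubst (der_1 s) (\<lambda>z. pure (x, y, z)) (prd x' y')
       - psubst (- (der_1 s + der_2 s)) (\<lambda>z. pure (x, z, y')) (prd y x')
       + psubst (der_2 s) (\<lambda>z. pure (z, x', y')) (prd x y)) r) =
      lin_ext sc (yb_pair s prd \<tau> (x, x')) r"
      unfolding lin_ext_hom[OF T.module_hom_axioms]
      by (rule lin_ext_cong, clarify) (rule pair)
  qed
qed

lemma slot_subst_symmetric:
  assumes inv: "invariant_form s s s sc \<kappa>" and s: "module s"
    and sym: "prd x' y' = signed e (twist s (prd y' x'))"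
  shows "slot_subst (der s) (\<lambda>z x. \<kappa> z x y) (prd x' y') x =
    signed e (slot_subst (der s) (\<lambda>z y. \<kappa> z x y) (prd y' x') y)"
proof -
  have lin: "additive (\<lambda>z. \<kappa> z x y)" for x y
    by (rule additive_hom) (rule invariant_formD(1)[OF inv])
  have add: "additive (\<lambda>p. slot_subst (der s) (\<lambda>z x. \<kappa> z x y) p x)"
    by (rule additive_slot_subst) (rule lin)
  have "slot_subst (der s) (\<lambda>z x. \<kappa> z x y) (prd x' y') x =
      signed e (slot_subst (der s) (\<lambda>z x. \<kappa> z x y) (twist s (prd y' x')) x)"
    unfolding sym by (rule signed_additive[OF add])
  also have "slot_subst (der s) (\<lambda>z x. \<kappa> z x y) (twist s (prd y' x')) x =
      slot_subst (der s) (\<lambda>z y. \<kappa> z x y) (prd y' x') y"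
    by (rule slot_subst_twist[where \<kappa> = \<kappa>, OF s lin invariant_formD(2)[OF inv]])
  finally show ?thesis .
qed

lemma lin_ext_cyb:
  assumes sc: "module sc" and inv: "invariant_form s s s sc \<tau>" and s: "module s"
    and sym: "\<And>x y. prd x y = - twist s (prd y x)"
  shows "lin_ext sc (uncurry3 \<tau>) (cyb s prd r) =
    lin_ext sc (\<lambda>p. lin_ext sc (yb_pair s prd \<tau> p) r) r"
proof -
  interpret T: module_hom fscale sc "lin_ext sc (uncurry3 \<tau>)" by (rule lin_ext_linear) fact
  have "invariant_form s s s sc (\<lambda>z x y. \<tau> x y z)"
    using invariant_form_swap12[OF invariant_form_swap23[OF inv]] .
  then have flip: "slot_subst (der s) (\<lambda>z x. \<tau> x y z) (prd x' y') x =
      - slot_subst (der s) (\<lambda>z y. \<tau> x y z) (prd y' x') y" for x x' y y'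
    using slot_subst_symmetric[where e = False and \<kappa> = "\<lambda>z x y. \<tau> x y z" and prd = prd, OF _ s]
    unfolding signed_def if_False by (metis sym)
  have pair: "lin_ext sc (uncurry3 \<tau>)
        (psubst (der_2 s) (\<lambda>z. pure (z, x', y')) (prd x y)
       - psubst (der_3 s) (\<lambda>z. pure (x, z, y')) (prd y x')
       - psubst (der_2 s) (\<lambda>z. pure (x, y, z)) (prd y' x')) = yb_pair s prd \<tau> (x, x') (y, y')" for x x' y y'
    unfolding T.diff lin_ext_psubst_slot[OF sc] yb_pair_def prod.case flip by simp
  show ?thesis
    unfolding cyb_def lin_ext_hom[OF T.module_hom_axioms]
  proof (rule lin_ext_cong, clarify)
    fix x x'
    show "lin_ext sc (uncurry3 \<tau>) (lin_ext fscale (\<lambda>(y, y').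
         psubst (der_2 s) (\<lambda>z. pure (z, x', y')) (prd x y)
       - psubst (der_3 s) (\<lambda>z. pure (x, z, y')) (prd y x')
       - psubst (der_2 s) (\<lambda>z. pure (x, y, z)) (prd y' x')) r) =
      lin_ext sc (yb_pair s prd \<tau> (x, x')) r"
      unfolding lin_ext_hom[OF T.module_hom_axioms]
      by (rule lin_ext_cong, clarify) (rule pair)
  qed
qed

lemma der_slot_formal_sums:
  assumes "\<And>x. x \<in> A \<Longrightarrow> der s x \<in> A" "t \<in> formal_sums (A \<times> A \<times> A)"
  shows "der_1 s t \<in> formal_sums (A \<times> A \<times> A)" "der_2 s t \<in> formal_sums (A \<times> A \<times> A)"
    "der_3 s t \<in> formal_sums (A \<times> A \<times> A)"
proof -
  have keys: "x \<in> A \<times> A \<times> A" if "x \<in> Poly_Mapping.keys t" for x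
    using assms(2) that by (auto simp: formal_sums_def)
  note lin = lin_ext_in_subspace[OF module_fscale subspace_formal_sums]
  show "der_1 s t \<in> formal_sums (A \<times> A \<times> A)" "der_2 s t \<in> formal_sums (A \<times> A \<times> A)"
    "der_3 s t \<in> formal_sums (A \<times> A \<times> A)"
    unfolding der_1_def der_2_def der_3_def
    by (rule lin, drule keys, auto simp: assms(1))+
qed

lemma psubst_formal_sums:
  assumes "\<And>t. t \<in> formal_sums X \<Longrightarrow> \<theta> t \<in> formal_sums X"
    and "\<And>k. h (coeff p k) \<in> formal_sums X"
  shows "psubst \<theta> h p \<in> (formal_sums X :: ('x \<Rightarrow>\<^sub>0 'k::field) set)"
proof -
  have "(\<theta> ^^ k) t \<in> formal_sums X" if "t \<in> formal_sums X" for k t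
    using that by (induction k) (simp_all add: assms(1))
  from this[OF assms(2)] show ?thesis
    unfolding psubst_def by (rule module.subspace_sum[OF module_fscale subspace_formal_sums])
qed

lemma yb_in_formal_sums:
  assumes s: "module s" and A: "module.subspace s A"
    and closed: "\<And>x y k. x \<in> A \<Longrightarrow> y \<in> A \<Longrightarrow> coeff (prd x y) k \<in> A"
    and r: "r \<in> formal_sums (A \<times> A)"
  shows "cyb s prd r \<in> formal_sums (A \<times> A \<times> A)" "ayb s prd r \<in> formal_sums (A \<times> A \<times> A)"
proof -
  have der: "der s x \<in> A" if "x \<in> A" for x
    unfolding der_def by (rule module.subspace_scale[OF s A that])
  have d: "der_1 s t \<in> formal_sums (A \<times> A \<times> A)" "der_2 s t \<in> formal_sums (A \<times> A \<times> A)"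
    "der_3 s t \<in> formal_sums (A \<times> A \<times> A)" if "t \<in> formal_sums (A \<times> A \<times> A)" for t
    using der_slot_formal_sums[of A s t] der that by blast+
  note sub = module.subspace_diff[OF module_fscale subspace_formal_sums]
    module.subspace_add[OF module_fscale subspace_formal_sums]
    module.subspace_neg[OF module_fscale subspace_formal_sums]
  have dm: "(- (der_1 s + der_2 s)) t \<in> formal_sums (A \<times> A \<times> A)" if "t \<in> formal_sums (A \<times> A \<times> A)" for t
    using sub(3)[OF sub(2)[OF d(1)[OF that] d(2)[OF that]]] by simp
  have r': "x \<in> A \<times> A" if "x \<in> Poly_Mapping.keys r" for x
    using r that by (auto simp: formal_sums_def)
  have ps: "psubst (der_1 s) (\<lambda>z. pure (x, y, z)) p \<in> formal_sums (A \<times> A \<times> A)"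
    "psubst (der_2 s) (\<lambda>z. pure (z, x, y)) p \<in> formal_sums (A \<times> A \<times> A)"
    "psubst (der_2 s) (\<lambda>z. pure (x, y, z)) p \<in> formal_sums (A \<times> A \<times> A)"
    "psubst (der_3 s) (\<lambda>z. pure (x, z, y)) p \<in> formal_sums (A \<times> A \<times> A)"
    "psubst (- (der_1 s + der_2 s)) (\<lambda>z. pure (x, z, y)) p \<in> formal_sums (A \<times> A \<times> A)"
    if "x \<in> A" "y \<in> A" "\<And>k. coeff p k \<in> A" for x y p
    by - (rule psubst_formal_sums, erule d dm, simp add: that)+
  note lin = lin_ext_in_subspace[OF module_fscale subspace_formal_sums]
  show "cyb s prd r \<in> formal_sums (A \<times> A \<times> A)"
    unfolding cyb_def by (intro lin; drule r'; clarify; intro lin; drule r'; clarify; intro sub ps closed)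
  show "ayb s prd r \<in> formal_sums (A \<times> A \<times> A)"
    unfolding ayb_def by (intro lin; drule r'; clarify; intro lin; drule r'; clarify; intro sub ps closed)
qed

section \<open>The Yang-Baxter expressions of the semi-direct product\<close>

lemma prod_scale_apply [simp]: "prod_scale s t p (a, u) = (s p a, t p u)"
  by (simp add: prod_scale_def)

lemma module_prod_scale:
  assumes "module s" "module t"
  shows "module (prod_scale s t)"
proof -
  interpret s: module s by fact
  interpret t: module t by fact
  show ?thesis
    by standard (auto simp: prod_scale_def s.scale_right_distrib t.scale_right_distrib
        s.scale_left_distrib t.scale_left_distrib)
qed

lemma der_prod_scale [simp]: "der (prod_scale s t) (a, u) = (der s a, der t u)"
  by (simp add: der_def)

lemma module_hom_prod_scale:
  assumes "module s" "module t"
  shows "module_hom s (prod_scale s t) (\<lambda>a. (a, 0))" "module_hom t (prod_scale s t) (\<lambda>u. (0, u))"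
    "module_hom (prod_scale s t) s fst" "module_hom (prod_scale s t) t snd"
  using assms module_prod_scale[OF assms]
  by (auto simp: module_hom_iff module.scale_zero_right)

lemma module_hom_scalars:
  assumes "module_hom s t f"
  shows "module_hom (\<lambda>c. s [:c:]) (\<lambda>c. t [:c:]) f"
  using assms by (simp add: module_hom_iff scalar_module)

lemma module_hom_comp: "module_hom s t f \<Longrightarrow> module_hom t u g \<Longrightarrow> module_hom s u (\<lambda>x. g (f x))"
  using module_hom_compose[of s t f u g] by (simp add: comp_def)

lemma invariant_form_pullback:
  assumes "invariant_form s1 s2 s3 sc \<tau>"
    and "module_hom t1 s1 \<pi>1" "module_hom t2 s2 \<pi>2" "module_hom t3 s3 \<pi>3"
  shows "invariant_form t1 t2 t3 sc (\<lambda>x y z. \<tau> (\<pi>1 x) (\<pi>2 y) (\<pi>3 z))"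
proof -
  have "\<pi>1 (der t1 x) = der s1 (\<pi>1 x)" "\<pi>2 (der t2 y) = der s2 (\<pi>2 y)"
    "\<pi>3 (der t3 z) = der s3 (\<pi>3 z)" for x y z
    using assms(2-4)[THEN module_hom.scale] by (simp_all add: der_def)
  moreover note h = assms(2-4)[THEN module_hom_scalars]
  have "module_hom (\<lambda>c. t1 [:c:]) sc (\<lambda>x. \<tau> (\<pi>1 x) y z)" for y z
    using assms(1) by (intro module_hom_comp[OF h(1)]) (simp add: invariant_form_def)
  moreover have "module_hom (\<lambda>c. t2 [:c:]) sc (\<lambda>y. \<tau> x (\<pi>2 y) z)" for x z
    using assms(1) by (intro module_hom_comp[OF h(2)]) (simp add: invariant_form_def)
  moreover have "module_hom (\<lambda>c. t3 [:c:]) sc (\<lambda>z. \<tau> x y (\<pi>3 z))" for x y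
    using assms(1) by (intro module_hom_comp[OF h(3)]) (simp add: invariant_form_def)
  ultimately show ?thesis
    using assms(1) unfolding invariant_form_def by simp
qed

lemma lin_ext_incl_tensor:
  assumes "module sc"
  shows "lin_ext sc g (incl_tensor t - flip (incl_tensor t)) =
    lin_ext sc (\<lambda>(a, f). g ((a, 0), (0, f)) - g ((0, f), (a, 0))) t"
proof -
  interpret sc: module sc by fact
  interpret G: module_hom fscale sc "lin_ext sc g" by (rule lin_ext_linear) fact
  have "flip (incl_tensor t) = lin_ext fscale (\<lambda>(a, f). pure ((0, f), (a, 0))) t"
    unfolding incl_tensor_def flip_def
    by (simp add: lin_ext_hom[OF lin_ext_linear[OF module_fscale]] module_fscale case_prod_unfold)
  then show ?thesis
    unfolding G.diff incl_tensor_def lin_ext_hom[OF G.module_hom_axioms]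
    by (simp add: lin_ext_hom[OF G.module_hom_axioms] case_prod_unfold assms)
      (simp add: lin_ext_def sc.scale_right_diff_distrib sum_subtractf)
qed

lemma sum_products_swap:
  fixes sc :: "'c::comm_monoid_mult \<Rightarrow> 'm \<Rightarrow> 'n::comm_monoid_add"
  shows "(\<Sum>i\<in>K. \<Sum>j\<in>K. sc (c i * c j) (w i j)) = (\<Sum>i\<in>K. \<Sum>j\<in>K. sc (c i * c j) (w j i))"
  by (subst sum.swap) (simp add: mult.commute)

context commutative_product_with_action
begin

abbreviation "sQ \<equiv> prod_scale sP (cdual_scale :: 'k poly \<Rightarrow> ('v \<Rightarrow> 'k poly) \<Rightarrow> _)"
abbreviation "Q \<equiv> (UNIV :: 'p set) \<times> cdual sV"

lemma module_sQ: "module sQ"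
  by (intro module_prod_scale P.module_axioms module_cdual_scale)

text \<open>
  Both products of the semi-direct product are instances of this one, see \<open>signed\<close>.
\<close>

definition semidirect :: "'p \<times> ('v \<Rightarrow> 'k poly) \<Rightarrow> 'p \<times> ('v \<Rightarrow> 'k poly) \<Rightarrow> ('p \<times> ('v \<Rightarrow> 'k poly)) poly" where
  "semidirect = (\<lambda>(a, u) (b, v).
     inl_poly (q a b) + inr_poly (dual a v + signed e (twist cdual_scale (dual b u))))"

lemma additive_inl_poly: "additive (inl_poly :: 'p poly \<Rightarrow> ('p \<times> ('v \<Rightarrow> 'k poly)) poly)"
  and additive_inr_poly: "additive (inr_poly :: ('v \<Rightarrow> 'k poly) poly \<Rightarrow> ('p \<times> ('v \<Rightarrow> 'k poly)) poly)"
  unfolding inl_poly_def inr_poly_def by (intro additive_map_poly; standard; simp)+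

lemma coeff_inl_poly: "coeff (inl_poly p) n = (coeff p n, 0)"
  and coeff_inr_poly: "coeff (inr_poly p') n = (0, coeff p' n)"
  unfolding inl_poly_def inr_poly_def by (simp_all add: coeff_map_poly zero_prod_def)

lemma twist_inl_poly: "twist sQ (inl_poly p) = inl_poly (twist sP p)"
  and twist_inr_poly: "twist sQ (inr_poly p') = inr_poly (twist cdual_scale p')"
  unfolding inl_poly_def inr_poly_def
  by (rule twist_map_poly[symmetric];
      simp add: P.module_axioms module_cdual_scale module_sQ additive_def del: der_cdual)+

text \<open>
  The mixed products are (skew-)commutative by construction because the twist is an involution.
\<close>

lemma semidirect_symmetric: "semidirect x y = signed e (twist sQ (semidirect y x))"
proof -
  obtain a u b v where [simp]: "x = (a, u)" "y = (b, v)" by (cases x, cases y)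
  interpret T: additive "twist sQ" by (rule additive_twist[OF module_sQ])
  interpret TW: additive "twist (cdual_scale :: 'k poly \<Rightarrow> ('v \<Rightarrow> 'k poly) \<Rightarrow> _)"
    by (rule additive_twist[OF module_cdual_scale])
  have tt: "twist cdual_scale (twist cdual_scale p) = p" for p :: "('v \<Rightarrow> 'k poly) poly"
    by (rule twist_twist[OF module_cdual_scale])
  have t: "twist sQ (semidirect y x) = inl_poly (twist sP (q b a)) +
      inr_poly (twist cdual_scale (dual b u) + signed e (dual a v))"
    unfolding semidirect_def
    by (simp only: prod.case \<open>x = _\<close> \<open>y = _\<close> T.add twist_inl_poly twist_inr_poly TW.add
        signed_additive[OF TW.additive_axioms] tt)
  show ?thesis
    unfolding t unfolding semidirect_def \<open>x = _\<close> \<open>y = _\<close> prod.case symmetric[of a b]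
    by (simp add: signed_def additive.minus[OF additive_inl_poly] additive.minus[OF additive_inr_poly]
        additive.add[OF additive_inr_poly] additive.diff[OF additive_inr_poly])
qed

lemma dual_0_right: "dual a 0 = 0"
proof -
  have "(0 :: 'v \<Rightarrow> 'k poly) \<in> cdual sV" by (simp add: cdual_iff V.module_axioms)
  then have "coeff (dual_action phi a (0 :: 'v \<Rightarrow> 'k poly)) n = (\<lambda>u. - coeff (dual_poly 0 (phi a u)) n)" for n
    by (rule coeff_dual_action[where phi = phi, OF V.fg_module_axioms _ action_gc])
  moreover have "dual_poly (0 :: 'v \<Rightarrow> 'k poly) p = 0" for p :: "'v poly"
    unfolding dual_poly_def by (induction p) (simp_all add: psubst_0 psubst_pCons additive_lam)
  ultimately have "dual_action phi a (0 :: 'v \<Rightarrow> 'k poly) = 0"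
    by (intro poly_eqI) (simp add: fun_eq_iff)
  then show ?thesis by (simp add: dual_def)
qed

lemma dual_0_left:
  assumes "f \<in> cdual sV"
  shows "dual 0 f = 0"
proof -
  have "phi 0 u = 0" for u using action_add_left[of 0 0 u] by simp
  moreover have "dual_poly f 0 = 0"
    using additive.zero[OF additive_dual_poly[OF additive_cdual[OF V.module_axioms assms]]] .
  ultimately have "dual_action phi 0 f = 0"
    by (intro poly_eqI) (simp add: coeff_dual_action[where phi = phi, OF V.fg_module_axioms assms action_gc] fun_eq_iff)
  then show ?thesis by (simp add: dual_def)
qed

lemma semidirect_simps:
  "semidirect (a, 0) (b, 0) = inl_poly (q a b)"
  "f \<in> cdual sV \<Longrightarrow> semidirect (a, 0) (0, f) = inr_poly (dual a f)"
  "f \<in> cdual sV \<Longrightarrow> g \<in> cdual sV \<Longrightarrow> semidirect (0, f) (0, g) = 0"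
proof -
  have q0: "q a 0 = 0" for a using additive.zero[OF additive_q_right] .
  have tw: "twist cdual_scale (0 :: ('v \<Rightarrow> 'k poly) poly) = 0" by (rule psubst_0) simp
  have 0: "inl_poly (0 :: 'p poly) = (0 :: ('p \<times> ('v \<Rightarrow> 'k poly)) poly)"
    "inr_poly 0 = (0 :: ('p \<times> ('v \<Rightarrow> 'k poly)) poly)"
    using additive.zero[OF additive_inl_poly] additive.zero[OF additive_inr_poly] by simp_all
  show "semidirect (a, 0) (b, 0) = inl_poly (q a b)"
    by (simp only: semidirect_def prod.case dual_0_right tw signed_0 add_0_right 0)
  show "f \<in> cdual sV \<Longrightarrow> semidirect (a, 0) (0, f) = inr_poly (dual a f)"
    by (simp only: semidirect_def prod.case q0 dual_0_right tw signed_0 add_0_right add_0_left 0)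
  show "f \<in> cdual sV \<Longrightarrow> g \<in> cdual sV \<Longrightarrow> semidirect (0, f) (0, g) = 0"
    by (simp only: semidirect_def prod.case q0 dual_0_left tw signed_0 add_0_right add_0_left 0)
qed

lemma subspace_cdual_sV: "module.subspace cdual_scale (cdual sV)"
  by (rule subspace_cdual[OF V.module_axioms])

lemma semidirect_closed:
  assumes "x \<in> Q" "y \<in> Q"
  shows "coeff (semidirect x y) n \<in> Q"
proof -
  obtain a u b v where xy: "x = (a, u)" "y = (b, v)" and uv: "u \<in> cdual sV" "v \<in> cdual sV"
    using assms by auto
  note sub = module.subspace_add[OF module_cdual_scale subspace_cdual_sV]
    module.subspace_neg[OF module_cdual_scale subspace_cdual_sV]
  have sg: "signed e f \<in> cdual sV" if "f \<in> cdual sV" for f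
    using that sub(2) by (simp add: signed_def)
  have csg: "coeff (signed e p) n = signed e (coeff p n)" for p :: "('v \<Rightarrow> 'k poly) poly" and n
    by (simp add: signed_def)
  have d: "coeff (dual a f) n \<in> cdual sV" if "f \<in> cdual sV" for a f n
  proof -
    have "coeff (dual a f) n = - signed e (- (\<lambda>u. coeff (dual_poly f (phi a u)) n))"
      by (simp add: dual_def csg coeff_dual_action[where phi = phi, OF V.fg_module_axioms that action_gc] fun_Compl_def)
    then show ?thesis
      by (simp only:) (intro sub(2) sg dual_poly_coeff_in_cdual V.module_axioms that action_gc)
  qed
  have "coeff (dual a v + signed e (twist cdual_scale (dual b u))) n \<in> cdual sV"
    unfolding coeff_add csg
    by (intro sub(1) sg d uv twist_coeff_in_subspace module_cdual_scale subspace_cdual_sV)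
  then show ?thesis
    by (simp add: xy semidirect_def coeff_inl_poly coeff_inr_poly del: coeff_add) (simp add: coeff_inl_poly coeff_inr_poly)
qed

text \<open>
  In the components \<open>V\<^sup>*\<^sup>c \<otimes> P \<otimes> V\<^sup>*\<^sup>c\<close> and \<open>V\<^sup>*\<^sup>c \<otimes> V\<^sup>*\<^sup>c \<otimes> P\<close>, some terms agree with those of \<open>yb_form\<close> only after the two
  indices have been exchanged. These terms are collected here; they cancel in the sum over all pairs.
\<close>

definition leftover :: "('p \<times> ('v \<Rightarrow> 'k poly) \<Rightarrow> 'p \<times> ('v \<Rightarrow> 'k poly) \<Rightarrow> 'p \<times> ('v \<Rightarrow> 'k poly) \<Rightarrow> 'm::ab_group_add) \<Rightarrow>
    'p \<Rightarrow> ('v \<Rightarrow> 'k poly) \<Rightarrow> 'p \<Rightarrow> ('v \<Rightarrow> 'k poly) \<Rightarrow> 'm" where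
  "leftover \<tau> a f b g =
     - slot_subst dW (\<lambda>h f. \<tau> (0, h) (0, f) (b, 0)) (dual a g) f
     - slot_subst dW (\<lambda>h f. \<tau> (0, f) (b, 0) (0, h)) (dual a g) f
     - signed e (slot_subst dW (\<lambda>h f. \<tau> (0, f) (0, h) (b, 0)) (dual a g) f)"

text \<open>
  Products of two elements of \<open>V\<^sup>*\<^sup>c\<close> vanish and each remaining term has exactly one factor in \<open>P\<close>. Sorting the
  terms by the position of that factor gives one copy of \<open>yb_form\<close> for each of the three positions: the
  product on \<open>P\<close> and the mixed products are brought to the order in which they occur in \<open>yb_form\<close> by
  (skew-)commutativity, which moves the substituted operator to the other slot.
\<close>

lemma yb_pair_semidirect:
  fixes \<tau> :: "'p \<times> ('v \<Rightarrow> 'k poly) \<Rightarrow> 'p \<times> ('v \<Rightarrow> 'k poly) \<Rightarrow> 'p \<times> ('v \<Rightarrow> 'k poly) \<Rightarrow> 'm::ab_group_add"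
  assumes inv: "invariant_form sQ sQ sQ sc \<tau>" and f: "f \<in> cdual sV" and g: "g \<in> cdual sV"
  shows "yb_pair sQ semidirect \<tau> ((a, 0), (0, f)) ((b, 0), (0, g))
       - yb_pair sQ semidirect \<tau> ((a, 0), (0, f)) ((0, g), (b, 0))
       - (yb_pair sQ semidirect \<tau> ((0, f), (a, 0)) ((b, 0), (0, g))
       - yb_pair sQ semidirect \<tau> ((0, f), (a, 0)) ((0, g), (b, 0))) =
      yb_form (\<lambda>a f g. \<tau> (a, 0) (0, f) (0, g)) a f b g
    + signed e (yb_form (\<lambda>a f g. \<tau> (0, f) (a, 0) (0, g)) a f b g)
    + yb_form (\<lambda>a f g. \<tau> (0, f) (0, g) (a, 0)) a f b g
    + (leftover \<tau> a f b g - leftover \<tau> b g a f)"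
proof -
  define S where "S \<kappa> p y = slot_subst (der sQ) \<kappa> p y" for \<kappa> :: "'p \<times> ('v \<Rightarrow> 'k poly) \<Rightarrow> 'p \<times> ('v \<Rightarrow> 'k poly) \<Rightarrow> 'm" and p y
  \<comment> \<open>To flip a product in the second or third slot, that slot is moved to the front.\<close>
  have inv2: "invariant_form sQ sQ sQ sc (\<lambda>z x y. \<tau> y z x)"
    using invariant_form_swap23[OF invariant_form_swap12[OF inv]] .
  have inv3: "invariant_form sQ sQ sQ sc (\<lambda>z x y. \<tau> x y z)"
    using invariant_form_swap12[OF invariant_form_swap23[OF inv]] .
  have \<tau>0: "\<tau> 0 x y = 0" "\<tau> x 0 y = 0" "\<tau> x y 0 = 0" for x y
    using inv unfolding invariant_form_def by (blast dest: module_hom.zero)+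
  note flip1 = slot_subst_symmetric[where prd = semidirect and \<kappa> = \<tau>, OF inv module_sQ semidirect_symmetric, folded S_def]
  note flip2 = slot_subst_symmetric[where prd = semidirect and \<kappa> = "\<lambda>z x y. \<tau> y z x", OF inv2 module_sQ semidirect_symmetric, folded S_def]
  note flip3 = slot_subst_symmetric[where prd = semidirect and \<kappa> = "\<lambda>z x y. \<tau> x y z", OF inv3 module_sQ semidirect_symmetric, folded S_def]
  have S_inl: "S \<kappa> (inl_poly p) (0, x) = slot_subst dW (\<lambda>z x. \<kappa> (z, 0) (0, x)) p x"
    if "\<And>y. \<kappa> 0 y = 0" for \<kappa> p x
  proof -
    have "slot_subst (der sQ) \<kappa> (map_poly (\<lambda>a. (a, 0)) p) (0, x) = slot_subst (der sQ) (\<lambda>a. \<kappa> (a, 0)) p (0, x)"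
      by (rule slot_subst_map_poly) (simp_all add: that zero_prod_def[symmetric])
    also have "\<dots> = slot_subst dW (\<lambda>a x. \<kappa> (a, 0) (0, x)) p x"
      by (rule slot_subst_transport) (simp add: P.module_axioms del: der_cdual)
    finally show ?thesis unfolding S_def inl_poly_def .
  qed
  have S_inr: "S \<kappa> (inr_poly p) (0, x) = slot_subst dW (\<lambda>h x. \<kappa> (0, h) (0, x)) p x"
    if "\<And>y. \<kappa> 0 y = 0" for \<kappa> p x
  proof -
    have "slot_subst (der sQ) \<kappa> (map_poly (\<lambda>a. (0, a)) p) (0, x) = slot_subst (der sQ) (\<lambda>a. \<kappa> (0, a)) p (0, x)"
      by (rule slot_subst_map_poly) (simp_all add: that zero_prod_def[symmetric])
    also have "\<dots> = slot_subst dW (\<lambda>a x. \<kappa> (0, a) (0, x)) p x"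
      by (rule slot_subst_transport) (simp add: P.module_axioms del: der_cdual)
    finally show ?thesis unfolding S_def inr_poly_def .
  qed
  have S0: "S \<kappa> 0 y = 0" if "\<And>y. \<kappa> 0 y = 0" for \<kappa> y
    unfolding S_def by (rule slot_subst_0) (rule that)
  \<comment> \<open>Products of two dual elements vanish. In \<open>e6\<close>, \<open>e7\<close>, \<open>e8\<close> and \<open>e11\<close> the product occurs in reverse order;
    reversing it moves the substituted operator to the other slot.\<close>
  have e1: "S (\<lambda>z x. \<tau> z x (0, g)) (semidirect (a, 0) (b, 0)) (0, f) =
      slot_subst dW (\<lambda>z f. \<tau> (z, 0) (0, f) (0, g)) (q a b) f"
    unfolding semidirect_simps by (rule S_inl) (rule \<tau>0)
  have e2: "S (\<lambda>z y. \<tau> (a, 0) z y) (semidirect (b, 0) (0, f)) (0, g) =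
      slot_subst dW (\<lambda>h g. \<tau> (a, 0) (0, h) (0, g)) (dual b f) g"
    unfolding semidirect_simps(2)[OF f] by (rule S_inr) (rule \<tau>0)
  have e3: "S (\<lambda>z x. \<tau> x (b, 0) z) (semidirect (0, f) (0, g)) (a, 0) = 0"
    unfolding semidirect_simps(3)[OF f g] by (rule S0) (rule \<tau>0)
  have e4: "S (\<lambda>z x. \<tau> z x (b, 0)) (semidirect (a, 0) (0, g)) (0, f) =
      slot_subst dW (\<lambda>h f. \<tau> (0, h) (0, f) (b, 0)) (dual a g) f"
    unfolding semidirect_simps(2)[OF g] by (rule S_inr) (rule \<tau>0)
  have e5: "S (\<lambda>z y. \<tau> (a, 0) z y) (semidirect (0, g) (0, f)) (b, 0) = 0"
    unfolding semidirect_simps(3)[OF g f] by (rule S0) (rule \<tau>0)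
  have e6: "S (\<lambda>z x. \<tau> x (0, g) z) (semidirect (0, f) (b, 0)) (a, 0) =
      signed e (slot_subst dW (\<lambda>h g. \<tau> (a, 0) (0, g) (0, h)) (dual b f) g)"
    unfolding flip3[of "(0, g)" "(0, f)" "(b, 0)" "(a, 0)"] semidirect_simps(2)[OF f]
    by (rule arg_cong[where f = "signed e"], rule S_inr) (rule \<tau>0)
  have e7: "S (\<lambda>z x. \<tau> z x (0, g)) (semidirect (0, f) (b, 0)) (a, 0) =
      signed e (slot_subst dW (\<lambda>h g. \<tau> (0, h) (a, 0) (0, g)) (dual b f) g)"
    unfolding flip1[of "(0, g)" "(0, f)" "(b, 0)" "(a, 0)"] semidirect_simps(2)[OF f]
    by (rule arg_cong[where f = "signed e"], rule S_inr) (rule \<tau>0)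
  have e8: "S (\<lambda>z y. \<tau> (0, f) z y) (semidirect (b, 0) (a, 0)) (0, g) =
      signed e (slot_subst dW (\<lambda>z f. \<tau> (0, f) (z, 0) (0, g)) (q a b) f)"
    unfolding flip2[of "(0, f)" "(b, 0)" "(a, 0)" "(0, g)"] unfolding semidirect_simps(1)
    by (rule arg_cong[where f = "signed e"], rule S_inl) (rule \<tau>0)
  have e9: "S (\<lambda>z x. \<tau> x (b, 0) z) (semidirect (a, 0) (0, g)) (0, f) =
      slot_subst dW (\<lambda>h f. \<tau> (0, f) (b, 0) (0, h)) (dual a g) f"
    unfolding semidirect_simps(2)[OF g] by (rule S_inr) (rule \<tau>0)
  have e10: "S (\<lambda>z x. \<tau> z x (b, 0)) (semidirect (0, f) (0, g)) (a, 0) = 0"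
    unfolding semidirect_simps(3)[OF f g] by (rule S0) (rule \<tau>0)
  have e11: "S (\<lambda>z y. \<tau> (0, f) z y) (semidirect (0, g) (a, 0)) (b, 0) =
      signed e (slot_subst dW (\<lambda>h f. \<tau> (0, f) (0, h) (b, 0)) (dual a g) f)"
    unfolding flip2[of "(0, f)" "(0, g)" "(a, 0)" "(b, 0)"] semidirect_simps(2)[OF g]
    by (rule arg_cong[where f = "signed e"], rule S_inr) (rule \<tau>0)
  have e12: "S (\<lambda>z x. \<tau> x (0, g) z) (semidirect (a, 0) (b, 0)) (0, f) =
      slot_subst dW (\<lambda>z f. \<tau> (0, f) (0, g) (z, 0)) (q a b) f"
    unfolding semidirect_simps by (rule S_inl) (rule \<tau>0)
  show ?thesis
    unfolding yb_pair_def prod.case S_def[symmetric] e1 e2 e3 e4 e5 e6 e7 e8 e9 e10 e11 e12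
      yb_form_def leftover_def
    by (simp add: signed_def)
qed


section \<open>The Yang-Baxter equation as the operator identity\<close>

lemma lin_ext_yb_pair:
  fixes sc :: "'k \<Rightarrow> 'm::ab_group_add \<Rightarrow> 'm"
  assumes sc: "module sc" and inv: "invariant_form sQ sQ sQ sc \<tau>"
    and t: "t \<in> formal_sums (UNIV \<times> cdual sV)"
    and r: "r = incl_tensor t - flip (incl_tensor t)"
  shows "lin_ext sc (\<lambda>p. lin_ext sc (yb_pair sQ semidirect \<tau> p) r) r =
    (\<Sum>i\<in>Poly_Mapping.keys t. \<Sum>j\<in>Poly_Mapping.keys t.
       sc (Poly_Mapping.lookup t i * Poly_Mapping.lookup t j)
         (yb_form (\<lambda>a f g. \<tau> (a, 0) (0, f) (0, g)) (fst i) (snd i) (fst j) (snd j)))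
  + signed e (\<Sum>i\<in>Poly_Mapping.keys t. \<Sum>j\<in>Poly_Mapping.keys t.
       sc (Poly_Mapping.lookup t i * Poly_Mapping.lookup t j)
         (yb_form (\<lambda>a f g. \<tau> (0, f) (a, 0) (0, g)) (fst i) (snd i) (fst j) (snd j)))
  + (\<Sum>i\<in>Poly_Mapping.keys t. \<Sum>j\<in>Poly_Mapping.keys t.
       sc (Poly_Mapping.lookup t i * Poly_Mapping.lookup t j)
         (yb_form (\<lambda>a f g. \<tau> (0, f) (0, g) (a, 0)) (fst i) (snd i) (fst j) (snd j)))"
proof -
  interpret sc: module sc by fact
  let ?K = "Poly_Mapping.keys t" and ?c = "Poly_Mapping.lookup t"
  let ?Y1 = "\<lambda>i j. yb_form (\<lambda>a f g. \<tau> (a, 0) (0, f) (0, g)) (fst i) (snd i) (fst j) (snd j)"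
  let ?Y2 = "\<lambda>i j. yb_form (\<lambda>a f g. \<tau> (0, f) (a, 0) (0, g)) (fst i) (snd i) (fst j) (snd j)"
  let ?Y3 = "\<lambda>i j. yb_form (\<lambda>a f g. \<tau> (0, f) (0, g) (a, 0)) (fst i) (snd i) (fst j) (snd j)"
  let ?w = "\<lambda>i j. leftover \<tau> (fst i) (snd i) (fst j) (snd j)"
  define y where "y = yb_pair sQ semidirect \<tau>"
  have K: "snd i \<in> cdual sV" if "i \<in> ?K" for i
    using t that by (auto simp: formal_sums_def)
  have "lin_ext sc (\<lambda>p. lin_ext sc (y p) r) r =
    (\<Sum>i\<in>?K. \<Sum>j\<in>?K. sc (?c i * ?c j)
      (y ((fst i, 0), (0, snd i)) ((fst j, 0), (0, snd j))
     - y ((fst i, 0), (0, snd i)) ((0, snd j), (fst j, 0))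
     - (y ((0, snd i), (fst i, 0)) ((fst j, 0), (0, snd j))
     - y ((0, snd i), (fst i, 0)) ((0, snd j), (fst j, 0)))))"
    unfolding r lin_ext_incl_tensor[OF sc]
    by (simp add: lin_ext_def case_prod_unfold sc.scale_right_diff_distrib sum_subtractf sc.scale_sum_right)
  also have "\<dots> = (\<Sum>i\<in>?K. \<Sum>j\<in>?K. sc (?c i * ?c j)
      (?Y1 i j + signed e (?Y2 i j) + ?Y3 i j + (?w i j - ?w j i)))"
    unfolding y_def by (intro sum.cong refl) (simp only: yb_pair_semidirect[OF inv K K])
  also have "\<dots> = (\<Sum>i\<in>?K. \<Sum>j\<in>?K. sc (?c i * ?c j) (?Y1 i j))
      + signed e (\<Sum>i\<in>?K. \<Sum>j\<in>?K. sc (?c i * ?c j) (?Y2 i j))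
      + (\<Sum>i\<in>?K. \<Sum>j\<in>?K. sc (?c i * ?c j) (?Y3 i j))
      + ((\<Sum>i\<in>?K. \<Sum>j\<in>?K. sc (?c i * ?c j) (?w i j)) - (\<Sum>i\<in>?K. \<Sum>j\<in>?K. sc (?c i * ?c j) (?w j i)))"
    by (simp add: sc.scale_right_distrib sc.scale_right_diff_distrib sum.distrib sum_subtractf
        signed_def sum_negf)
  also have "(\<Sum>i\<in>?K. \<Sum>j\<in>?K. sc (?c i * ?c j) (?w i j)) = (\<Sum>i\<in>?K. \<Sum>j\<in>?K. sc (?c i * ?c j) (?w j i))"
    by (rule sum_products_swap)
  finally show ?thesis unfolding y_def diff_self add_0_right .
qed

lemma dual_proj_0: "dual_proj 0 = 0"
  using module_hom.zero[OF dual_proj_hom] .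

text \<open>
  If \<open>X\<close> lies in the image of \<open>\<partial>\<close>, the evaluation forms on \<open>P \<otimes> V\<^sup>*\<^sup>c \<otimes> V\<^sup>*\<^sup>c\<close>, extended by zero to the other components,
  vanish on it, and this is the operator identity. Conversely the operator identity makes the
  evaluations vanish; they determine all invariant forms on each of the three components.
\<close>

theorem in_der_image_iff_operator:
  assumes t: "t \<in> formal_sums (UNIV \<times> cdual sV)"
    and r: "r = incl_tensor t - flip (incl_tensor t)"
    and T: "\<And>v. T v = (\<Sum>i\<in>Poly_Mapping.keys t. sP [:Poly_Mapping.lookup t i:] (sP (snd i v) (fst i)))"
    and X: "X \<in> formal_sums (Q \<times> Q \<times> Q)"
    and X_poly: "\<And>\<tau>. invariant_form sQ sQ sQ psP \<tau> \<Longrightarrow>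
      lin_ext psP (uncurry3 \<tau>) X = lin_ext psP (\<lambda>p. lin_ext psP (yb_pair sQ semidirect \<tau> p) r) r"
    and X_field: "\<And>\<tau>. invariant_form sQ sQ sQ (*) \<tau> \<Longrightarrow>
      lin_ext (*) (uncurry3 \<tau>) X = lin_ext (*) (\<lambda>p. lin_ext (*) (yb_pair sQ semidirect \<tau> p) r) r"
  shows "in_der_image sQ Q X \<longleftrightarrow>
    (\<forall>u v. q (T u) (T v) = map_poly T (phi (T u) v) + signed e (map_poly T (twist sV (phi (T v) u))))"
proof -
  let ?K = "Poly_Mapping.keys t" and ?c = "Poly_Mapping.lookup t"
  let ?X = "\<lambda>u v. \<Sum>i\<in>?K. \<Sum>j\<in>?K. psP (?c i * ?c j) (yb_form (eval_form u v) (fst i) (snd i) (fst j) (snd j))"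
  have K: "snd i \<in> cdual sV" if "i \<in> ?K" for i
    using t that by (auto simp: formal_sums_def)
  have defect: "?X u v = q (T u) (T v) - map_poly T (phi (T u) v) - signed e (map_poly T (twist sV (phi (T v) u)))" for u v
    by (rule sum_yb_form_eval_form[OF finite_keys K T])
  then have O_iff: "?X u v = 0 \<longleftrightarrow>
      q (T u) (T v) = map_poly T (phi (T u) v) + signed e (map_poly T (twist sV (phi (T v) u)))" for u v
    by (simp add: diff_diff_eq)
  note homs = module_hom_prod_scale[OF P.module_axioms module_cdual_scale]
  have "in_der_image sQ Q X \<longleftrightarrow> (\<forall>u v. ?X u v = 0)"
  proof (intro iffI allI)
    fix u v assume "in_der_image sQ Q X"
    \<comment> \<open>The projections make this form vanish outside the component with \<open>P\<close> in the first slot.\<close>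
    define \<tau> where "\<tau> x y z = eval_form u v (fst x) (snd y) (snd z)"
      for x y z :: "'p \<times> ('v \<Rightarrow> 'k poly)"
    have ev0: "eval_form u v 0 f g = 0" "eval_form u v a 0 g = 0" "eval_form u v a f 0 = 0" for a f g
      using invariant_eval_form[of u v] unfolding invariant_form_def by (blast dest: module_hom.zero)+
    have inv: "invariant_form sQ sQ sQ psP \<tau>"
      unfolding \<tau>_def by (rule invariant_form_pullback[OF invariant_eval_form homs(3,4,4)])
    have "0 = lin_ext psP (\<lambda>p. lin_ext psP (yb_pair sQ semidirect \<tau> p) r) r"
      using invariant_form_kills_der_image[OF module_psP inv \<open>in_der_image sQ Q X\<close>] X_poly[OF inv] by simp
    also have "\<dots> = ?X u v"
    proof -
      have "yb_form (\<lambda>a f g. 0) a f b g = (0 :: 'p poly)" for a f b g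
        by (simp add: yb_form_def slot_subst_def)
      then show ?thesis
        unfolding lin_ext_yb_pair[OF module_psP inv t r]
        by (simp add: \<tau>_def ev0 module.scale_zero_right[OF module_psP])
    qed
    finally show "?X u v = 0" by (rule sym)
  next
    assume van: "\<forall>u v. ?X u v = 0"
    define \<pi> where "\<pi> x = (fst x, dual_proj (snd x))" for x :: "'p \<times> ('v \<Rightarrow> 'k poly)"
    show "in_der_image sQ Q X"
    proof (rule in_der_image_if_forms_vanish[OF module_sQ X])
      show "module_hom sQ sQ \<pi>"
        using module_hom.add[OF dual_proj_hom] module_hom.scale[OF dual_proj_hom]
        by (auto simp: module_hom_iff module_sQ \<pi>_def)
      show "\<pi> x \<in> Q" for x by (simp add: \<pi>_def dual_proj_in_cdual)
      show "\<pi> x = x" if "x \<in> Q" for x using that by (auto simp: \<pi>_def dual_proj_id)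
    next
      fix \<tau> :: "'p \<times> ('v \<Rightarrow> 'k poly) \<Rightarrow> 'p \<times> ('v \<Rightarrow> 'k poly) \<Rightarrow> 'p \<times> ('v \<Rightarrow> 'k poly) \<Rightarrow> 'k"
      assume inv: "invariant_form sQ sQ sQ (*) \<tau>"
        and \<pi>: "\<And>x y z. \<tau> (\<pi> x) (\<pi> y) (\<pi> z) = \<tau> x y z"
      have field: "module ((*) :: 'k \<Rightarrow> 'k \<Rightarrow> 'k)"
        by standard (simp_all add: algebra_simps)
      have \<pi>_simps: "\<pi> (a, 0) = (a, 0)" "\<pi> (0, f) = (0, dual_proj f)" for a f
        by (simp_all add: \<pi>_def dual_proj_0)
      \<comment> \<open>The restrictions of \<open>\<tau>\<close> to the three components.\<close>
      have 1: "(\<Sum>i\<in>?K. \<Sum>j\<in>?K. ?c i * ?c j *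
          yb_form (\<lambda>a f g. \<tau> (a, 0) (0, f) (0, g)) (fst i) (snd i) (fst j) (snd j)) = 0"
        by (rule sum_yb_form_vanishes[OF invariant_form_pullback[OF inv homs(1,2,2)]])
          (use van \<pi>[of "(_, 0)" "(0, _)" "(0, _)"] in \<open>simp_all add: \<pi>_simps\<close>)
      have 2: "(\<Sum>i\<in>?K. \<Sum>j\<in>?K. ?c i * ?c j *
          yb_form (\<lambda>a f g. \<tau> (0, f) (a, 0) (0, g)) (fst i) (snd i) (fst j) (snd j)) = 0"
        by (rule sum_yb_form_vanishes[OF invariant_form_pullback[OF invariant_form_swap12[OF inv] homs(1,2,2)]])
          (use van \<pi>[of "(0, _)" "(_, 0)" "(0, _)"] in \<open>simp_all add: \<pi>_simps\<close>)
      have 3: "(\<Sum>i\<in>?K. \<Sum>j\<in>?K. ?c i * ?c j *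
          yb_form (\<lambda>a f g. \<tau> (0, f) (0, g) (a, 0)) (fst i) (snd i) (fst j) (snd j)) = 0"
        by (rule sum_yb_form_vanishes[OF invariant_form_pullback[OF
                invariant_form_swap12[OF invariant_form_swap23[OF inv]] homs(1,2,2)]])
          (use van \<pi>[of "(0, _)" "(0, _)" "(_, 0)"] in \<open>simp_all add: \<pi>_simps\<close>)
      show "lin_ext (*) (uncurry3 \<tau>) X = 0"
        unfolding X_field[OF inv] lin_ext_yb_pair[OF field inv t r] 1 2 3 by simp
    qed
  qed
  then show ?thesis using O_iff by simp
qed

end

section \<open>The tensor of a conformal linear map\<close>

context commutative_product_with_action
begin

lemma chom_of_tensor_conv:
  "chom_of_tensor sP t v = lin_ext psP (\<lambda>(a, f). opoly psP (lam + der1 sP) (f v) [:a:]) t"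
  unfolding chom_of_tensor_def opoly_def poly_scale_def[symmetric]
  by (simp add: P.module_axioms poly_scale_def[symmetric] del: plus_fun_apply)

text \<open>The coefficient of \<open>\<lambda>\<^sup>0\<close> turns \<open>\<lambda> + \<partial>\<close> into \<open>\<partial>\<close>.\<close>

lemma coeff_0_opoly: "coeff (opoly psP (lam + der1 sP) p x) 0 = sP p (coeff x 0)"
proof -
  have "coeff (opoly psP (lam + der1 sP) p x) 0 = opoly (\<lambda>c. sP [:c:]) (der sP) p (coeff x 0)"
  proof (rule opoly_hom[where H = "\<lambda>x. coeff x 0", OF linear_lam_der der_linear[OF P.module_axioms]])
    show "module_hom psP (\<lambda>c. sP [:c:]) (\<lambda>x. coeff x 0)"
      by (simp add: module_hom_iff module_psP scalar_module P.module_axioms)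
        (simp add: poly_scale_def coeff_map_poly P.module_axioms)
    show "coeff ((lam + der1 sP) x) 0 = der sP (coeff x 0)" for x
      by (simp add: der1_def coeff_map_poly P.module_axioms)
  qed
  then show ?thesis by (simp add: opoly_der P.module_axioms)
qed

text \<open>
  So \<open>T\<^sub>0\<close> is \<open>v \<mapsto> \<Sum>\<^sub>i f\<^sub>i\<^sub>,\<^sub>\<partial>(v) a\<^sub>i\<close>, the operator that appears in the evaluated Yang-Baxter expressions.
\<close>

lemma coeff_0_chom_of_tensor:
  "coeff (chom_of_tensor sP t v) 0 =
    (\<Sum>i\<in>Poly_Mapping.keys t. sP [:Poly_Mapping.lookup t i:] (sP (snd i v) (fst i)))"
proof -
  have "coeff (psP c x) 0 = sP [:c:] (coeff x 0)" for c x
    by (simp add: poly_scale_def coeff_map_poly P.module_axioms)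
  then show ?thesis
    unfolding chom_of_tensor_conv lin_ext_def coeff_sum case_prod_unfold
    by (simp only: coeff_0_opoly coeff_pCons_0)
qed

lemma coeff_0_hom:
  assumes "T \<in> chom sV sP"
  shows "module_hom sV sP (\<lambda>v. coeff (T v) 0)"
  using chom_polynomial[OF V.module_axioms P.module_axioms assms] additive.add[OF additive_chom[OF assms]]
  by (simp add: module_hom_iff V.module_axioms P.module_axioms coeff_0_opoly del: plus_fun_apply)

lemma psubst_lam_der_inverse: "psubst (lam + der1 sP) const1 (psubst (lam - der1 sP) const1 p) = p"
proof -
  have add: "additive (lam + der1 sP)" "additive (lam - der1 sP)"
    by (intro additive_ops additive_der1 P.module_axioms)+
  interpret H: additive "psubst (lam + der1 sP) const1" by (intro additive_psubst add additive_const1)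
  have "psubst (lam + der1 sP) const1 (psubst (lam - der1 sP) const1 p) =
      psubst lam (\<lambda>x. psubst (lam + der1 sP) const1 (const1 x)) p"
  proof (rule psubst_commute[OF add(2) _ additive_lam H.additive_axioms])
    show "psubst (lam + der1 sP) const1 ((lam - der1 sP) x) = lam (psubst (lam + der1 sP) const1 x)" for x
    proof -
      have "psubst (lam + der1 sP) const1 (lam x) = (lam + der1 sP) (psubst (lam + der1 sP) const1 x)"
        by (rule psubst_lam[OF add(1)]) simp
      moreover have "psubst (lam + der1 sP) const1 (der1 sP x) = der1 sP (psubst (lam + der1 sP) const1 x)"
        by (rule psubst_der1[OF P.module_axioms add(1) additive_const1 additive_der1])
          (simp_all add: P.module_axioms der1_add)
      ultimately show ?thesis by (simp add: H.diff del: uminus_apply)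
    qed
  qed simp
  also have "(\<lambda>x. psubst (lam + der1 sP) const1 (const1 x)) = const1"
    by (rule ext, rule psubst_const[OF add(1)]) simp
  finally show ?thesis by (simp only: psubst_lam_const1)
qed

text \<open>
  \<open>tensor_of_chom\<close> is only meaningful if a preimage exists. Writing \<open>T\<^sub>\<lambda>(b) = \<Sum>\<^sub>k (\<lambda> + \<partial>)\<^sup>k c\<^sub>k\<close> for each basis vector \<open>b\<close>, the
  sum of the \<open>c\<^sub>k \<otimes> \<lambda>\<^sup>k b\<^sup>*\<close> is one.
\<close>

lemma chom_of_tensor_surj:
  assumes "T \<in> chom sV sP"
  shows "\<exists>t \<in> formal_sums (UNIV \<times> cdual sV). chom_of_tensor sP t = T"
proof -
  define \<theta> where "\<theta> = lam + der1 sP"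
  have \<theta>: "module_hom psP psP \<theta>" unfolding \<theta>_def by (rule linear_lam_der)
  define R where "R b = psubst (lam - der1 sP) const1 (T b)" for b
  define t where "t = (\<Sum>b\<in>basis. \<Sum>k\<le>degree (R b).
      pure (coeff (R b) k, \<lambda>v. [:0, 1:] ^ k * coord b v) :: _ \<Rightarrow>\<^sub>0 'k)"
  have "(\<lambda>v. [:0, 1:] ^ k * coord b v) \<in> cdual sV" for k b
    using coord_in_cdual by (simp add: cdual_iff V.module_axioms algebra_simps)
  then have t: "t \<in> formal_sums (UNIV \<times> cdual sV)"
    unfolding t_def by (intro module.subspace_sum[OF module_fscale subspace_formal_sums]) simp
  have "chom_of_tensor sP t v = T v" for v
  proof -
    interpret L: module_hom fscale psP "lin_ext psP (\<lambda>(a, f). opoly psP \<theta> (f v) [:a:])"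
      by (rule lin_ext_linear[OF module_psP])
    have "chom_of_tensor sP t v =
        (\<Sum>b\<in>basis. \<Sum>k\<le>degree (R b). opoly psP \<theta> (coord b v) ((\<theta> ^^ k) [:coeff (R b) k:]))"
      unfolding chom_of_tensor_conv \<theta>_def[symmetric] t_def L.sum
      by (simp add: module_psP opoly_monom_mult[OF \<theta>])
    also have "\<dots> = (\<Sum>b\<in>basis. opoly psP \<theta> (coord b v) (psubst \<theta> const1 (R b)))"
      by (simp add: psubst_def module_hom.sum[OF opoly_linear[OF \<theta>]])
    also have "\<dots> = (\<Sum>b\<in>basis. T (sV (coord b v) b))"
      unfolding R_def \<theta>_def psubst_lam_der_inverse
      by (simp only: chom_polynomial[OF V.module_axioms P.module_axioms assms])
    also have "\<dots> = T v"
      by (simp only: additive.sum[OF additive_chom[OF assms], symmetric] coord_sum)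
    finally show ?thesis .
  qed
  with t show ?thesis by (auto simp: fun_eq_iff)
qed

lemma tensor_of_chom:
  assumes "T \<in> chom sV sP"
  shows "tensor_of_chom sP sV T \<in> formal_sums (UNIV \<times> cdual sV)"
    and "chom_of_tensor sP (tensor_of_chom sP sV T) = T"
proof -
  have "T \<in> chom_of_tensor sP ` formal_sums (UNIV \<times> cdual sV)"
    using chom_of_tensor_surj[OF assms] by blast
  then show "tensor_of_chom sP sV T \<in> formal_sums (UNIV \<times> cdual sV)"
    "chom_of_tensor sP (tensor_of_chom sP sV T) = T"
    unfolding tensor_of_chom_def by (rule inv_into_into, rule f_inv_into_f)
qed

lemma incl_tensor_in_formal_sums:
  assumes "t \<in> formal_sums (UNIV \<times> cdual sV)"
  shows "incl_tensor t \<in> formal_sums (Q \<times> Q)" "flip (incl_tensor t) \<in> formal_sums (Q \<times> Q)"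
proof -
  note lin = lin_ext_in_subspace[OF module_fscale subspace_formal_sums]
  have "(0 :: 'v \<Rightarrow> 'k poly) \<in> cdual sV" by (simp add: cdual_iff V.module_axioms)
  then show 1: "incl_tensor t \<in> formal_sums (Q \<times> Q)"
    using assms unfolding incl_tensor_def by (intro lin) (auto simp: formal_sums_def[of "UNIV \<times> _"])
  show "flip (incl_tensor t) \<in> formal_sums (Q \<times> Q)"
    unfolding flip_def case_prod_unfold
  proof (rule lin)
    fix x assume "x \<in> Poly_Mapping.keys (incl_tensor t)"
    then have "x \<in> Q \<times> Q" using 1 by (auto simp: formal_sums_def)
    then show "pure (snd x, fst x) \<in> formal_sums (Q \<times> Q)" by auto
  qed
qed

end

lemma flip_flip: "flip (flip t) = t"
  unfolding flip_def lin_ext_hom[OF lin_ext_linear[OF module_fscale]]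
  by (simp add: module_fscale case_prod_unfold formal_sum_conv_pure)

lemma skew_symmetric_diff_flip:
  fixes t :: "'a::ab_group_add \<times> 'a \<Rightarrow>\<^sub>0 'k::field_char_0"
  shows "skew_symmetric s A (t - flip t)"
proof -
  have "module_hom fscale fscale (flip :: ('a \<times> 'a \<Rightarrow>\<^sub>0 'k) \<Rightarrow> _)"
    unfolding flip_def by (intro lin_ext_linear module_fscale)
  then have "t - flip t - - flip (t - flip t) = 0"
    by (simp add: module_hom.diff flip_flip)
  then show ?thesis
    unfolding skew_symmetric_def tensor2_null_def
    by (simp only: module.span_zero[OF module_fscale])
qed

theorem theorem3p16:
  fixes sP :: "'k::field_char_0 poly \<Rightarrow> 'p::ab_group_add \<Rightarrow> 'p"
    and br mul :: "'p \<Rightarrow> 'p \<Rightarrow> 'p poly"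
    and sV :: "'k poly \<Rightarrow> 'v::ab_group_add \<Rightarrow> 'v"
    and rho l :: "'p \<Rightarrow> 'v \<Rightarrow> 'v poly"
    and T :: "'v \<Rightarrow> 'p poly"
  assumes "poisson_conformal_algebra sP UNIV br mul"
    and "poisson_conformal_representation sP br mul sV rho l"
    and "free_module sP" and "free_module sV"
    and "T \<in> chom sV sP"
  shows
    "(let Q = UNIV \<times> cdual sV;
          sQ = prod_scale sP cdual_scale;
          brQ = semidirect_br cdual_scale br (dual_action rho);
          mulQ = semidirect_mul cdual_scale mul (\<lambda>a f. - dual_action l a f);
          rT = incl_tensor (tensor_of_chom sP sV T);
          r = rT - flip rT
      in skew_symmetric sQ Q r \<and> pcybe_solution sQ Q brQ mulQ r)
     \<longleftrightarrow> O_operator sP br mul sV rho l (\<lambda>v. coeff (T v) 0)"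
proof -
  interpret R: poisson_conformal_representation sP br mul sV rho l by fact
  interpret M: commutative_product_with_action sP mul sV l True
  proof (intro commutative_product_with_action.intro commutative_product_with_action_axioms.intro)
    show "mul a b = signed True (twist sP (mul b a))" for a b
      unfolding signed_def if_True by (rule R.P.assoc.comm) simp_all
  qed (rule R.P.assoc.conformal_product_axioms R.V.fg_module_axioms R.l_gc R.l_hom assms(4))+
  interpret B: commutative_product_with_action sP br sV rho False
  proof (intro commutative_product_with_action.intro commutative_product_with_action_axioms.intro)
    show "br a b = signed False (twist sP (br b a))" for a b
      unfolding signed_def if_False by (rule R.P.lie.skew) simp_all
  qed (rule R.P.lie.conformal_product_axioms R.V.fg_module_axioms R.rho_gc R.rho_hom assms(4))+
  have mulQ: "semidirect_mul cdual_scale mul (\<lambda>a f. - dual_action l a f) = M.semidirect"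
    by (simp add: fun_eq_iff semidirect_mul_def M.semidirect_def M.dual_def signed_def del: uminus_apply minus_apply)
  have brQ: "semidirect_br cdual_scale br (dual_action rho) = B.semidirect"
    by (simp add: fun_eq_iff semidirect_br_def B.semidirect_def B.dual_def signed_def del: uminus_apply minus_apply)
  define t where "t = tensor_of_chom sP sV T"
  define r where "r = incl_tensor t - flip (incl_tensor t)"
  have t: "t \<in> formal_sums (UNIV \<times> cdual sV)" and T: "chom_of_tensor sP t = T"
    unfolding t_def by (rule M.tensor_of_chom[OF assms(5)])+
  have r: "r \<in> formal_sums (M.Q \<times> M.Q)"
    unfolding r_def
    by (intro module.subspace_diff[OF module_fscale subspace_formal_sums] M.incl_tensor_in_formal_sums t)
  have T0: "coeff (T v) 0 =
      (\<Sum>i\<in>Poly_Mapping.keys t. sP [:Poly_Mapping.lookup t i:] (sP (snd i v) (fst i)))" for v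
    using M.coeff_0_chom_of_tensor[of t v] by (simp only: T)
  have subQ: "module.subspace M.sQ M.Q"
    using module.subspace_0[OF module_cdual_scale M.subspace_cdual_sV]
      module.subspace_add[OF module_cdual_scale M.subspace_cdual_sV]
      module.subspace_scale[OF module_cdual_scale M.subspace_cdual_sV]
    by (intro module.subspaceI[OF M.module_sQ]) (auto simp: zero_prod_def)
  have field: "module ((*) :: 'k \<Rightarrow> 'k \<Rightarrow> 'k)"
    by standard (simp_all add: algebra_simps)
  have ayb_sum: "ayb M.sQ M.semidirect r \<in> formal_sums (M.Q \<times> M.Q \<times> M.Q)"
    by (rule yb_in_formal_sums(2)[OF M.module_sQ subQ _ r]) (rule M.semidirect_closed)
  have cyb_sum: "cyb M.sQ B.semidirect r \<in> formal_sums (M.Q \<times> M.Q \<times> M.Q)"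
    by (rule yb_in_formal_sums(1)[OF M.module_sQ subQ _ r]) (rule B.semidirect_closed)
  have ayb: "in_der_image M.sQ M.Q (ayb M.sQ M.semidirect r) \<longleftrightarrow>
      (\<forall>u v. mul (coeff (T u) 0) (coeff (T v) 0) = map_poly (\<lambda>v. coeff (T v) 0) (l (coeff (T u) 0) v) +
        signed True (map_poly (\<lambda>v. coeff (T v) 0) (twist sV (l (coeff (T v) 0) u))))"
    by (rule M.in_der_image_iff_operator[OF t r_def T0 ayb_sum])
      (rule lin_ext_ayb[OF M.module_psP], assumption, rule lin_ext_ayb[OF field], assumption)
  have cyb: "in_der_image M.sQ M.Q (cyb M.sQ B.semidirect r) \<longleftrightarrow>
      (\<forall>u v. br (coeff (T u) 0) (coeff (T v) 0) = map_poly (\<lambda>v. coeff (T v) 0) (rho (coeff (T u) 0) v) +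
        signed False (map_poly (\<lambda>v. coeff (T v) 0) (twist sV (rho (coeff (T v) 0) u))))"
  proof (rule B.in_der_image_iff_operator[OF t r_def T0 cyb_sum])
    have sym: "B.semidirect x y = - twist M.sQ (B.semidirect y x)" for x y
      using B.semidirect_symmetric[of x y] unfolding signed_def if_False .
    show "lin_ext M.psP (uncurry3 \<tau>) (cyb M.sQ B.semidirect r) =
        lin_ext M.psP (\<lambda>p. lin_ext M.psP (yb_pair M.sQ B.semidirect \<tau> p) r) r"
      if "invariant_form M.sQ M.sQ M.sQ M.psP \<tau>" for \<tau>
      by (rule lin_ext_cyb[OF M.module_psP that M.module_sQ sym])
    show "lin_ext (*) (uncurry3 \<tau>) (cyb M.sQ B.semidirect r) =
        lin_ext (*) (\<lambda>p. lin_ext (*) (yb_pair M.sQ B.semidirect \<tau> p) r) r"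
      if "invariant_form M.sQ M.sQ M.sQ (*) \<tau>" for \<tau>
      by (rule lin_ext_cyb[OF field that M.module_sQ sym])
  qed
  show ?thesis
    unfolding Let_def mulQ brQ t_def[symmetric] r_def[symmetric] pcybe_solution_def O_operator_def ayb cyb
    using r skew_symmetric_diff_flip[of M.sQ M.Q "incl_tensor t", folded r_def] M.coeff_0_hom[OF assms(5)]
    by (auto simp: signed_def simp del: uminus_apply minus_apply)
qed

end
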